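(* Let $R$ be a Noetherian ring. Let $\mathcal P$ be a finite (possibly empty) subset of $\mathrm{Spec}(R)$. Let $E$ be a finitely generated $R$-module having a rank $e>0$. Let $s$ be an integer. Let $W$ be a submodule of $E$ such that $\mathrm{ht}(W:_R E)\ge s$. Suppose that $E$ satisfies $\mathrm{G}_s$. Then there exist elements $a_1,\dots,a_s$ in $W$ such that (1) $\mu\big((W/\sum_{j=1}^s Ra_j)_{\mathfrak p}\big)=\max\{0,\ \mu(W_{\mathfrak p})-s\}$ whenever $\mathfrak p\in\mathcal P$; (2) $\mathrm{ht}\big(\sum_{j=1}^i Ra_j:_R E\big)\ge i-e+1$ whenever $0\le i\le s$. In particular, if $s\ge e$, then there exists an $i$-residual intersection of $E$ for every $e\le i\le s$.
   Context: A finitely generated $R$-module $E$ has rank $e$ if $E\otimes_R \mathrm{Quot}(R)$ is free of rank $e$ over the total ring of quotients $\mathrm{Quot}(R)$. $\mu(-)$ denotes the minimal number of generators. For an integer $s\ge1$, a finitely generated module $E$ of rank $e$ satisfies $\mathrm{G}_s$ if $\mu(E_{\mathfrak p})\le\dim R_{\mathfrak p}+e-1$ for all primes $\mathfrak p$ with $1\le\dim R_{\mathfrak p}\le s-1$. For submodules $U\subseteq E$, $(U:_R E)=\{r\in R: rE\subseteq U\}$. $\mathrm{ht}$ denotes the height of an ideal. Residual intersections: let $E$ be a finitely generated $R$-module having a rank $e>0$ and let $i\ge e$ be an integer. A proper ideal $K$ of $R$ is called an $i$-residual intersection of $E$ if there is an $i$-generated submodule $U\subseteq E$ such that $K=(U:_R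 E)$ and $\mathrm{ht}(K)\ge i-e+1$. If $E$ is an ideal $I$ of $R$ of positive grade, one also assumes $i\ge\mathrm{ht}(I)$.
   Formalization: The final claim is stated for those i with i-e+1 ≤ dim R (and i ≥ ht(I) if E is an ideal I of positive grade), since an i-residual intersection is a proper ideal of height ≥ i-e+1; unrestricted it fails, e.g. for R a field, W = E = R^2, e = s = 2. Also s ≥ 0. *)

theory Defs
  imports "HOL-Algebra.Algebra" "HOL-Library.Extended_Nat"
begin

text \<open>
  Modules are records of type \<^typ>\<open>('a, 'b) module\<close>. Such a record extends the ring record, but its
  fields \<open>mult\<close> and \<open>one\<close> play no role for a module; they are left \<^const>\<open>undefined\<close> below.
\<close>

section \<open>Submodules, quotients, numbers of generators\<close>

definition span_module :: "('a, 'm) ring_scheme \<Rightarrow> ('a, 'b) module \<Rightarrow> 'b set \<Rightarrow> 'b set" where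
  "span_module R M A = (\<lambda>N. submodule N R M) hull A"

definition finitely_generated :: "('a, 'm) ring_scheme \<Rightarrow> ('a, 'b) module \<Rightarrow> bool" where
  "finitely_generated R M \<longleftrightarrow>
     (\<exists>A. finite A \<and> A \<subseteq> carrier M \<and> span_module R M A = carrier M)"

text \<open>The value is \<open>\<infinity>\<close> if the module is not finitely generated.\<close>

definition mu :: "('a, 'm) ring_scheme \<Rightarrow> ('a, 'b) module \<Rightarrow> enat" where
  "mu R M =
     (INF A \<in> {A. finite A \<and> A \<subseteq> carrier M \<and> span_module R M A = carrier M}. enat (card A))"

definition quotient_module :: "('a, 'b) module \<Rightarrow> 'b set \<Rightarrow> ('a, 'b set) module" where
  "quotient_module M N =
     \<lparr>carrier = a_rcosets\<^bsub>M\<^esub> N, monoid.mult = undefined, one = undefined,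
      ring.zero = N, ring.add = set_add M,
      module.smult = (\<lambda>r C. \<Union>x\<in>C. N +>\<^bsub>M\<^esub> (r \<odot>\<^bsub>M\<^esub> x))\<rparr>"

text \<open>An ideal \<open>I\<close> of \<open>R\<close> regarded as an \<open>R\<close>-module.\<close>

definition ideal_module :: "('a, 'm) ring_scheme \<Rightarrow> 'a set \<Rightarrow> ('a, 'a) module" where
  "ideal_module R I =
     \<lparr>carrier = I, monoid.mult = undefined, one = undefined,
      ring.zero = \<zero>\<^bsub>R\<^esub>, ring.add = (\<oplus>\<^bsub>R\<^esub>), module.smult = (\<otimes>\<^bsub>R\<^esub>)\<rparr>"

definition module_iso ::
    "('a, 'm) ring_scheme \<Rightarrow> ('a, 'b) module \<Rightarrow> ('a, 'c) module \<Rightarrow> ('b \<Rightarrow> 'c) \<Rightarrow> bool" where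
  "module_iso R M N f \<longleftrightarrow>
     bij_betw f (carrier M) (carrier N) \<and>
     (\<forall>x\<in>carrier M. \<forall>y\<in>carrier M. f (x \<oplus>\<^bsub>M\<^esub> y) = f x \<oplus>\<^bsub>N\<^esub> f y) \<and>
     (\<forall>r\<in>carrier R. \<forall>x\<in>carrier M. f (r \<odot>\<^bsub>M\<^esub> x) = r \<odot>\<^bsub>N\<^esub> f x)"

text \<open>The ideal \<open>(U :\<^sub>R E)\<close>.\<close>

definition colon :: "('a, 'm) ring_scheme \<Rightarrow> ('a, 'b) module \<Rightarrow> 'b set \<Rightarrow> 'a set" where
  "colon R E U = {r \<in> carrier R. \<forall>x\<in>carrier E. r \<odot>\<^bsub>E\<^esub> x \<in> U}"


section \<open>Localization at a multiplicative set\<close>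

definition frac_rel ::
    "('a, 'm) ring_scheme \<Rightarrow> 'a set \<Rightarrow> ('a, 'b) module \<Rightarrow> (('b \<times> 'a) \<times> ('b \<times> 'a)) set" where
  "frac_rel R S M =
     {((x, s), (y, t)). x \<in> carrier M \<and> s \<in> S \<and> y \<in> carrier M \<and> t \<in> S \<and>
        (\<exists>u\<in>S. u \<odot>\<^bsub>M\<^esub> (t \<odot>\<^bsub>M\<^esub> x) = u \<odot>\<^bsub>M\<^esub> (s \<odot>\<^bsub>M\<^esub> y))}"

definition frac ::
    "('a, 'm) ring_scheme \<Rightarrow> 'a set \<Rightarrow> ('a, 'b) module \<Rightarrow> 'b \<Rightarrow> 'a \<Rightarrow> ('b \<times> 'a) set" where
  "frac R S M x s = frac_rel R S M `` {(x, s)}"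

text \<open>
  The unions below are over all representatives of the given classes; as the operations do not
  depend on the representatives, each union is a single class.
\<close>

definition loc_module ::
    "('a, 'm) ring_scheme \<Rightarrow> 'a set \<Rightarrow> ('a, 'b) module \<Rightarrow> (('a \<times> 'a) set, ('b \<times> 'a) set) module" where
  "loc_module R S M =
     \<lparr>carrier = (carrier M \<times> S) // frac_rel R S M, monoid.mult = undefined, one = undefined,
      ring.zero = frac R S M \<zero>\<^bsub>M\<^esub> \<one>\<^bsub>R\<^esub>,
      ring.add = (\<lambda>C D. \<Union>(x, s)\<in>C. \<Union>(y, t)\<in>D.
               frac R S M (t \<odot>\<^bsub>M\<^esub> x \<oplus>\<^bsub>M\<^esub> s \<odot>\<^bsub>M\<^esub> y) (s \<otimes>\<^bsub>R\<^esub> t)),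
      module.smult = (\<lambda>A C. \<Union>(a, s)\<in>A. \<Union>(x, t)\<in>C. frac R S M (a \<odot>\<^bsub>M\<^esub> x) (s \<otimes>\<^bsub>R\<^esub> t))\<rparr>"

text \<open>
  The ring \<open>S\<^sup>-\<^sup>1R\<close> is obtained from \<open>R\<close> as a module over itself; scalar multiplication then is the
  multiplication of fractions.
\<close>

definition loc_ring :: "('a, 'm) ring_scheme \<Rightarrow> 'a set \<Rightarrow> ('a \<times> 'a) set ring" where
  "loc_ring R S =
     (let M = ideal_module R (carrier R); L = loc_module R S M in
      \<lparr>carrier = carrier L, monoid.mult = module.smult L, one = frac R S M \<one>\<^bsub>R\<^esub> \<one>\<^bsub>R\<^esub>,
       ring.zero = ring.zero L, ring.add = ring.add L\<rparr>)"

definition ring_at :: "('a, 'm) ring_scheme \<Rightarrow> 'a set \<Rightarrow> ('a \<times> 'a) set ring" where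
  "ring_at R p = loc_ring R (carrier R - p)"

definition module_at ::
    "('a, 'm) ring_scheme \<Rightarrow> 'a set \<Rightarrow> ('a, 'b) module \<Rightarrow> (('a \<times> 'a) set, ('b \<times> 'a) set) module" where
  "module_at R p M = loc_module R (carrier R - p) M"

abbreviation mu_at :: "('a, 'm) ring_scheme \<Rightarrow> 'a set \<Rightarrow> ('a, 'b) module \<Rightarrow> enat" where
  "mu_at R p M \<equiv> mu (ring_at R p) (module_at R p M)"


section \<open>Dimension, height, grade\<close>

definition prime_chain :: "('a, 'm) ring_scheme \<Rightarrow> (nat \<Rightarrow> 'a set) \<Rightarrow> nat \<Rightarrow> bool" where
  "prime_chain R c n \<longleftrightarrow> (\<forall>i\<le>n. primeideal (c i) R) \<and> (\<forall>i<n. c i \<subset> c (Suc i))"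

definition krull_dim :: "('a, 'm) ring_scheme \<Rightarrow> enat" where
  "krull_dim R = (SUP n \<in> {n. \<exists>c. prime_chain R c n}. enat n)"

definition height_prime :: "('a, 'm) ring_scheme \<Rightarrow> 'a set \<Rightarrow> enat" where
  "height_prime R p = (SUP n \<in> {n. \<exists>c. prime_chain R c n \<and> c n = p}. enat n)"

text \<open>The unit ideal has height \<open>\<infinity>\<close>, being contained in no prime ideal.\<close>

definition height :: "('a, 'm) ring_scheme \<Rightarrow> 'a set \<Rightarrow> enat" where
  "height R I = (INF p \<in> {p. primeideal p R \<and> I \<subseteq> p}. height_prime R p)"

text \<open>
  Nontriviality of the quotient by the sequence is not required: it is automatic for sequences in a
  proper ideal, and dropping it gives the unit ideal the conventional grade \<open>\<infinity>\<close>.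
\<close>

definition regular_sequence :: "('a, 'm) ring_scheme \<Rightarrow> 'a list \<Rightarrow> bool" where
  "regular_sequence R xs \<longleftrightarrow>
     set xs \<subseteq> carrier R \<and>
     (\<forall>i<length xs. \<forall>r\<in>carrier R.
        (xs ! i) \<otimes>\<^bsub>R\<^esub> r \<in> Idl\<^bsub>R\<^esub> (set (take i xs)) \<longrightarrow> r \<in> Idl\<^bsub>R\<^esub> (set (take i xs)))"

definition grade :: "('a, 'm) ring_scheme \<Rightarrow> 'a set \<Rightarrow> enat" where
  "grade R I = (SUP xs \<in> {xs. regular_sequence R xs \<and> set xs \<subseteq> I}. enat (length xs))"


section \<open>Rank\<close>

definition nonzerodivisors :: "('a, 'm) ring_scheme \<Rightarrow> 'a set" where
  "nonzerodivisors R =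
     {s \<in> carrier R. \<forall>x\<in>carrier R. s \<otimes>\<^bsub>R\<^esub> x = \<zero>\<^bsub>R\<^esub> \<longrightarrow> x = \<zero>\<^bsub>R\<^esub>}"

definition total_quot :: "('a, 'm) ring_scheme \<Rightarrow> ('a \<times> 'a) set ring" where
  "total_quot R = loc_ring R (nonzerodivisors R)"

definition to_total_quot :: "('a, 'm) ring_scheme \<Rightarrow> 'a \<Rightarrow> ('a \<times> 'a) set" where
  "to_total_quot R r = frac R (nonzerodivisors R) (ideal_module R (carrier R)) r \<one>\<^bsub>R\<^esub>"

text \<open>
  For a ring homomorphism \<open>f\<close> from \<open>R\<close> to \<open>Q\<close>, the tensor product of \<open>E\<close> and \<open>Q\<close> over \<open>R\<close> is the
  free abelian group on \<open>E \<times> Q\<close> modulo the bilinearity relations; \<open>Q\<close> acts on the second factor.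
\<close>

definition tensor_relations ::
    "('a, 'm) ring_scheme \<Rightarrow> ('a, 'b) module \<Rightarrow> ('q, 'n) ring_scheme \<Rightarrow> ('a \<Rightarrow> 'q) \<Rightarrow>
     (('b \<times> 'q) \<Rightarrow>\<^sub>0 int) set" where
  "tensor_relations R E Q f =
     {frag_of (x \<oplus>\<^bsub>E\<^esub> y, q) - frag_of (x, q) - frag_of (y, q) | x y q.
        x \<in> carrier E \<and> y \<in> carrier E \<and> q \<in> carrier Q} \<union>
     {frag_of (x, p \<oplus>\<^bsub>Q\<^esub> q) - frag_of (x, p) - frag_of (x, q) | x p q.
        x \<in> carrier E \<and> p \<in> carrier Q \<and> q \<in> carrier Q} \<union>
     {frag_of (r \<odot>\<^bsub>E\<^esub> x, q) - frag_of (x, f r \<otimes>\<^bsub>Q\<^esub> q) | r x q.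
        r \<in> carrier R \<and> x \<in> carrier E \<and> q \<in> carrier Q}"

definition base_change ::
    "('a, 'm) ring_scheme \<Rightarrow> ('a, 'b) module \<Rightarrow> ('q, 'n) ring_scheme \<Rightarrow> ('a \<Rightarrow> 'q) \<Rightarrow>
     ('q, (('b \<times> 'q) \<Rightarrow>\<^sub>0 int) set) module" where
  "base_change R E Q f =
     (let F = free_Abelian_group (carrier E \<times> carrier Q);
          H = generate F (tensor_relations R E Q f) in
      \<lparr>carrier = carrier (F Mod H), monoid.mult = undefined, one = undefined,
       ring.zero = \<one>\<^bsub>F Mod H\<^esub>, ring.add = (\<otimes>\<^bsub>F Mod H\<^esub>),
       module.smult = (\<lambda>q C. \<Union>z\<in>C. H #>\<^bsub>F\<^esub> frag_extend (\<lambda>(x, p). frag_of (x, q \<otimes>\<^bsub>Q\<^esub> p)) z)\<rparr>)"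

definition free_of_rank :: "('a, 'm) ring_scheme \<Rightarrow> ('a, 'b) module \<Rightarrow> nat \<Rightarrow> bool" where
  "free_of_rank R M n \<longleftrightarrow>
     (\<exists>b. b \<in> {..<n} \<rightarrow> carrier M \<and>
        bij_betw (\<lambda>c. \<Oplus>\<^bsub>M\<^esub>i\<in>{..<n}. c i \<odot>\<^bsub>M\<^esub> b i) ({..<n} \<rightarrow>\<^sub>E carrier R) (carrier M))"

definition has_rank :: "('a, 'm) ring_scheme \<Rightarrow> ('a, 'b) module \<Rightarrow> nat \<Rightarrow> bool" where
  "has_rank R E e \<longleftrightarrow>
     free_of_rank (total_quot R) (base_change R E (total_quot R) (to_total_quot R)) e"


section \<open>The condition \<open>G\<^sub>s\<close> and residual intersections\<close>

text \<open>Here \<open>e\<close> is the rank of \<open>E\<close>. For \<open>s = 0\<close> the condition is vacuous.\<close>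

definition G_cond :: "('a, 'm) ring_scheme \<Rightarrow> ('a, 'b) module \<Rightarrow> nat \<Rightarrow> nat \<Rightarrow> bool" where
  "G_cond R E e s \<longleftrightarrow>
     (\<forall>p. primeideal p R \<and> 1 \<le> krull_dim (ring_at R p) \<and> krull_dim (ring_at R p) \<le> enat (s - 1) \<longrightarrow>
        mu_at R p E \<le> krull_dim (ring_at R p) + enat e - 1)"

text \<open>
  \<open>K\<close> is an \<open>i\<close>-residual intersection of the module \<open>E\<close> of rank \<open>e\<close>. The last inequality is
  \<open>ht K \<ge> i - e + 1\<close>.
\<close>

definition residual_intersection ::
    "('a, 'm) ring_scheme \<Rightarrow> ('a, 'b) module \<Rightarrow> nat \<Rightarrow> nat \<Rightarrow> 'a set \<Rightarrow> bool" where
  "residual_intersection R E e i K \<longleftrightarrow>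
     e \<le> i \<and> ideal K R \<and> K \<noteq> carrier R \<and>
     (\<exists>u. u \<in> {1..i} \<rightarrow> carrier E \<and> K = colon R E (span_module R E (u ` {1..i}))) \<and>
     enat (i + 1) \<le> height R K + enat e"

text \<open>
  For ideals of positive grade the additional convention \<open>i \<ge> ht I\<close> is part of the notion. It depends
  on the ideal and not only on its isomorphism class as a module, whence a separate definition.
\<close>

definition ideal_residual_intersection ::
    "('a, 'm) ring_scheme \<Rightarrow> 'a set \<Rightarrow> nat \<Rightarrow> nat \<Rightarrow> 'a set \<Rightarrow> bool" where
  "ideal_residual_intersection R I e i K \<longleftrightarrow>
     residual_intersection R (ideal_module R I) e i K \<and>
     (0 < grade R I \<longrightarrow> height R I \<le> enat i)"

end

theory Submission
  imports Defs
begin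

text \<open>
  The number \<open>\<mu>((M/U)\<^sub>q)\<close> is the least \<open>n\<close> such that some \<open>f \<notin> q\<close> maps \<open>M\<close> into the span of \<open>U\<close> and
  \<open>n\<close> further elements; as a function of \<open>q\<close> it is upper semicontinuous. Choose \<open>a\<^sub>1, \<dots>, a\<^sub>s \<in> W\<close> one
  after the other, each of them a minimal generator of the quotient by its predecessors at finitely many
  primes: those in \<open>P\<close>, and those bad primes \<open>q\<close> where
  \<open>\<mu>((W/(a\<^sub>1, \<dots>, a\<^sub>i))\<^sub>q) = ht q + e - i > 0\<close>. The inequality \<open>\<mu>((W/(a\<^sub>1, \<dots>, a\<^sub>i))\<^sub>q) \<le> max 0 (ht q + e - i)\<close>
  for \<open>ht q \<le> s - e\<close> is thereby inherited from \<open>i\<close> to \<open>i + 1\<close>; it starts with \<open>G\<^sub>s\<close> and ends with the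
  bound on the heights. A bad prime is minimal in the closed set where \<open>\<mu>\<close> is at least \<open>ht q + e - i\<close>,
  because smaller primes have smaller height, so there are only finitely many of them. For the existence of
  residual intersections take \<open>W = p E\<close> with a prime \<open>p\<close> of sufficient height.
\<close>

section \<open>Submodules and spans\<close>

text \<open>The value h + e allowed at height h has two sources. At height 0 the condition
  \<open>G_cond\<close> says nothing; there the rank provides e generators, because a prime of
  height 0 contains no nonzerodivisor. At positive height \<open>G_cond\<close> even provides h + e
  - 1, but this would permit the same value e at heights 0 and 1, whereas the minimality of the bad
  primes rests on a bound that grows strictly with the height. The bound passes from E to W because
  e > 0: a prime of height at most s - e has height less than s, so it does not contain (W : E), and
  W and E have the same localization there. A residual intersection must moreover be a proper ideal.
  This is why its generators are taken in pE: by Nakayama's lemma at p, and because a module of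
  positive rank is faithful, pE differs from E.\<close>

lemma (in cring) idealI2:
  assumes "I \<subseteq> carrier R" "\<zero> \<in> I" "\<And>a b. a \<in> I \<Longrightarrow> b \<in> I \<Longrightarrow> a \<oplus> b \<in> I"
    and mult: "\<And>r a. r \<in> carrier R \<Longrightarrow> a \<in> I \<Longrightarrow> r \<otimes> a \<in> I"
  shows "ideal I R"
proof (rule idealI[OF ring_axioms])
  show "subgroup I (add_monoid R)"
  proof (rule add.subgroupI)
    fix a assume a: "a \<in> I"
    then have "(\<ominus> \<one>) \<otimes> a \<in> I" "a \<in> carrier R" using mult[of "\<ominus> \<one>" a] assms(1) by auto
    then show "\<ominus> a \<in> I" by (simp add: l_minus)
  qed (use assms in auto)
  show "\<And>a x. a \<in> I \<Longrightarrow> x \<in> carrier R \<Longrightarrow> x \<otimes> a \<in> I" using mult by blast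
  show "\<And>a x. a \<in> I \<Longrightarrow> x \<in> carrier R \<Longrightarrow> a \<otimes> x \<in> I"
    using mult assms(1) by (metis m_comm subsetD)
qed

text \<open>The locale \<^locale>\<open>module\<close> allows extended module records, the definitions of this development do not.\<close>

locale rmodule = module R M for R :: "('a, 'm) ring_scheme" (structure) and M :: "('a, 'b) module" (structure)
begin

lemma submoduleI2:
  assumes "H \<subseteq> carrier M" "\<zero>\<^bsub>M\<^esub> \<in> H"
    and "\<And>x y. \<lbrakk>x \<in> H; y \<in> H\<rbrakk> \<Longrightarrow> x \<oplus>\<^bsub>M\<^esub> y \<in> H"
    and "\<And>r x. \<lbrakk>r \<in> carrier R; x \<in> H\<rbrakk> \<Longrightarrow> r \<odot>\<^bsub>M\<^esub> x \<in> H"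
  shows "submodule H R M"
proof (rule submoduleI)
  fix x assume "x \<in> H"
  then have "(\<ominus> \<one>) \<odot>\<^bsub>M\<^esub> x \<in> H" and x: "x \<in> carrier M" using assms by auto
  moreover have "(\<ominus> \<one>) \<odot>\<^bsub>M\<^esub> x = \<ominus>\<^bsub>M\<^esub> x" using x by (simp add: smult_l_minus)
  ultimately show "\<ominus>\<^bsub>M\<^esub> x \<in> H" by simp
qed (use assms in auto)

lemma submodule_zero: "submodule H R M \<Longrightarrow> \<zero>\<^bsub>M\<^esub> \<in> H"
  using subgroup.one_closed[of H "add_monoid M"] by (simp add: submodule_def)

lemma submodule_add: "submodule H R M \<Longrightarrow> x \<in> H \<Longrightarrow> y \<in> H \<Longrightarrow> x \<oplus>\<^bsub>M\<^esub> y \<in> H"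
  by (rule submoduleE(5))

lemma submodule_smult: "submodule H R M \<Longrightarrow> r \<in> carrier R \<Longrightarrow> x \<in> H \<Longrightarrow> r \<odot>\<^bsub>M\<^esub> x \<in> H"
  by (rule submoduleE(4))

lemma submodule_minus:
  assumes "submodule H R M" "x \<in> H" "y \<in> H"
  shows "x \<ominus>\<^bsub>M\<^esub> y \<in> H"
  using assms submoduleE(3)[of H y] submodule_add[of H x "\<ominus>\<^bsub>M\<^esub> y"] by (simp add: a_minus_def)

lemma submodule_Inter:
  assumes "\<And>N. N \<in> \<N> \<Longrightarrow> submodule N R M" "\<N> \<noteq> {}"
  shows "submodule (\<Inter>\<N>) R M"
proof (rule submoduleI2)
  show "\<Inter>\<N> \<subseteq> carrier M" using assms submoduleE(1) by blast
qed (use assms submodule_zero submodule_add submodule_smult in blast)+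

lemma submodule_span:
  assumes "A \<subseteq> carrier M"
  shows "submodule (span_module R M A) R M"
  unfolding span_module_def hull_def
  using submodule_Inter[of "{N. submodule N R M \<and> A \<subseteq> N}"] carrier_is_submodule assms by blast

lemma span_subset: "A \<subseteq> span_module R M A"
  unfolding span_module_def by (rule hull_subset)

lemma span_superset: "x \<in> A \<Longrightarrow> x \<in> span_module R M A"
  using span_subset by auto

lemma span_mono: "A \<subseteq> B \<Longrightarrow> span_module R M A \<subseteq> span_module R M B"
  unfolding span_module_def by (rule hull_mono)

lemma span_minimal: "submodule N R M \<Longrightarrow> A \<subseteq> N \<Longrightarrow> span_module R M A \<subseteq> N"
  unfolding span_module_def by (rule hull_minimal)

lemma span_closed: "A \<subseteq> carrier M \<Longrightarrow> span_module R M A \<subseteq> carrier M"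
  by (rule span_minimal[OF carrier_is_submodule])

lemma span_Un_span: "span_module R M (A \<union> span_module R M B) = span_module R M (A \<union> B)"
  unfolding span_module_def by (rule hull_Un_right[symmetric])

lemma span_empty: "span_module R M {} = {\<zero>\<^bsub>M\<^esub>}"
proof -
  have "submodule {\<zero>\<^bsub>M\<^esub>} R M" by (rule submoduleI2) auto
  then show ?thesis
    using span_minimal[of "{\<zero>\<^bsub>M\<^esub>}" "{}"] submodule_zero[OF submodule_span[of "{}"]] by auto
qed

lemma span_insertE:
  assumes "x \<in> span_module R M (insert m A)" "m \<in> carrier M" "A \<subseteq> carrier M"
  obtains c y where "c \<in> carrier R" "y \<in> span_module R M A" "x = c \<odot>\<^bsub>M\<^esub> m \<oplus>\<^bsub>M\<^esub> y"
proof -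
  note sA = submodule_span[OF assms(3)] and cA = span_closed[OF assms(3)]
  let ?N = "{c \<odot>\<^bsub>M\<^esub> m \<oplus>\<^bsub>M\<^esub> y | c y. c \<in> carrier R \<and> y \<in> span_module R M A}"
  have "submodule ?N R M"
  proof (rule submoduleI2)
    show "?N \<subseteq> carrier M" using cA assms(2) by auto
    have "\<zero> \<odot>\<^bsub>M\<^esub> m \<oplus>\<^bsub>M\<^esub> \<zero>\<^bsub>M\<^esub> \<in> ?N" using submodule_zero[OF sA] by blast
    then show "\<zero>\<^bsub>M\<^esub> \<in> ?N" using assms(2) by simp
  next
    fix u v assume "u \<in> ?N" "v \<in> ?N"
    then obtain c y d z where *: "c \<in> carrier R" "y \<in> span_module R M A" "u = c \<odot>\<^bsub>M\<^esub> m \<oplus>\<^bsub>M\<^esub> y"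
      "d \<in> carrier R" "z \<in> span_module R M A" "v = d \<odot>\<^bsub>M\<^esub> m \<oplus>\<^bsub>M\<^esub> z" by blast
    then have yz: "y \<in> carrier M" "z \<in> carrier M" using cA by auto
    have "u \<oplus>\<^bsub>M\<^esub> v = (c \<oplus> d) \<odot>\<^bsub>M\<^esub> m \<oplus>\<^bsub>M\<^esub> (y \<oplus>\<^bsub>M\<^esub> z)"
      using * yz assms(2) by (simp add: smult_l_distr M.add.m_ac)
    then show "u \<oplus>\<^bsub>M\<^esub> v \<in> ?N" using * submodule_add[OF sA] by blast
  next
    fix r u assume r: "r \<in> carrier R" and "u \<in> ?N"
    then obtain c y where *: "c \<in> carrier R" "y \<in> span_module R M A" "u = c \<odot>\<^bsub>M\<^esub> m \<oplus>\<^bsub>M\<^esub> y"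
      by blast
    then have "y \<in> carrier M" using cA by auto
    then have "r \<odot>\<^bsub>M\<^esub> u = (r \<otimes> c) \<odot>\<^bsub>M\<^esub> m \<oplus>\<^bsub>M\<^esub> (r \<odot>\<^bsub>M\<^esub> y)"
      using * r assms(2) by (simp add: smult_r_distr smult_assoc1)
    then show "r \<odot>\<^bsub>M\<^esub> u \<in> ?N" using * r submodule_smult[OF sA] by blast
  qed
  moreover have "insert m A \<subseteq> ?N"
  proof
    fix z assume "z \<in> insert m A"
    then consider "z = m" | "z \<in> A" by auto
    then show "z \<in> ?N"
    proof cases
      case 1
      then have "z = \<one> \<odot>\<^bsub>M\<^esub> m \<oplus>\<^bsub>M\<^esub> \<zero>\<^bsub>M\<^esub>" using assms(2) by simp
      then show ?thesis using submodule_zero[OF sA] by blast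
    next
      case 2
      then have "z = \<zero> \<odot>\<^bsub>M\<^esub> m \<oplus>\<^bsub>M\<^esub> z" using assms(2,3) by auto
      then show ?thesis using span_superset[OF 2] by blast
    qed
  qed
  ultimately have "x \<in> ?N" using span_minimal assms(1) by blast
  then show thesis using that by blast
qed

text \<open>Lets \<open>W\<close> serve as the ambient module while spans are still formed in
  \<open>M\<close>, where the colon ideals of the final statement live.\<close>

lemma span_restrict:
  assumes W: "submodule W R M" and A: "A \<subseteq> W"
  shows "span_module R (M\<lparr>carrier := W\<rparr>) A = span_module R M A"
proof -
  interpret W: rmodule R "M\<lparr>carrier := W\<rparr>"
    using rmodule.intro submodule.submodule_is_module[OF W module_axioms] by auto
  have WM: "W \<subseteq> carrier M" using submoduleE(1)[OF W] .
  have "submodule (span_module R (M\<lparr>carrier := W\<rparr>) A) R M"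
  proof (rule submoduleI2)
    have s: "submodule (span_module R (M\<lparr>carrier := W\<rparr>) A) R (M\<lparr>carrier := W\<rparr>)"
      using W.submodule_span A by simp
    show "span_module R (M\<lparr>carrier := W\<rparr>) A \<subseteq> carrier M"
      using W.submoduleE(1)[OF s] WM by simp
    show "\<zero>\<^bsub>M\<^esub> \<in> span_module R (M\<lparr>carrier := W\<rparr>) A" using W.submodule_zero[OF s] by simp
  qed (use W.submodule_add[OF W.submodule_span] W.submodule_smult[OF W.submodule_span] A in auto)
  moreover have "submodule (span_module R M A) R (M\<lparr>carrier := W\<rparr>)"
  proof -
    have s: "submodule (span_module R M A) R M" using submodule_span A WM by simp
    show ?thesis
      by (rule W.submoduleI2)
        (use span_minimal[OF W A] submodule_zero[OF s] submodule_add[OF s] submodule_smult[OF s] in auto)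
  qed
  ultimately show ?thesis
    using span_minimal[of _ A] W.span_minimal[of _ A] span_subset[of A] W.span_subset[of A] by blast
qed

text \<open>Applied to an element \<open>g\<close> with \<open>g M \<subseteq> W\<close>: scaling
  moves generators of \<open>M\<close> into \<open>W\<close>, and the span of \<open>U\<close> is
  stable under \<open>g\<close>.\<close>

lemma span_scale:
  assumes "x \<in> span_module R M (A \<union> U)" "g \<in> carrier R" "A \<subseteq> carrier M" "U \<subseteq> carrier M"
  shows "g \<odot>\<^bsub>M\<^esub> x \<in> span_module R M ((\<lambda>a. g \<odot>\<^bsub>M\<^esub> a) ` A \<union> U)"
proof -
  let ?S = "span_module R M ((\<lambda>a. g \<odot>\<^bsub>M\<^esub> a) ` A \<union> U)"
  have s: "submodule ?S R M" by (rule submodule_span) (use assms in auto)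
  have "submodule {x \<in> carrier M. g \<odot>\<^bsub>M\<^esub> x \<in> ?S} R M"
  proof (rule submoduleI2)
    fix r x assume *: "r \<in> carrier R" "x \<in> {x \<in> carrier M. g \<odot>\<^bsub>M\<^esub> x \<in> ?S}"
    then have "g \<odot>\<^bsub>M\<^esub> (r \<odot>\<^bsub>M\<^esub> x) = r \<odot>\<^bsub>M\<^esub> (g \<odot>\<^bsub>M\<^esub> x)"
      using assms(2) by (metis (mono_tags, lifting) R.m_comm mem_Collect_eq smult_assoc1)
    then show "r \<odot>\<^bsub>M\<^esub> x \<in> {x \<in> carrier M. g \<odot>\<^bsub>M\<^esub> x \<in> ?S}"
      using * submodule_smult[OF s] by auto
  qed (use assms(2) submodule_zero[OF s] submodule_add[OF s] in \<open>auto simp: smult_r_distr\<close>)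
  moreover have "A \<union> U \<subseteq> {x \<in> carrier M. g \<odot>\<^bsub>M\<^esub> x \<in> ?S}"
    using assms span_superset[of _ "(\<lambda>a. g \<odot>\<^bsub>M\<^esub> a) ` A \<union> U"] submodule_smult[OF s] by auto
  ultimately show ?thesis using span_minimal assms(1) by blast
qed

lemma submodule_colonI:
  assumes "submodule N R M" "r \<in> carrier R"
  shows "submodule {x \<in> carrier M. r \<odot>\<^bsub>M\<^esub> x \<in> N} R M"
proof (rule submoduleI2)
  fix s x assume *: "s \<in> carrier R" "x \<in> {x \<in> carrier M. r \<odot>\<^bsub>M\<^esub> x \<in> N}"
  then have "r \<odot>\<^bsub>M\<^esub> (s \<odot>\<^bsub>M\<^esub> x) = s \<odot>\<^bsub>M\<^esub> (r \<odot>\<^bsub>M\<^esub> x)"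
    using assms(2) by (metis (mono_tags, lifting) R.m_comm mem_Collect_eq smult_assoc1)
  then show "s \<odot>\<^bsub>M\<^esub> x \<in> {x \<in> carrier M. r \<odot>\<^bsub>M\<^esub> x \<in> N}"
    using * submodule_smult[OF assms(1)] by auto
qed (use assms submodule_zero submodule_add in \<open>auto simp: smult_r_distr\<close>)

lemma colon_ideal:
  assumes "submodule N R M"
  shows "ideal (colon R M N) R"
proof (rule R.idealI2)
  note N = submodule_zero[OF assms] submodule_add[OF assms] submodule_smult[OF assms]
  show "\<zero> \<in> colon R M N" using N by (simp add: colon_def)
  show "a \<oplus> b \<in> colon R M N" if "a \<in> colon R M N" "b \<in> colon R M N" for a b
    using that N by (simp add: colon_def smult_l_distr)
  show "r \<otimes> a \<in> colon R M N" if "r \<in> carrier R" "a \<in> colon R M N" for r a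
    using that N by (simp add: colon_def smult_assoc1)
qed (auto simp: colon_def)

end

lemma primeideal_compl_mult:
  assumes "primeideal p R" "f \<in> carrier R - p" "g \<in> carrier R - p"
  shows "f \<otimes>\<^bsub>R\<^esub> g \<in> carrier R - p"
proof -
  interpret primeideal p R by fact
  show ?thesis using assms I_prime by auto
qed

lemma primeideal_compl_one:
  assumes "primeideal p R"
  shows "\<one>\<^bsub>R\<^esub> \<in> carrier R - p"
proof -
  interpret primeideal p R by fact
  show ?thesis using one_imp_carrier I_notcarr by auto
qed

section \<open>Noetherian rings\<close>

locale noetherian_cring = noetherian_ring + cring
begin

text \<open>Zorn's lemma applies because the union of a nonempty chain of ideals is itself a member
  of the chain.\<close>

lemma maximal_idealE:
  assumes "\<A> \<noteq> {}" "\<And>I. I \<in> \<A> \<Longrightarrow> ideal I R"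
  obtains I where "I \<in> \<A>" "\<And>J. J \<in> \<A> \<Longrightarrow> I \<subseteq> J \<Longrightarrow> J = I"
proof -
  have "\<Union>\<C> \<in> \<A>" if "\<C> \<noteq> {}" "subset.chain \<A> \<C>" for \<C>
  proof -
    have "subset.chain {I. ideal I R} \<C>" and "\<C> \<subseteq> \<A>"
      using that(2) assms(2) by (auto simp: pred_on.chain_def)
    then show ?thesis using ideal_chain_is_trivial[OF that(1)] by blast
  qed
  from subset_Zorn_nonempty[OF assms(1) this] show thesis using that by blast
qed

lemma ideal_adjoin:
  assumes "ideal I R" "a \<in> carrier R"
  shows "ideal (I <+>\<^bsub>R\<^esub> PIdl a) R" "I \<subseteq> I <+>\<^bsub>R\<^esub> PIdl a" "a \<in> I <+>\<^bsub>R\<^esub> PIdl a"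
proof -
  interpret I: ideal I R by fact
  show "ideal (I <+>\<^bsub>R\<^esub> PIdl a) R" using add_ideals[OF assms(1) cgenideal_ideal] assms(2) .
  interpret A: ideal "PIdl a" R using cgenideal_ideal[OF assms(2)] .
  show "I \<subseteq> I <+>\<^bsub>R\<^esub> PIdl a"
  proof
    fix x assume x: "x \<in> I"
    then have "x = x \<oplus> \<zero>" using I.Icarr by simp
    then show "x \<in> I <+>\<^bsub>R\<^esub> PIdl a" using x A.zero_closed unfolding set_add_def' by blast
  qed
  have "a = \<zero> \<oplus> a" using assms(2) by simp
  then show "a \<in> I <+>\<^bsub>R\<^esub> PIdl a"
    using I.zero_closed cgenideal_self[OF assms(2)] unfolding set_add_def' by blast
qed

lemma ideal_adjoin_mult:
  assumes "ideal I R" "a \<in> carrier R" "b \<in> carrier R" "a \<otimes> b \<in> I"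
    and "x \<in> I <+>\<^bsub>R\<^esub> PIdl a" "y \<in> I <+>\<^bsub>R\<^esub> PIdl b"
  shows "x \<otimes> y \<in> I"
proof -
  interpret I: ideal I R by fact
  obtain u r v s where *: "u \<in> I" "v \<in> I" "r \<in> carrier R" "s \<in> carrier R"
    "x = u \<oplus> r \<otimes> a" "y = v \<oplus> s \<otimes> b"
    using assms(5,6) unfolding set_add_def' cgenideal_def by auto
  have uv: "u \<in> carrier R" "v \<in> carrier R" using * I.Icarr by auto
  have "x \<otimes> y = u \<otimes> y \<oplus> (r \<otimes> a \<otimes> v \<oplus> (r \<otimes> s) \<otimes> (a \<otimes> b))"
    using * uv assms(2,3) by (simp add: l_distr r_distr m_ac a_ac)
  moreover have "y \<in> carrier R" using * uv assms(3) by simp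
  ultimately show ?thesis
    using * uv assms by (simp add: I.I_l_closed I.I_r_closed I.a_closed)
qed

text \<open>An ideal \<open>p\<close> maximal among those that contain \<open>J\<close> and avoid
  \<open>S\<close> is prime: if \<open>a\<close> and \<open>b\<close> lie outside \<open>p\<close>,
  both enlarged ideals meet \<open>S\<close>, and with \<open>a \<otimes> b \<in> p\<close> the
  product of two common elements would lie in \<open>p\<close> and in \<open>S\<close>.\<close>

lemma primeideal_avoidingE:
  assumes "ideal J R" "J \<inter> S = {}" "\<one> \<in> S" "S \<subseteq> carrier R"
    and "\<And>x y. x \<in> S \<Longrightarrow> y \<in> S \<Longrightarrow> x \<otimes> y \<in> S"
  obtains p where "primeideal p R" "J \<subseteq> p" "p \<inter> S = {}"
proof -
  let ?\<A> = "{I. ideal I R \<and> J \<subseteq> I \<and> I \<inter> S = {}}"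
  have "?\<A> \<noteq> {}" using assms by auto
  then obtain p where p: "ideal p R" "J \<subseteq> p" "p \<inter> S = {}"
    and max: "\<And>I. I \<in> ?\<A> \<Longrightarrow> p \<subseteq> I \<Longrightarrow> I = p"
    by (rule maximal_idealE) auto
  have "primeideal p R"
  proof (rule primeidealI[OF p(1) is_cring])
    show "carrier R \<noteq> p" using p(3) assms(3) by auto
  next
    fix a b assume ab: "a \<in> carrier R" "b \<in> carrier R" "a \<otimes> b \<in> p"
    show "a \<in> p \<or> b \<in> p"
    proof (rule ccontr)
      assume n: "\<not> (a \<in> p \<or> b \<in> p)"
      have "\<exists>x. x \<in> (p <+>\<^bsub>R\<^esub> PIdl c) \<inter> S" if "c \<in> carrier R" "c \<notin> p" for c
      proof -
        note adj = ideal_adjoin[OF p(1) that(1)]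
        have "p <+>\<^bsub>R\<^esub> PIdl c \<noteq> p" using adj(3) that(2) by auto
        then have "p <+>\<^bsub>R\<^esub> PIdl c \<notin> ?\<A>" using max[OF _ adj(2)] by blast
        then show ?thesis using adj(1,2) p(2) by auto
      qed
      then obtain x y where "x \<in> (p <+>\<^bsub>R\<^esub> PIdl a) \<inter> S" "y \<in> (p <+>\<^bsub>R\<^esub> PIdl b) \<inter> S"
        using ab n by meson
      then show False using ideal_adjoin_mult[OF p(1) ab, of x y] assms(5)[of x y] p(3) by auto
    qed
  qed
  then show thesis using that p by blast
qed

text \<open>Noetherian induction: a maximal counterexample \<open>I\<close> is neither prime nor the
  unit ideal, so it contains a product of two elements \<open>a\<close> and \<open>b\<close> outside
  it. Every prime over \<open>I\<close> lies over \<open>I + (a)\<close> or over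
  \<open>I + (b)\<close>, and the union of the two families serves \<open>I\<close>.\<close>

lemma finite_minimal_primes:
  assumes "ideal J R"
  shows "\<exists>F. finite F \<and> (\<forall>p\<in>F. primeideal p R \<and> J \<subseteq> p) \<and>
             (\<forall>q. primeideal q R \<and> J \<subseteq> q \<longrightarrow> (\<exists>p\<in>F. p \<subseteq> q))" (is "?good J")
proof (rule ccontr)
  assume "\<not> ?good J"
  then have "{J. ideal J R \<and> \<not> ?good J} \<noteq> {}" using assms by blast
  then obtain I where I: "ideal I R" "\<not> ?good I"
    and max: "\<And>J. J \<in> {J. ideal J R \<and> \<not> ?good J} \<Longrightarrow> I \<subseteq> J \<Longrightarrow> J = I"
    by (rule maximal_idealE) auto
  interpret I: ideal I R by fact
  have "\<not> primeideal I R"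
  proof
    assume "primeideal I R"
    then have "?good I" by (intro exI[of _ "{I}"]) auto
    with I show False by simp
  qed
  moreover have "carrier R \<noteq> I"
  proof
    assume eq: "carrier R = I"
    have "\<not> I \<subseteq> q" if "primeideal q R" for q
    proof -
      interpret primeideal q R by fact
      show ?thesis using I_notcarr a_subset eq by auto
    qed
    then have "?good I" by (intro exI[of _ "{}"]) auto
    with I show False by simp
  qed
  ultimately obtain a b where ab: "a \<in> carrier R" "b \<in> carrier R" "a \<otimes> b \<in> I" "a \<notin> I" "b \<notin> I"
    using I.primeidealCE[OF is_cring] by metis
  have good: "?good (I <+>\<^bsub>R\<^esub> PIdl c)" if "c \<in> carrier R" "c \<notin> I" for c
  proof -
    note adj = ideal_adjoin[OF I(1) that(1)]
    have "I <+>\<^bsub>R\<^esub> PIdl c \<noteq> I" using adj(3) that(2) by auto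
    then have "I <+>\<^bsub>R\<^esub> PIdl c \<notin> {J. ideal J R \<and> \<not> ?good J}" using max[OF _ adj(2)] by blast
    then show ?thesis using adj(1) by blast
  qed
  obtain F where F: "finite F" "\<forall>p\<in>F. primeideal p R \<and> I <+>\<^bsub>R\<^esub> PIdl a \<subseteq> p"
      "\<forall>q. primeideal q R \<and> I <+>\<^bsub>R\<^esub> PIdl a \<subseteq> q \<longrightarrow> (\<exists>p\<in>F. p \<subseteq> q)"
    using good[OF ab(1,4)] by auto
  obtain G where G: "finite G" "\<forall>p\<in>G. primeideal p R \<and> I <+>\<^bsub>R\<^esub> PIdl b \<subseteq> p"
      "\<forall>q. primeideal q R \<and> I <+>\<^bsub>R\<^esub> PIdl b \<subseteq> q \<longrightarrow> (\<exists>p\<in>G. p \<subseteq> q)"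
    using good[OF ab(2,5)] by auto
  have "I <+>\<^bsub>R\<^esub> PIdl a \<subseteq> q \<or> I <+>\<^bsub>R\<^esub> PIdl b \<subseteq> q" if q: "primeideal q R" "I \<subseteq> q" for q
  proof -
    interpret q: primeideal q R by fact
    have incl: "I <+>\<^bsub>R\<^esub> PIdl c \<subseteq> q" if "c \<in> q" for c
      using that q(2) q.I_l_closed unfolding set_add_def' cgenideal_def
      by (auto intro!: q.a_closed)
    show ?thesis using q.I_prime[of a b] ab q(2) incl by blast
  qed
  then have "\<forall>q. primeideal q R \<and> I \<subseteq> q \<longrightarrow> (\<exists>p\<in>F \<union> G. p \<subseteq> q)"
    using F(3) G(3) by (meson UnCI)
  moreover have "\<forall>p\<in>F \<union> G. primeideal p R \<and> I \<subseteq> p"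
    using F(2) G(2) ideal_adjoin(2)[OF I(1)] ab by (meson Un_iff subset_trans)
  ultimately have "?good I"
    using F(1) G(1) by (intro exI[of _ "F \<union> G"]) simp
  with I show False by simp
qed

end

text \<open>The element is a product with one factor in \<open>p - q\<close> for each
  \<open>p \<in> Q\<close>; it stays outside \<open>q\<close> because \<open>q\<close> is
  prime.\<close>

lemma finite_avoidE:
  assumes q: "primeideal q R" and Q: "finite Q"
    and "\<And>p. p \<in> Q \<Longrightarrow> primeideal p R \<and> \<not> p \<subseteq> q"
  obtains r where "r \<in> carrier R - q" "\<And>p. p \<in> Q \<Longrightarrow> r \<in> p"
proof -
  interpret q: primeideal q R by fact
  have "\<exists>r\<in>carrier R - q. \<forall>p\<in>Q. r \<in> p" using Q assms(3)
  proof (induction Q)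
    case empty
    then show ?case using primeideal_compl_one[OF q] by auto
  next
    case (insert p Q)
    then obtain r where r: "r \<in> carrier R - q" "\<forall>p\<in>Q. r \<in> p" by auto
    interpret p: primeideal p R using insert.prems by auto
    obtain t where t: "t \<in> p" "t \<in> carrier R - q" using insert.prems p.Icarr by blast
    have "r \<otimes>\<^bsub>R\<^esub> t \<in> p'" if "p' \<in> insert p Q" for p'
    proof -
      interpret p': primeideal p' R using insert.prems that by auto
      show ?thesis using that r t p'.I_l_closed[of t r] p'.I_r_closed[of r t] by auto
    qed
    then show ?case using primeideal_compl_mult[OF q r(1) t(2)] by blast
  qed
  then show thesis using that by blast
qed

section \<open>Local numbers of generators\<close>

text \<open>This expresses \<open>\<mu>((M/U)\<^sub>p) \<le> n\<close> without localizing; see \<open>mu_at_le_iff\<close> and \<open>gens_at_quotient\<close>.\<close>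

definition gens_at ::
    "('a, 'm) ring_scheme \<Rightarrow> ('a, 'b) module \<Rightarrow> 'a set \<Rightarrow> 'b set \<Rightarrow> nat \<Rightarrow> bool" where
  "gens_at R M p U n \<longleftrightarrow>
     (\<exists>A. finite A \<and> A \<subseteq> carrier M \<and> card A \<le> n \<and> \<not> colon R M (span_module R M (A \<union> U)) \<subseteq> p)"

context rmodule
begin

lemma gens_at_mono:
  assumes "gens_at R M p U n" "U \<subseteq> V" "n \<le> k"
  shows "gens_at R M p V k"
proof -
  obtain A where A: "finite A" "A \<subseteq> carrier M" "card A \<le> n"
      "\<not> colon R M (span_module R M (A \<union> U)) \<subseteq> p"
    using assms(1) by (auto simp: gens_at_def)
  have "colon R M (span_module R M (A \<union> U)) \<subseteq> colon R M (span_module R M (A \<union> V))"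
    using span_mono[of "A \<union> U" "A \<union> V"] assms(2) by (auto simp: colon_def)
  then show ?thesis
    unfolding gens_at_def using A assms(3) by (intro exI[of _ A]) auto
qed

lemma gens_atE:
  assumes "gens_at R M p U n"
  obtains A h where "finite A" "A \<subseteq> carrier M" "card A \<le> n" "h \<in> carrier R - p"
    "\<And>x. x \<in> carrier M \<Longrightarrow> h \<odot>\<^bsub>M\<^esub> x \<in> span_module R M (A \<union> U)"
  using assms unfolding gens_at_def colon_def by blast

lemma gens_atI:
  assumes "finite A" "A \<subseteq> carrier M" "card A \<le> n" "h \<in> carrier R - p"
    "\<And>x. x \<in> carrier M \<Longrightarrow> h \<odot>\<^bsub>M\<^esub> x \<in> span_module R M (A \<union> U)"
  shows "gens_at R M p U n"
  using assms unfolding gens_at_def colon_def by blast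

text \<open>Linear algebra over the residue field in explicit form: either all coefficients on
  \<open>A\<close> can be taken in \<open>q\<close>, or some coefficient is a unit at
  \<open>q\<close> and its generator can be traded for \<open>x\<close>.\<close>

lemma span_finite_cases:
  assumes "finite A" "A \<subseteq> carrier M" "U \<subseteq> carrier M" "q \<subseteq> carrier R"
    and "x \<in> span_module R M (A \<union> U)"
  shows "x \<in> span_module R M ({c \<odot>\<^bsub>M\<^esub> m | c m. c \<in> q \<and> m \<in> A} \<union> U) \<or>
     (\<exists>m\<in>A. \<exists>c\<in>carrier R - q. \<exists>y\<in>span_module R M ((A - {m}) \<union> U). x = c \<odot>\<^bsub>M\<^esub> m \<oplus>\<^bsub>M\<^esub> y)"
  using assms(1,2,5)
proof (induction A arbitrary: x)
  case empty
  then show ?case by simp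
next
  case (insert m A)
  let ?T = "\<lambda>A. {c \<odot>\<^bsub>M\<^esub> m | c m. c \<in> q \<and> m \<in> A} \<union> U"
  have m: "m \<in> carrier M" and AU: "A \<union> U \<subseteq> carrier M" using insert.prems assms(3) by auto
  have T: "?T (insert m A) \<subseteq> carrier M" using insert.prems assms(3,4) by auto
  obtain c y where cy: "c \<in> carrier R" "y \<in> span_module R M (A \<union> U)" "x = c \<odot>\<^bsub>M\<^esub> m \<oplus>\<^bsub>M\<^esub> y"
    using span_insertE[of x m "A \<union> U"] insert.prems m AU by auto
  show ?case
  proof (cases "c \<in> q")
    case False
    have "insert m A - {m} = A" using insert.hyps by auto
    then show ?thesis using False cy by auto
  next
    case True
    have cm: "c \<odot>\<^bsub>M\<^esub> m \<in> span_module R M (?T (insert m A))"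
      using True by (intro span_superset) auto
    from insert.IH[OF _ cy(2)] insert.prems(1) consider
      "y \<in> span_module R M (?T A)" |
      m' d z where "m' \<in> A" "d \<in> carrier R - q" "z \<in> span_module R M ((A - {m'}) \<union> U)"
        "y = d \<odot>\<^bsub>M\<^esub> m' \<oplus>\<^bsub>M\<^esub> z" by auto
    then show ?thesis
    proof cases
      case 1
      then have "y \<in> span_module R M (?T (insert m A))"
        using span_mono[of "?T A" "?T (insert m A)"] by blast
      then show ?thesis using cm cy(3) submodule_add[OF submodule_span[OF T]] by blast
    next
      case 2
      \<comment> \<open>The pivot \<open>m'\<close> found in \<open>A\<close> differs from
        \<open>m\<close>, so the term with coefficient \<open>c\<close> can be absorbed into the
        remainder.\<close>
      let ?S = "span_module R M ((insert m A - {m'}) \<union> U)"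
      have S: "submodule ?S R M" by (rule submodule_span) (use insert.prems assms(3) in auto)
      have "m \<in> insert m A - {m'}" using 2(1) insert.hyps by auto
      then have "c \<odot>\<^bsub>M\<^esub> m \<in> ?S"
        using submodule_smult[OF S cy(1)] span_superset[of m "(insert m A - {m'}) \<union> U"] by blast
      moreover have "z \<in> ?S"
        using 2(3) span_mono[of "(A - {m'}) \<union> U" "(insert m A - {m'}) \<union> U"] by blast
      ultimately have "c \<odot>\<^bsub>M\<^esub> m \<oplus>\<^bsub>M\<^esub> z \<in> ?S" using submodule_add[OF S] by blast
      moreover have "x = d \<odot>\<^bsub>M\<^esub> m' \<oplus>\<^bsub>M\<^esub> (c \<odot>\<^bsub>M\<^esub> m \<oplus>\<^bsub>M\<^esub> z)"
      proof -
        have "m' \<in> carrier M" using 2(1) AU by auto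
        moreover have "z \<in> carrier M" using submoduleE(1)[OF S] \<open>z \<in> ?S\<close> by blast
        ultimately show ?thesis using cy(1,3) 2(2,4) m by (simp add: M.a_ac)
      qed
      ultimately show ?thesis using 2(1,2) by blast
    qed
  qed
qed

text \<open>\<open>c\<close> is a unit at \<open>q\<close>, so \<open>m\<close> is redundant modulo
  \<open>V\<close> and the other generators; the multiplier \<open>c \<otimes> h\<close> clears the
  denominator. \<open>V\<close> may exceed \<open>U\<close>, so that a new element can take the
  place of \<open>m\<close>.\<close>

lemma gens_at_eliminate:
  assumes q: "primeideal q R" and A: "finite A" "A \<subseteq> carrier M" "m \<in> A"
    and U: "U \<subseteq> V" "V \<subseteq> carrier M"
    and h: "h \<in> carrier R - q" "\<And>x. x \<in> carrier M \<Longrightarrow> h \<odot>\<^bsub>M\<^esub> x \<in> span_module R M (A \<union> U)"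
    and c: "c \<in> carrier R - q" "c \<odot>\<^bsub>M\<^esub> m \<in> span_module R M ((A - {m}) \<union> V)"
  shows "gens_at R M q V (card A - 1)"
proof (rule gens_atI[of "A - {m}" _ "c \<otimes> h"])
  let ?S = "span_module R M ((A - {m}) \<union> V)"
  have S: "submodule ?S R M" using A U by (intro submodule_span) auto
  show "c \<otimes> h \<odot>\<^bsub>M\<^esub> x \<in> ?S" if x: "x \<in> carrier M" for x
  proof -
    have "h \<odot>\<^bsub>M\<^esub> x \<in> span_module R M (insert m ((A - {m}) \<union> V))"
      using h(2)[OF x] span_mono[of "A \<union> U" "insert m ((A - {m}) \<union> V)"] U A by blast
    then obtain d y where dy: "d \<in> carrier R" "y \<in> ?S" "h \<odot>\<^bsub>M\<^esub> x = d \<odot>\<^bsub>M\<^esub> m \<oplus>\<^bsub>M\<^esub> y"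
      by (rule span_insertE) (use A U in auto)
    have y: "y \<in> carrier M" using dy(2) submoduleE(1)[OF S] by blast
    have m: "m \<in> carrier M" using A by auto
    have "c \<otimes> h \<odot>\<^bsub>M\<^esub> x = c \<odot>\<^bsub>M\<^esub> (d \<odot>\<^bsub>M\<^esub> m \<oplus>\<^bsub>M\<^esub> y)"
      using c(1) h(1) x dy(3) by (simp add: smult_assoc1)
    also have "\<dots> = d \<odot>\<^bsub>M\<^esub> (c \<odot>\<^bsub>M\<^esub> m) \<oplus>\<^bsub>M\<^esub> c \<odot>\<^bsub>M\<^esub> y"
      using c(1) dy(1) y m by (simp add: smult_r_distr R.m_comm flip: smult_assoc1)
    also have "\<dots> \<in> ?S"
      using submodule_add[OF S] submodule_smult[OF S] c dy(1,2) by auto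
    finally show ?thesis .
  qed
qed (use A primeideal_compl_mult[OF q c(1) h(1)] in auto)

text \<open>Below, \<open>N\<close> is the preimage in \<open>M\<close> of the submodule \<open>qM\<^sub>q + U\<^sub>q\<close> of \<open>M\<^sub>q\<close>.\<close>

lemma gens_at_dropE:
  assumes q: "primeideal q R" and U: "U \<subseteq> carrier M"
    and gens: "gens_at R M q U (Suc n)" "\<not> gens_at R M q U n"
  obtains N where "submodule N R M" "N \<noteq> carrier M"
    "\<And>r x. r \<in> q \<Longrightarrow> x \<in> carrier M \<Longrightarrow> r \<odot>\<^bsub>M\<^esub> x \<in> N"
    "\<And>r x. r \<in> carrier R - q \<Longrightarrow> x \<in> carrier M \<Longrightarrow> r \<odot>\<^bsub>M\<^esub> x \<in> N \<Longrightarrow> x \<in> N"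
    "\<And>a. a \<in> carrier M - N \<Longrightarrow> gens_at R M q (insert a U) n"
proof -
  interpret q: primeideal q R by fact
  obtain A h where A: "finite A" "A \<subseteq> carrier M" "card A \<le> Suc n" and h: "h \<in> carrier R - q"
    "\<And>x. x \<in> carrier M \<Longrightarrow> h \<odot>\<^bsub>M\<^esub> x \<in> span_module R M (A \<union> U)"
    by (rule gens_atE[OF gens(1)]) (rule that)
  have "\<not> card A \<le> n" using gens_atI[OF A(1,2) _ h] gens(2) by blast
  then have cA: "card A = Suc n" using A(3) by simp
  then obtain m where mA: "m \<in> A" by fastforce
  \<comment> \<open>The number of generators at \<open>q\<close> is minimal, so none of them can be
    eliminated.\<close>
  have elim: "\<not> c \<odot>\<^bsub>M\<^esub> m \<in> span_module R M ((A - {m}) \<union> U)" if "c \<in> carrier R - q" for c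
    using gens_at_eliminate[OF q A(1,2) mA _ U h that] gens(2) cA by auto
  have m: "m \<in> carrier M" using mA A by auto
  \<comment> \<open>Since \<open>A\<close> and \<open>U\<close> together generate \<open>M\<close>
    at \<open>q\<close>, the products of \<open>q\<close> with \<open>A\<close> generate
    \<open>q M\<close> modulo \<open>U\<close> there.\<close>
  let ?T = "{c \<odot>\<^bsub>M\<^esub> m | c m. c \<in> q \<and> m \<in> A} \<union> U"
  have T: "?T \<subseteq> carrier M" using A U q.Icarr by auto
  note S = submodule_span[OF T]
  define N where "N = {x \<in> carrier M. \<exists>f\<in>carrier R - q. f \<odot>\<^bsub>M\<^esub> x \<in> span_module R M ?T}"
  show thesis
  proof (rule that[of N])
    show "submodule N R M"
    proof (rule submoduleI2)
      show "\<zero>\<^bsub>M\<^esub> \<in> N"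
        unfolding N_def using primeideal_compl_one[OF q] submodule_zero[OF S] by auto
    next
      fix x y assume "x \<in> N" "y \<in> N"
      then obtain f g where *: "x \<in> carrier M" "y \<in> carrier M" "f \<in> carrier R - q" "g \<in> carrier R - q"
        "f \<odot>\<^bsub>M\<^esub> x \<in> span_module R M ?T" "g \<odot>\<^bsub>M\<^esub> y \<in> span_module R M ?T" by (auto simp: N_def)
      have "(f \<otimes> g) \<odot>\<^bsub>M\<^esub> (x \<oplus>\<^bsub>M\<^esub> y) = g \<odot>\<^bsub>M\<^esub> (f \<odot>\<^bsub>M\<^esub> x) \<oplus>\<^bsub>M\<^esub> f \<odot>\<^bsub>M\<^esub> (g \<odot>\<^bsub>M\<^esub> y)"
        using * by (simp add: smult_r_distr R.m_comm flip: smult_assoc1)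
      also have "\<dots> \<in> span_module R M ?T"
        using * submodule_add[OF S] submodule_smult[OF S] by auto
      finally show "x \<oplus>\<^bsub>M\<^esub> y \<in> N"
        using * primeideal_compl_mult[OF q *(3,4)] by (auto simp: N_def)
    next
      fix r x assume r: "r \<in> carrier R" and "x \<in> N"
      then obtain f where *: "x \<in> carrier M" "f \<in> carrier R - q"
        "f \<odot>\<^bsub>M\<^esub> x \<in> span_module R M ?T" by (auto simp: N_def)
      have "f \<odot>\<^bsub>M\<^esub> (r \<odot>\<^bsub>M\<^esub> x) = r \<odot>\<^bsub>M\<^esub> (f \<odot>\<^bsub>M\<^esub> x)"
        using * r by (simp add: R.m_comm flip: smult_assoc1)
      also have "\<dots> \<in> span_module R M ?T" using *(3) submodule_smult[OF S r] by blast
      finally show "r \<odot>\<^bsub>M\<^esub> x \<in> N" using *(1,2) r unfolding N_def by blast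
    qed (auto simp: N_def)
  next
    fix r x assume rx: "r \<in> q" "x \<in> carrier M"
    then have r: "r \<in> carrier R" using q.Icarr by simp
    have "A \<union> U \<subseteq> {x \<in> carrier M. r \<odot>\<^bsub>M\<^esub> x \<in> span_module R M ?T}"
      using A(2) U rx(1) r span_superset[of _ ?T] submodule_smult[OF S r] by blast
    then have "r \<odot>\<^bsub>M\<^esub> (h \<odot>\<^bsub>M\<^esub> x) \<in> span_module R M ?T"
      using span_minimal[OF submodule_colonI[OF S r]] h(2)[OF rx(2)] by blast
    moreover have "h \<odot>\<^bsub>M\<^esub> (r \<odot>\<^bsub>M\<^esub> x) = r \<odot>\<^bsub>M\<^esub> (h \<odot>\<^bsub>M\<^esub> x)"
      using h(1) rx r by (simp add: R.m_comm flip: smult_assoc1)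
    ultimately have "h \<odot>\<^bsub>M\<^esub> (r \<odot>\<^bsub>M\<^esub> x) \<in> span_module R M ?T" by simp
    then show "r \<odot>\<^bsub>M\<^esub> x \<in> N" using h(1) rx r unfolding N_def by blast
  next
    fix r x assume r: "r \<in> carrier R - q" and x: "x \<in> carrier M" and "r \<odot>\<^bsub>M\<^esub> x \<in> N"
    then obtain f where f: "f \<in> carrier R - q" "f \<odot>\<^bsub>M\<^esub> (r \<odot>\<^bsub>M\<^esub> x) \<in> span_module R M ?T"
      by (auto simp: N_def)
    then have "(f \<otimes> r) \<odot>\<^bsub>M\<^esub> x \<in> span_module R M ?T" using r x by (simp add: smult_assoc1)
    then show "x \<in> N" using x primeideal_compl_mult[OF q f(1) r] by (auto simp: N_def)
  next
    \<comment> \<open>Nakayama's lemma by hand: \<open>m \<in> N\<close> leads to a relation in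
      which \<open>m\<close> has the coefficient \<open>f - c\<close> with
      \<open>f \<notin> q\<close> and \<open>c \<in> q\<close>. This coefficient is a unit at
      \<open>q\<close>, so \<open>m\<close> could be eliminated.\<close>
    have "m \<notin> N"
    proof
      assume "m \<in> N"
      then obtain f where f: "f \<in> carrier R - q" "f \<odot>\<^bsub>M\<^esub> m \<in> span_module R M ?T"
        by (auto simp: N_def)
      let ?S = "span_module R M ((A - {m}) \<union> U)"
      \<comment> \<open>Elements of the span of \<open>A \<union> U\<close> whose coefficient at
        \<open>m\<close> can be taken in \<open>q\<close>.\<close>
      let ?K = "{x \<in> carrier M. \<exists>c\<in>q. \<exists>y\<in>?S. x = c \<odot>\<^bsub>M\<^esub> m \<oplus>\<^bsub>M\<^esub> y}"
      have S': "submodule ?S R M" using A U by (intro submodule_span) auto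
      note SM = submoduleE(1)[OF S']
      have z: "\<zero>\<^bsub>M\<^esub> \<in> ?S" "\<zero> \<in> q" using submodule_zero[OF S'] q.zero_closed by auto
      have "submodule ?K R M"
      proof (rule submoduleI2)
        have "\<zero>\<^bsub>M\<^esub> = \<zero> \<odot>\<^bsub>M\<^esub> m \<oplus>\<^bsub>M\<^esub> \<zero>\<^bsub>M\<^esub>" using m by simp
        then show "\<zero>\<^bsub>M\<^esub> \<in> ?K" using z by blast
      next
        fix x y assume "x \<in> ?K" "y \<in> ?K"
        then obtain c d u v where *: "c \<in> q" "d \<in> q" "u \<in> ?S" "v \<in> ?S"
          "x = c \<odot>\<^bsub>M\<^esub> m \<oplus>\<^bsub>M\<^esub> u" "y = d \<odot>\<^bsub>M\<^esub> m \<oplus>\<^bsub>M\<^esub> v" by blast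
        then have "x \<oplus>\<^bsub>M\<^esub> y = (c \<oplus> d) \<odot>\<^bsub>M\<^esub> m \<oplus>\<^bsub>M\<^esub> (u \<oplus>\<^bsub>M\<^esub> v)"
          using m SM q.Icarr by (simp add: subset_iff smult_l_distr M.a_ac)
        moreover have "x \<in> carrier M" "y \<in> carrier M" using * m SM q.Icarr by auto
        ultimately show "x \<oplus>\<^bsub>M\<^esub> y \<in> ?K"
          using * q.a_closed submodule_add[OF S'] by blast
      next
        fix r x assume r: "r \<in> carrier R" and "x \<in> ?K"
        then obtain c u where *: "c \<in> q" "u \<in> ?S" "x = c \<odot>\<^bsub>M\<^esub> m \<oplus>\<^bsub>M\<^esub> u" by blast
        then have "r \<odot>\<^bsub>M\<^esub> x = (r \<otimes> c) \<odot>\<^bsub>M\<^esub> m \<oplus>\<^bsub>M\<^esub> (r \<odot>\<^bsub>M\<^esub> u)"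
          using m r SM q.Icarr by (simp add: subset_iff smult_assoc1 smult_r_distr)
        moreover have "r \<odot>\<^bsub>M\<^esub> x \<in> carrier M" using * m r SM q.Icarr by auto
        ultimately show "r \<odot>\<^bsub>M\<^esub> x \<in> ?K"
          using * r q.I_l_closed submodule_smult[OF S'] by blast
      qed auto
      moreover have "?T \<subseteq> ?K"
      proof
        fix x assume x: "x \<in> ?T"
        then have xM: "x \<in> carrier M" using T by auto
        consider c where "c \<in> q" "x = c \<odot>\<^bsub>M\<^esub> m" | "x \<in> ?S"
        proof -
          have "c \<odot>\<^bsub>M\<^esub> m' \<in> ?S" if "c \<in> q" "m' \<in> A - {m}" for c m'
            using that submodule_smult[OF S'] q.Icarr span_superset[of m' "(A - {m}) \<union> U"] by auto
          then show thesis using x that span_superset[of _ "(A - {m}) \<union> U"] by blast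
        qed
        then show "x \<in> ?K"
        proof cases
          case 1
          then have "x = c \<odot>\<^bsub>M\<^esub> m \<oplus>\<^bsub>M\<^esub> \<zero>\<^bsub>M\<^esub>" using xM by simp
          then show ?thesis using 1 xM z by blast
        next
          case 2
          have "x = \<zero> \<odot>\<^bsub>M\<^esub> m \<oplus>\<^bsub>M\<^esub> x" using xM m by simp
          then show ?thesis using 2 xM z by blast
        qed
      qed
      ultimately have "f \<odot>\<^bsub>M\<^esub> m \<in> ?K" using span_minimal f(2) by blast
      then obtain c y where cy: "c \<in> q" "y \<in> ?S" "f \<odot>\<^bsub>M\<^esub> m = c \<odot>\<^bsub>M\<^esub> m \<oplus>\<^bsub>M\<^esub> y" by blast
      have c: "c \<in> carrier R" and y: "y \<in> carrier M" using cy q.Icarr SM by auto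
      have "(f \<ominus> c) \<odot>\<^bsub>M\<^esub> m = f \<odot>\<^bsub>M\<^esub> m \<ominus>\<^bsub>M\<^esub> c \<odot>\<^bsub>M\<^esub> m"
        using f c m by (simp add: a_minus_def M.minus_eq smult_l_distr smult_l_minus)
      also have "\<dots> = y" using cy(3) c m y by (simp add: M.minus_eq M.a_ac M.r_neg)
      finally have "(f \<ominus> c) \<odot>\<^bsub>M\<^esub> m \<in> ?S" using cy(2) by simp
      moreover have "f \<ominus> c \<in> carrier R - q"
      proof -
        have "f \<in> q" if "f \<ominus> c \<in> q"
        proof -
          have "f = (f \<ominus> c) \<oplus> c" using f c by (simp add: R.minus_eq R.a_assoc R.l_neg)
          then show ?thesis using that cy(1) q.a_closed by metis
        qed
        then show ?thesis using f c by auto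
      qed
      ultimately show False using elim by blast
    qed
    then show "N \<noteq> carrier M" using m by auto
  next
    fix a assume a: "a \<in> carrier M - N"
    \<comment> \<open>For \<open>a\<close> outside \<open>N\<close>, the element \<open>h a\<close>
      has a unit coefficient at some \<open>m'\<close>, and \<open>a\<close> can take the place of
      \<open>m'\<close>.\<close>
    have "h \<odot>\<^bsub>M\<^esub> a \<in> span_module R M (A \<union> U)" using h(2) a by simp
    moreover have "h \<odot>\<^bsub>M\<^esub> a \<notin> span_module R M ?T" using h(1) a by (auto simp: N_def)
    ultimately obtain m' c y where *: "m' \<in> A" "c \<in> carrier R - q"
        "y \<in> span_module R M ((A - {m'}) \<union> U)" "h \<odot>\<^bsub>M\<^esub> a = c \<odot>\<^bsub>M\<^esub> m' \<oplus>\<^bsub>M\<^esub> y"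
      using span_finite_cases[OF A(1,2) U q.a_subset] by blast
    let ?S = "span_module R M ((A - {m'}) \<union> insert a U)"
    have aU: "insert a U \<subseteq> carrier M" using a U by auto
    have S': "submodule ?S R M" using A aU by (intro submodule_span) auto
    have y: "y \<in> ?S" using *(3) span_mono[of "(A - {m'}) \<union> U" "(A - {m'}) \<union> insert a U"] by blast
    have ha: "h \<odot>\<^bsub>M\<^esub> a \<in> ?S"
      using submodule_smult[OF S', of h a] h(1) span_superset[of a "(A - {m'}) \<union> insert a U"] by blast
    have "c \<odot>\<^bsub>M\<^esub> m' = h \<odot>\<^bsub>M\<^esub> a \<ominus>\<^bsub>M\<^esub> y"
    proof -
      have "m' \<in> carrier M" "y \<in> carrier M" using *(1) A y submoduleE(1)[OF S'] by auto
      then show ?thesis using *(2,4) by (simp add: M.minus_eq M.a_assoc M.r_neg)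
    qed
    then have "c \<odot>\<^bsub>M\<^esub> m' \<in> ?S" using submodule_minus[OF S' ha y] by simp
    then have "gens_at R M q (insert a U) (card A - 1)"
      using gens_at_eliminate[OF q A(1,2) *(1) _ aU h *(2)] by blast
    then show "gens_at R M q (insert a U) n" using cA by simp
  qed
qed

text \<open>Prime avoidance for submodules. The hypotheses say that each \<open>M / N q\<close> is a
  nonzero torsion-free module over \<open>R / q\<close>. The induction removes a minimal
  \<open>q\<close> from \<open>Q\<close>, since then some \<open>r\<close> outside \<open>q\<close>
  lies in all the other primes.\<close>

lemma avoid_submodules:
  assumes "finite Q" "\<And>q. q \<in> Q \<Longrightarrow> primeideal q R"
    and "\<And>q. q \<in> Q \<Longrightarrow> submodule (N q) R M \<and> N q \<noteq> carrier M"
    and "\<And>q r x. q \<in> Q \<Longrightarrow> r \<in> q \<Longrightarrow> x \<in> carrier M \<Longrightarrow> r \<odot>\<^bsub>M\<^esub> x \<in> N q"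
    and "\<And>q r x. q \<in> Q \<Longrightarrow> r \<in> carrier R - q \<Longrightarrow> x \<in> carrier M \<Longrightarrow> r \<odot>\<^bsub>M\<^esub> x \<in> N q \<Longrightarrow> x \<in> N q"
  shows "\<exists>a\<in>carrier M. \<forall>q\<in>Q. a \<notin> N q"
  using assms
proof (induction Q rule: finite_psubset_induct)
  case (psubset Q)
  show ?case
  proof (cases "Q = {}")
    case False
    obtain q where q: "q \<in> Q" and min: "\<And>p. p \<in> Q \<Longrightarrow> p \<subseteq> q \<Longrightarrow> p = q"
      using finite_has_minimal[OF psubset.hyps(1) False] by metis
    have "\<exists>a\<in>carrier M. \<forall>p\<in>Q - {q}. a \<notin> N p"
      by (rule psubset.IH) (use q psubset.prems in \<open>auto simp: psubset_eq\<close>)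
    then obtain a where a: "a \<in> carrier M" "\<And>p. p \<in> Q - {q} \<Longrightarrow> a \<notin> N p" by blast
    note Nq = psubset.prems(2)[OF q]
    note sub = submodule_minus[OF conjunct1[OF psubset.prems(2)]]
    show ?thesis
    proof (cases "a \<in> N q")
      case False
      then show ?thesis using a by (intro bexI[of _ a]) blast+
    next
      case True
      obtain x where x: "x \<in> carrier M" "x \<notin> N q" using Nq submoduleE(1)[of "N q"] by blast
      obtain r where r: "r \<in> carrier R - q" "\<And>p. p \<in> Q - {q} \<Longrightarrow> r \<in> p"
        using finite_avoidE[OF psubset.prems(1)[OF q], of "Q - {q}"] psubset.hyps(1)
          psubset.prems(1) min by (metis Diff_iff finite_Diff insertI1)
      \<comment> \<open>The correction is nonzero modulo \<open>N q\<close>, because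
        \<open>r \<notin> q\<close> and \<open>x \<notin> N q\<close>, and zero modulo every other
        \<open>N p\<close>, because \<open>r \<in> p\<close>.\<close>
      let ?b = "a \<oplus>\<^bsub>M\<^esub> r \<odot>\<^bsub>M\<^esub> x"
      have rx: "r \<odot>\<^bsub>M\<^esub> x \<in> carrier M" using r x by simp
      have eq: "?b \<ominus>\<^bsub>M\<^esub> a = r \<odot>\<^bsub>M\<^esub> x" "?b \<ominus>\<^bsub>M\<^esub> r \<odot>\<^bsub>M\<^esub> x = a"
        using a(1) rx by (simp_all add: M.minus_eq M.a_ac M.r_neg M.r_neg1 M.r_neg2)
      have "?b \<notin> N p" if p: "p \<in> Q" for p
      proof (cases "p = q")
        case True
        have "r \<odot>\<^bsub>M\<^esub> x \<notin> N q" using psubset.prems(4)[OF q r(1) x(1)] x(2) by blast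
        then show ?thesis using sub[OF q, of ?b a] eq(1) \<open>a \<in> N q\<close> True by auto
      next
        case False
        then have "r \<odot>\<^bsub>M\<^esub> x \<in> N p" "a \<notin> N p" using psubset.prems(3)[OF p] r(2) a(2) x(1) p by auto
        then show ?thesis using sub[OF p, of ?b "r \<odot>\<^bsub>M\<^esub> x"] eq(2) by auto
      qed
      then show ?thesis using a(1) rx by (intro bexI[of _ ?b]) auto
    qed
  qed (use M.zero_closed in blast)
qed

lemma gens_at_drop:
  assumes Q: "finite Q" "\<And>q. q \<in> Q \<Longrightarrow> primeideal q R" and U: "U \<subseteq> carrier M"
  shows "\<exists>a\<in>carrier M. \<forall>q\<in>Q. \<forall>n. gens_at R M q U n \<longrightarrow> gens_at R M q (insert a U) (n - 1)"
proof -
  \<comment> \<open>At a prime outside \<open>Q'\<close> either no generators are required or no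
    finite number suffices; there any element serves.\<close>
  define Q' where "Q' = {q \<in> Q. \<exists>n. gens_at R M q U (Suc n) \<and> \<not> gens_at R M q U n}"
  define D where "D q n N \<longleftrightarrow> submodule N R M \<and> N \<noteq> carrier M \<and>
      (\<forall>r\<in>q. \<forall>x\<in>carrier M. r \<odot>\<^bsub>M\<^esub> x \<in> N) \<and>
      (\<forall>r\<in>carrier R - q. \<forall>x\<in>carrier M. r \<odot>\<^bsub>M\<^esub> x \<in> N \<longrightarrow> x \<in> N) \<and>
      (\<forall>a\<in>carrier M - N. gens_at R M q (insert a U) n) \<and> \<not> gens_at R M q U n" for q n N
  have "\<exists>n N. D q n N" if "q \<in> Q'" for q
  proof -
    obtain n where n: "gens_at R M q U (Suc n)" "\<not> gens_at R M q U n" using \<open>q \<in> Q'\<close> by (auto simp: Q'_def)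
    have "primeideal q R" using Q(2) \<open>q \<in> Q'\<close> by (auto simp: Q'_def)
    then obtain N where "submodule N R M" "N \<noteq> carrier M"
      "\<And>r x. r \<in> q \<Longrightarrow> x \<in> carrier M \<Longrightarrow> r \<odot>\<^bsub>M\<^esub> x \<in> N"
      "\<And>r x. r \<in> carrier R - q \<Longrightarrow> x \<in> carrier M \<Longrightarrow> r \<odot>\<^bsub>M\<^esub> x \<in> N \<Longrightarrow> x \<in> N"
      "\<And>a. a \<in> carrier M - N \<Longrightarrow> gens_at R M q (insert a U) n"
      by (rule gens_at_dropE[OF _ U n]) (rule that)
    then have "D q n N" using n(2) unfolding D_def by simp
    then show ?thesis by blast
  qed
  then obtain n N where D: "\<And>q. q \<in> Q' \<Longrightarrow> D q (n q) (N q)" by metis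
  then have N: "\<And>q. q \<in> Q' \<Longrightarrow> submodule (N q) R M \<and> N q \<noteq> carrier M"
    "\<And>q r x. q \<in> Q' \<Longrightarrow> r \<in> q \<Longrightarrow> x \<in> carrier M \<Longrightarrow> r \<odot>\<^bsub>M\<^esub> x \<in> N q"
    "\<And>q r x. q \<in> Q' \<Longrightarrow> r \<in> carrier R - q \<Longrightarrow> x \<in> carrier M \<Longrightarrow> r \<odot>\<^bsub>M\<^esub> x \<in> N q \<Longrightarrow> x \<in> N q"
    "\<And>q a. q \<in> Q' \<Longrightarrow> a \<in> carrier M - N q \<Longrightarrow> gens_at R M q (insert a U) (n q)"
    "\<And>q. q \<in> Q' \<Longrightarrow> \<not> gens_at R M q U (n q)"
    unfolding D_def by blast+
  have "\<exists>a\<in>carrier M. \<forall>q\<in>Q'. a \<notin> N q"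
    by (rule avoid_submodules[OF _ _ N(1,2,3)]) (use Q in \<open>auto simp: Q'_def\<close>)
  then obtain a where a: "a \<in> carrier M" "\<And>q. q \<in> Q' \<Longrightarrow> a \<notin> N q" by blast
  have "gens_at R M q (insert a U) (k - 1)" if "q \<in> Q" "gens_at R M q U k" for q k
  proof (cases "q \<in> Q'")
    case True
    then have "gens_at R M q (insert a U) (n q)" using N(4) a by blast
    \<comment> \<open>\<open>gens_at\<close> is monotone in the number, so the jump at
      \<open>n q\<close> lies below any \<open>k\<close> that suffices.\<close>
    moreover have "n q < k" using N(5)[OF True] gens_at_mono[OF that(2), of U "n q"] by fastforce
    ultimately show ?thesis using gens_at_mono[of q "insert a U" "n q" "insert a U" "k - 1"] by auto
  next
    case False
    \<comment> \<open>Without a jump, any sufficient number descends to 0.\<close>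
    then have "gens_at R M q U j \<Longrightarrow> gens_at R M q U 0" for j
      using that(1) by (induction j) (auto simp: Q'_def)
    then show ?thesis using gens_at_mono[of q U 0 "insert a U" "k - 1"] that(2) by auto
  qed
  then show ?thesis using a(1) by blast
qed

end

section \<open>General elements\<close>

lemma prime_chain_snoc:
  assumes "prime_chain R c n" "c n \<subset> q" "primeideal q R"
  shows "prime_chain R (c(Suc n := q)) (Suc n)"
  using assms by (auto simp: prime_chain_def le_Suc_eq less_Suc_eq)

lemma height_prime_geI: "prime_chain R c n \<Longrightarrow> c n = p \<Longrightarrow> enat n \<le> height_prime R p"
  unfolding height_prime_def by (intro SUP_upper) auto

text \<open>Every chain ending in \<open>p\<close> can be prolonged by \<open>q\<close>, so the
  finite height of \<open>q\<close> bounds that of \<open>p\<close> strictly.\<close>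

lemma height_prime_less:
  assumes "primeideal p R" "primeideal q R" "p \<subset> q" "height_prime R q = enat h"
  obtains k where "height_prime R p = enat k" "k < h"
proof -
  have *: "Suc n \<le> h" if "prime_chain R c n" "c n = p" for c n
    using height_prime_geI[OF prime_chain_snoc[OF that(1) _ assms(2)]] that(2) assms(3,4) by fastforce
  have "prime_chain R (\<lambda>_. p) 0" using assms(1) by (simp add: prime_chain_def)
  then have "0 < h" using * by fastforce
  moreover have "height_prime R p \<le> enat (h - 1)"
    unfolding height_prime_def
  proof (rule SUP_least)
    fix n assume "n \<in> {n. \<exists>c. prime_chain R c n \<and> c n = p}"
    then have "Suc n \<le> h" using * by blast
    then show "enat n \<le> enat (h - 1)" by simp
  qed
  ultimately show thesis using that by (cases "height_prime R p") auto
qed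

locale noetherian_module = rmodule R M + noetherian_ring R
  for R :: "('a, 'm) ring_scheme" (structure) and M :: "('a, 'b) module" (structure)

sublocale noetherian_module \<subseteq> noetherian_cring R ..

context noetherian_module
begin

text \<open>The primes at which more than \<open>n\<close> generators are required form a closed
  set, cut out by the colon ideals of all sets of at most \<open>n\<close> elements, much as by a
  Fitting ideal. Its minimal members belong to the finite family of
  \<open>finite_minimal_primes\<close>.\<close>

lemma finite_minimal_not_gens_at:
  assumes "U \<subseteq> carrier M"
  shows "finite {q. primeideal q R \<and> \<not> gens_at R M q U n \<and>
           (\<forall>p. primeideal p R \<and> p \<subset> q \<longrightarrow> gens_at R M p U n)}"
proof -
  \<comment> \<open>This is only a union of ideals; the ideal it generates is contained in the same
    primes.\<close>
  define C where "C = (\<Union>A \<in> {A. finite A \<and> A \<subseteq> carrier M \<and> card A \<le> n}.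
      colon R M (span_module R M (A \<union> U)))"
  have C: "C \<subseteq> carrier R" by (auto simp: C_def colon_def)
  have iff: "Idl C \<subseteq> q \<longleftrightarrow> \<not> gens_at R M q U n" if "primeideal q R" for q
  proof -
    have "ideal q R" using that by (rule primeideal.axioms(1))
    then have "Idl C \<subseteq> q \<longleftrightarrow> C \<subseteq> q"
      using genideal_minimal[of q C] genideal_self[OF C] by blast
    also have "\<dots> \<longleftrightarrow> \<not> gens_at R M q U n" by (auto simp: C_def gens_at_def)
    finally show ?thesis .
  qed
  from finite_minimal_primes[OF genideal_ideal[OF C]]
  obtain F where F: "finite F" "\<forall>p\<in>F. primeideal p R \<and> Idl C \<subseteq> p"
    "\<forall>q. primeideal q R \<and> Idl C \<subseteq> q \<longrightarrow> (\<exists>p\<in>F. p \<subseteq> q)"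
    by (elim exE conjE)
  have "q \<in> F" if q: "primeideal q R" "\<not> gens_at R M q U n"
    and min: "\<forall>p. primeideal p R \<and> p \<subset> q \<longrightarrow> gens_at R M p U n" for q
  proof -
    have "Idl C \<subseteq> q" using iff[OF q(1)] q(2) by simp
    then obtain p where p: "p \<in> F" "p \<subseteq> q" using F(3) q(1) by auto
    then have "primeideal p R" "\<not> gens_at R M p U n" using F(2) iff by auto
    then have "p = q" using min p(2) by (auto simp: psubset_eq)
    then show ?thesis using p by simp
  qed
  then show ?thesis by (intro finite_subset[OF _ F(1)]) blast
qed

text \<open>The induction carries all \<open>i \<le> k\<close>, so that a single sequence serves
  every initial segment. Truncated subtraction expresses the maximum with 0.\<close>

lemma general_elements:
  assumes P: "finite P" "\<forall>p\<in>P. primeideal p R"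
    and gens: "\<forall>q h. primeideal q R \<and> height_prime R q = enat h \<and> h + e \<le> s \<longrightarrow>
        gens_at R M q {} (h + e)"
  shows "k \<le> s \<Longrightarrow> \<exists>a. a \<in> {1..k} \<rightarrow> carrier M \<and> (\<forall>i\<le>k.
     (\<forall>p\<in>P. \<forall>n. gens_at R M p {} n \<longrightarrow> gens_at R M p (a ` {1..i}) (n - i)) \<and>
     (\<forall>q h. primeideal q R \<and> height_prime R q = enat h \<and> h + e \<le> s \<longrightarrow>
        gens_at R M q (a ` {1..i}) (h + e - i)))"
proof (induction k)
  case 0
  then show ?case using gens by simp
next
  case (Suc k)
  then obtain a where a: "a \<in> {1..k} \<rightarrow> carrier M"
    and aP: "\<And>i p n. i \<le> k \<Longrightarrow> p \<in> P \<Longrightarrow> gens_at R M p {} n \<Longrightarrow> gens_at R M p (a ` {1..i}) (n - i)"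
    and aq: "\<And>i q h. i \<le> k \<Longrightarrow> primeideal q R \<Longrightarrow> height_prime R q = enat h \<Longrightarrow> h + e \<le> s \<Longrightarrow>
        gens_at R M q (a ` {1..i}) (h + e - i)"
    by (meson Suc_leD)
  define U where "U = a ` {1..k}"
  have U: "U \<subseteq> carrier M" using a by (auto simp: U_def)
  \<comment> \<open>The primes where the bound for \<open>Suc k\<close> does not already hold for
    \<open>U\<close>.\<close>
  define B where "B = {q. primeideal q R \<and> (\<exists>h. height_prime R q = enat h \<and> h + e \<le> s \<and>
      \<not> gens_at R M q U (h + e - Suc k))}"
  \<comment> \<open>The required number \<open>h + e - Suc k\<close> takes only finitely many values
    \<open>t\<close>, and for each of them the bad primes are minimal among those requiring more
    than \<open>t\<close> generators.\<close>
  have "B \<subseteq> (\<Union>t\<le>s. {q. primeideal q R \<and> \<not> gens_at R M q U t \<and>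
           (\<forall>p. primeideal p R \<and> p \<subset> q \<longrightarrow> gens_at R M p U t)})"
  proof
    fix q assume "q \<in> B"
    then obtain h where q: "primeideal q R" "height_prime R q = enat h" "h + e \<le> s"
      "\<not> gens_at R M q U (h + e - Suc k)" by (auto simp: B_def)
    let ?t = "h + e - Suc k"
    have "gens_at R M q U (h + e - k)" using aq[OF order_refl q(1,2,3)] by (simp add: U_def)
    \<comment> \<open>Since the old bound holds and the new one fails, the two truncated differences
      must differ, whence \<open>k < h + e\<close>.\<close>
    then have "\<not> h + e - k \<le> ?t" using q(4) gens_at_mono[of q U "h + e - k" U ?t] by auto
    then have "k < h + e" by simp
    \<comment> \<open>Here the strict growth of the bound enters: \<open>j < h\<close> makes
      \<open>j + e - k\<close> at most \<open>?t\<close>.\<close>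
    have "gens_at R M p U ?t" if p: "primeideal p R" "p \<subset> q" for p
    proof -
      obtain j where j: "height_prime R p = enat j" "j < h"
        using height_prime_less[OF p(1) q(1) p(2) q(2)] .
      then have "gens_at R M p U (j + e - k)" using aq[OF order_refl p(1)] q(3) by (simp add: U_def)
      then show ?thesis using gens_at_mono[of p U "j + e - k" U ?t] j \<open>k < h + e\<close> by simp
    qed
    then show "q \<in> (\<Union>t\<le>s. {q. primeideal q R \<and> \<not> gens_at R M q U t \<and>
           (\<forall>p. primeideal p R \<and> p \<subset> q \<longrightarrow> gens_at R M p U t)})"
      using q by (intro UN_I[of ?t]) auto
  qed
  then have "finite B" by (rule finite_subset) (simp add: finite_minimal_not_gens_at[OF U])
  then have "\<exists>x\<in>carrier M. \<forall>q\<in>P \<union> B. \<forall>n. gens_at R M q U n \<longrightarrow> gens_at R M q (insert x U) (n - 1)"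
    using P by (intro gens_at_drop[OF _ _ U]) (auto simp: B_def)
  then obtain x where x: "x \<in> carrier M"
    "\<And>q n. q \<in> P \<union> B \<Longrightarrow> gens_at R M q U n \<Longrightarrow> gens_at R M q (insert x U) (n - 1)" by blast
  let ?a = "a(Suc k := x)"
  have im: "?a ` {1..i} = a ` {1..i}" if "i \<le> k" for i using that by auto
  have imS: "?a ` {1..Suc k} = insert x U" unfolding U_def by (auto simp: atLeastAtMostSuc_conv)
  have "(\<forall>p\<in>P. \<forall>n. gens_at R M p {} n \<longrightarrow> gens_at R M p (?a ` {1..i}) (n - i)) \<and>
     (\<forall>q h. primeideal q R \<and> height_prime R q = enat h \<and> h + e \<le> s \<longrightarrow>
        gens_at R M q (?a ` {1..i}) (h + e - i))" if "i \<le> Suc k" for i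
  proof (cases "i = Suc k")
    case True
    have "gens_at R M p (insert x U) (n - Suc k)" if "p \<in> P" "gens_at R M p {} n" for p n
      using x(2)[of p "n - k"] aP[OF order_refl that] that(1) by (simp add: U_def)
    moreover have "gens_at R M q (insert x U) (h + e - Suc k)"
      if "primeideal q R" "height_prime R q = enat h" "h + e \<le> s" for q h
    proof (cases "q \<in> B")
      case True
      then show ?thesis using x(2)[of q "h + e - k"] aq[OF order_refl that] by (simp add: U_def)
    next
      case False
      then have "gens_at R M q U (h + e - Suc k)" using that by (auto simp: B_def)
      then show ?thesis by (rule gens_at_mono) auto
    qed
    ultimately show ?thesis unfolding True imS by blast
  next
    case False
    then have "i \<le> k" using that by simp
    then show ?thesis using aP aq im by simp
  qed
  moreover have "?a \<in> {1..Suc k} \<rightarrow> carrier M" using a x(1) by (auto simp: le_Suc_eq)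
  ultimately show ?case by blast
qed

end

section \<open>Submodules of finitely generated modules over a Noetherian ring\<close>

lemma (in rmodule) coefficient_ideal:
  assumes N: "submodule N R M" and S: "submodule S R M" and m: "m \<in> carrier M"
  shows "ideal {r \<in> carrier R. \<exists>y\<in>S. r \<odot>\<^bsub>M\<^esub> m \<oplus>\<^bsub>M\<^esub> y \<in> N} R" (is "ideal ?I R")
proof (rule R.idealI2)
  have "\<zero> \<odot>\<^bsub>M\<^esub> m \<oplus>\<^bsub>M\<^esub> \<zero>\<^bsub>M\<^esub> \<in> N" using m submodule_zero[OF N] by simp
  then show "\<zero> \<in> ?I" using submodule_zero[OF S] by blast
next
  note SM = submoduleE(1)[OF S]
  fix c d assume "c \<in> ?I" "d \<in> ?I"
  then obtain y z where *: "c \<in> carrier R" "d \<in> carrier R" "y \<in> S" "z \<in> S"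
    "c \<odot>\<^bsub>M\<^esub> m \<oplus>\<^bsub>M\<^esub> y \<in> N" "d \<odot>\<^bsub>M\<^esub> m \<oplus>\<^bsub>M\<^esub> z \<in> N" by blast
  have "(c \<oplus> d) \<odot>\<^bsub>M\<^esub> m \<oplus>\<^bsub>M\<^esub> (y \<oplus>\<^bsub>M\<^esub> z) = (c \<odot>\<^bsub>M\<^esub> m \<oplus>\<^bsub>M\<^esub> y) \<oplus>\<^bsub>M\<^esub> (d \<odot>\<^bsub>M\<^esub> m \<oplus>\<^bsub>M\<^esub> z)"
    using * SM m by (simp add: subset_iff smult_l_distr M.a_ac)
  then have "(c \<oplus> d) \<odot>\<^bsub>M\<^esub> m \<oplus>\<^bsub>M\<^esub> (y \<oplus>\<^bsub>M\<^esub> z) \<in> N"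
    using submodule_add[OF N *(5,6)] by simp
  then show "c \<oplus> d \<in> ?I" using * submodule_add[OF S *(3,4)] by blast
next
  note SM = submoduleE(1)[OF S]
  fix r c assume r: "r \<in> carrier R" and "c \<in> ?I"
  then obtain y where y: "c \<in> carrier R" "y \<in> S" "c \<odot>\<^bsub>M\<^esub> m \<oplus>\<^bsub>M\<^esub> y \<in> N" by blast
  have "(r \<otimes> c) \<odot>\<^bsub>M\<^esub> m \<oplus>\<^bsub>M\<^esub> r \<odot>\<^bsub>M\<^esub> y = r \<odot>\<^bsub>M\<^esub> (c \<odot>\<^bsub>M\<^esub> m \<oplus>\<^bsub>M\<^esub> y)"
    using y r m SM by (simp add: subset_iff smult_r_distr smult_assoc1)
  then have "(r \<otimes> c) \<odot>\<^bsub>M\<^esub> m \<oplus>\<^bsub>M\<^esub> r \<odot>\<^bsub>M\<^esub> y \<in> N" using submodule_smult[OF N r y(3)] by simp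
  then show "r \<otimes> c \<in> ?I" using y r submodule_smult[OF S r] by blast
qed auto

context noetherian_module
begin

text \<open>Generators: those of the intersection with the span of \<open>A\<close>, and lifts of generators of the
  coefficient ideal of \<open>m\<close>.\<close>

lemma submodule_of_span_finite:
  assumes "finite A" "A \<subseteq> carrier M" "submodule N R M" "N \<subseteq> span_module R M A"
  shows "\<exists>B. finite B \<and> B \<subseteq> N \<and> span_module R M B = N"
  using assms
proof (induction A arbitrary: N)
  case empty
  then have "N = {\<zero>\<^bsub>M\<^esub>}" using span_empty submodule_zero by blast
  then show ?case using span_empty by (intro exI[of _ "{}"]) auto
next
  case (insert m A)
  have m: "m \<in> carrier M" and A: "A \<subseteq> carrier M" using insert.prems by auto
  note sA = submodule_span[OF A] and N = insert.prems(2)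
  note NM = submoduleE(1)[OF N] and AM = submoduleE(1)[OF sA]
  \<comment> \<open>For a submodule \<open>N\<close> this is the ideal (N + span A : m); the form
    with a witness \<open>y\<close> supplies the lifts to \<open>N\<close>.\<close>
  let ?I = "\<lambda>N. {r \<in> carrier R. \<exists>y\<in>span_module R M A. r \<odot>\<^bsub>M\<^esub> m \<oplus>\<^bsub>M\<^esub> y \<in> N}"
  obtain C where C: "C \<subseteq> carrier R" "finite C" "?I N = Idl C"
    using finetely_gen[OF coefficient_ideal[OF N sA m]] by blast
  have "\<forall>c\<in>C. \<exists>y\<in>span_module R M A. c \<odot>\<^bsub>M\<^esub> m \<oplus>\<^bsub>M\<^esub> y \<in> N"
    using genideal_self[OF C(1)] C(3) by blast
  then obtain y where y: "\<And>c. c \<in> C \<Longrightarrow> y c \<in> span_module R M A"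
      "\<And>c. c \<in> C \<Longrightarrow> c \<odot>\<^bsub>M\<^esub> m \<oplus>\<^bsub>M\<^esub> y c \<in> N" by metis
  have NA: "submodule (N \<inter> span_module R M A) R M"
    using submodule_Inter[of "{N, span_module R M A}"] N sA by auto
  from insert.IH[OF A NA Int_lower2]
  obtain B where B: "finite B" "B \<subseteq> N \<inter> span_module R M A" "span_module R M B = N \<inter> span_module R M A"
    by (elim exE conjE)
  define D where "D = B \<union> (\<lambda>c. c \<odot>\<^bsub>M\<^esub> m \<oplus>\<^bsub>M\<^esub> y c) ` C"
  have DN: "D \<subseteq> N" using B y by (auto simp: D_def)
  then have DM: "D \<subseteq> carrier M" using NM by auto
  note sD = submodule_span[OF DM]
  have "C \<subseteq> ?I (span_module R M D)"
    using C(1) y(1) span_superset[of _ D] unfolding D_def by blast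
  then have IJ: "?I N \<subseteq> ?I (span_module R M D)"
    unfolding C(3) by (rule genideal_minimal[OF coefficient_ideal[OF sD sA m]])
  have "N \<subseteq> span_module R M D"
  proof
    fix x assume x: "x \<in> N"
    then obtain r z where rz: "r \<in> carrier R" "z \<in> span_module R M A" "x = r \<odot>\<^bsub>M\<^esub> m \<oplus>\<^bsub>M\<^esub> z"
      using span_insertE[of x m A] insert.prems m A by blast
    then have "r \<in> ?I N" using x by blast
    then have "r \<in> ?I (span_module R M D)" using IJ by blast
    then obtain w where w: "w \<in> span_module R M A" "r \<odot>\<^bsub>M\<^esub> m \<oplus>\<^bsub>M\<^esub> w \<in> span_module R M D"
      by blast
    have zw: "z \<in> carrier M" "w \<in> carrier M" using rz w AM by auto
    have rm: "r \<odot>\<^bsub>M\<^esub> m \<in> carrier M" using rz(1) m by simp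
    \<comment> \<open>\<open>r m + w\<close> is an element of the span of \<open>D\<close> with the
      same coefficient \<open>r\<close> as \<open>x\<close>. The difference \<open>z - w\<close>
      thus lies in \<open>N\<close> and in the span of \<open>A\<close>, where \<open>B\<close>
      generates.\<close>
    have x_eq: "x = (z \<ominus>\<^bsub>M\<^esub> w) \<oplus>\<^bsub>M\<^esub> (r \<odot>\<^bsub>M\<^esub> m \<oplus>\<^bsub>M\<^esub> w)"
      using rz(3) rm zw M.a_comm[OF rm zw(1)] M.a_comm[OF rm zw(2)]
      by (simp add: M.minus_eq M.a_assoc M.r_neg1)
    then have "x \<ominus>\<^bsub>M\<^esub> (r \<odot>\<^bsub>M\<^esub> m \<oplus>\<^bsub>M\<^esub> w) = z \<ominus>\<^bsub>M\<^esub> w"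
      using rm zw by (simp add: M.minus_eq M.a_assoc M.r_neg)
    moreover have "x \<ominus>\<^bsub>M\<^esub> (r \<odot>\<^bsub>M\<^esub> m \<oplus>\<^bsub>M\<^esub> w) \<in> N"
      using submodule_minus[OF N x] w(2) span_minimal[OF N DN] by blast
    moreover have "z \<ominus>\<^bsub>M\<^esub> w \<in> span_module R M A" by (rule submodule_minus[OF sA rz(2) w(1)])
    ultimately have "z \<ominus>\<^bsub>M\<^esub> w \<in> span_module R M B" using B(3) by simp
    then have "z \<ominus>\<^bsub>M\<^esub> w \<in> span_module R M D" using span_mono[of B D] by (auto simp: D_def)
    then have "(z \<ominus>\<^bsub>M\<^esub> w) \<oplus>\<^bsub>M\<^esub> (r \<odot>\<^bsub>M\<^esub> m \<oplus>\<^bsub>M\<^esub> w) \<in> span_module R M D"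
      using w(2) by (rule submodule_add[OF sD])
    then show "x \<in> span_module R M D" unfolding x_eq .
  qed
  then have "span_module R M D = N" using span_minimal[OF N DN] by blast
  then show ?case using B(1) C(2) DN unfolding D_def by (intro exI[of _ D]) (auto simp: D_def)
qed

lemma submodule_finitely_generated:
  assumes "finitely_generated R M" "submodule N R M"
  shows "finitely_generated R (M\<lparr>carrier := N\<rparr>)"
proof -
  obtain A where A: "finite A" "A \<subseteq> carrier M" "span_module R M A = carrier M"
    using assms(1) by (auto simp: finitely_generated_def)
  obtain B where "finite B" "B \<subseteq> N" "span_module R M B = N"
    using submodule_of_span_finite[OF A(1,2) assms(2)] submoduleE(1)[OF assms(2)] A(3) by auto
  then show ?thesis
    using span_restrict[OF assms(2)] by (auto simp: finitely_generated_def)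
qed

end

section \<open>Localization\<close>

lemma (in cring) rmodule_ideal_module:
  assumes "ideal I R"
  shows "rmodule R (ideal_module R I)"
proof -
  interpret I: ideal I R by fact
  have "abelian_group (ideal_module R I)"
  proof (rule abelian_groupI)
    fix x assume "x \<in> carrier (ideal_module R I)"
    then show "\<exists>y\<in>carrier (ideal_module R I). y \<oplus>\<^bsub>ideal_module R I\<^esub> x = \<zero>\<^bsub>ideal_module R I\<^esub>"
      by (intro bexI[of _ "\<ominus> x"]) (auto simp: ideal_module_def l_neg I.Icarr)
  qed (auto simp: ideal_module_def a_ac I.Icarr)
  then show ?thesis
    unfolding rmodule_def
    by (intro moduleI is_cring) (auto simp: ideal_module_def l_distr r_distr m_assoc I.Icarr I.I_l_closed)
qed

text \<open>\<open>S\<close> is arbitrary because two cases occur: the complement of a prime for the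
  local numbers of generators, and the set of nonzerodivisors for the rank.\<close>

locale mult_subset = cring R for R :: "('a, 'm) ring_scheme" (structure) and S +
  assumes S_subset: "S \<subseteq> carrier R"
    and S_one: "\<one> \<in> S"
    and S_mult: "\<And>s t. s \<in> S \<Longrightarrow> t \<in> S \<Longrightarrow> s \<otimes> t \<in> S"
begin

lemma S_carrier: "s \<in> S \<Longrightarrow> s \<in> carrier R"
  using S_subset by blast

end

locale localization = rmodule R M + mult_subset R S
  for R :: "('a, 'm) ring_scheme" (structure) and M :: "('a, 'b) module" (structure) and S
begin

abbreviation L where "L \<equiv> loc_module R S M"
abbreviation fr where "fr \<equiv> frac R S M"

lemma equiv_frac_rel: "equiv (carrier M \<times> S) (frac_rel R S M)"
proof (rule equivI)
  show "frac_rel R S M \<subseteq> (carrier M \<times> S) \<times> (carrier M \<times> S)"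
    by (auto simp: frac_rel_def)
  show "refl_on (carrier M \<times> S) (frac_rel R S M)"
    using S_one by (auto simp: frac_rel_def refl_on_def)
  show "sym (frac_rel R S M)"
  proof (rule symI)
    fix a b assume "(a, b) \<in> frac_rel R S M"
    then show "(b, a) \<in> frac_rel R S M" unfolding frac_rel_def by (clarsimp, metis)
  qed
  show "trans (frac_rel R S M)"
  proof (rule transI)
    fix a b c assume ab: "(a, b) \<in> frac_rel R S M" and bc: "(b, c) \<in> frac_rel R S M"
    obtain x s y t z w where abc: "a = (x, s)" "b = (y, t)" "c = (z, w)" by (metis surj_pair)
    obtain u where u: "x \<in> carrier M" "y \<in> carrier M" "s \<in> S" "t \<in> S" "u \<in> S"
      "u \<odot>\<^bsub>M\<^esub> (t \<odot>\<^bsub>M\<^esub> x) = u \<odot>\<^bsub>M\<^esub> (s \<odot>\<^bsub>M\<^esub> y)"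
      using ab unfolding abc frac_rel_def by blast
    obtain v where v: "z \<in> carrier M" "w \<in> S" "v \<in> S"
      "v \<odot>\<^bsub>M\<^esub> (w \<odot>\<^bsub>M\<^esub> y) = v \<odot>\<^bsub>M\<^esub> (t \<odot>\<^bsub>M\<^esub> z)"
      using bc unfolding abc frac_rel_def by blast
    note cl = u(1-5) v(1-3) S_carrier
    \<comment> \<open>The two witnesses together with the middle denominator \<open>t\<close> form
      the witness for the outer pair.\<close>
    have "(u \<otimes> v \<otimes> t) \<odot>\<^bsub>M\<^esub> (w \<odot>\<^bsub>M\<^esub> x) = (v \<otimes> w) \<odot>\<^bsub>M\<^esub> (u \<odot>\<^bsub>M\<^esub> (t \<odot>\<^bsub>M\<^esub> x))"
      using cl by (simp add: R.m_ac flip: smult_assoc1)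
    also have "\<dots> = (u \<otimes> s) \<odot>\<^bsub>M\<^esub> (v \<odot>\<^bsub>M\<^esub> (w \<odot>\<^bsub>M\<^esub> y))"
      unfolding u(6) using cl by (simp add: R.m_ac flip: smult_assoc1)
    also have "\<dots> = (u \<otimes> v \<otimes> t) \<odot>\<^bsub>M\<^esub> (s \<odot>\<^bsub>M\<^esub> z)"
      unfolding v(4) using cl by (simp add: R.m_ac flip: smult_assoc1)
    finally show "(a, c) \<in> frac_rel R S M"
      unfolding abc frac_rel_def using u v S_mult by blast
  qed
qed

lemma frac_eq_iff:
  assumes "x \<in> carrier M" "s \<in> S" "y \<in> carrier M" "t \<in> S"
  shows "fr x s = fr y t \<longleftrightarrow> (\<exists>u\<in>S. u \<odot>\<^bsub>M\<^esub> (t \<odot>\<^bsub>M\<^esub> x) = u \<odot>\<^bsub>M\<^esub> (s \<odot>\<^bsub>M\<^esub> y))"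
  unfolding frac_def using eq_equiv_class_iff[OF equiv_frac_rel, of "(x, s)" "(y, t)"] assms
  by (simp add: frac_rel_def)

lemma frac_eqI:
  assumes "x \<in> carrier M" "s \<in> S" "y \<in> carrier M" "t \<in> S" "t \<odot>\<^bsub>M\<^esub> x = s \<odot>\<^bsub>M\<^esub> y"
  shows "fr x s = fr y t"
  using frac_eq_iff[OF assms(1-4)] assms(5) S_one by auto

lemma frac_self: "x \<in> carrier M \<Longrightarrow> s \<in> S \<Longrightarrow> (x, s) \<in> fr x s"
  unfolding frac_def using equiv_class_self[OF equiv_frac_rel] by auto

lemma in_fracD:
  assumes "(y, t) \<in> fr x s"
  shows "y \<in> carrier M" "t \<in> S" "x \<in> carrier M" "s \<in> S" "fr y t = fr x s"
    "\<exists>u\<in>S. u \<odot>\<^bsub>M\<^esub> (t \<odot>\<^bsub>M\<^esub> x) = u \<odot>\<^bsub>M\<^esub> (s \<odot>\<^bsub>M\<^esub> y)"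
proof -
  have *: "((x, s), (y, t)) \<in> frac_rel R S M" using assms by (simp add: frac_def)
  then show "y \<in> carrier M" "t \<in> S" "x \<in> carrier M" "s \<in> S"
    "\<exists>u\<in>S. u \<odot>\<^bsub>M\<^esub> (t \<odot>\<^bsub>M\<^esub> x) = u \<odot>\<^bsub>M\<^esub> (s \<odot>\<^bsub>M\<^esub> y)"
    by (auto simp: frac_rel_def)
  show "fr y t = fr x s"
    using equiv_class_eq[OF equiv_frac_rel *] by (simp add: frac_def)
qed

lemma carrier_loc_module: "carrier L = {fr x s | x s. x \<in> carrier M \<and> s \<in> S}"
  by (auto simp: loc_module_def frac_def quotient_def)

lemma frac_in_carrier: "x \<in> carrier M \<Longrightarrow> s \<in> S \<Longrightarrow> fr x s \<in> carrier L"
  by (auto simp: carrier_loc_module)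

lemma loc_moduleE:
  assumes "C \<in> carrier L"
  obtains x s where "x \<in> carrier M" "s \<in> S" "C = fr x s"
  using assms by (auto simp: carrier_loc_module)

lemma frac_cancel:
  assumes "x \<in> carrier M" "s \<in> S" "u \<in> S"
  shows "fr (u \<odot>\<^bsub>M\<^esub> x) (u \<otimes> s) = fr x s"
  using assms S_carrier S_mult by (intro frac_eqI) (simp_all add: R.m_ac flip: smult_assoc1)

text \<open>Independence of the representatives, with witness \<open>u \<otimes> v\<close>; it
  collapses the union in the definition.\<close>

lemma loc_add:
  assumes "x \<in> carrier M" "s \<in> S" "y \<in> carrier M" "t \<in> S"
  shows "fr x s \<oplus>\<^bsub>L\<^esub> fr y t = fr (t \<odot>\<^bsub>M\<^esub> x \<oplus>\<^bsub>M\<^esub> s \<odot>\<^bsub>M\<^esub> y) (s \<otimes> t)"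
proof -
  have "fr (t' \<odot>\<^bsub>M\<^esub> x' \<oplus>\<^bsub>M\<^esub> s' \<odot>\<^bsub>M\<^esub> y') (s' \<otimes> t') = fr (t \<odot>\<^bsub>M\<^esub> x \<oplus>\<^bsub>M\<^esub> s \<odot>\<^bsub>M\<^esub> y) (s \<otimes> t)"
    if "(x', s') \<in> fr x s" "(y', t') \<in> fr y t" for x' s' y' t'
  proof -
    note X = in_fracD[OF that(1)] and Y = in_fracD[OF that(2)]
    obtain u where u: "u \<in> S" "u \<odot>\<^bsub>M\<^esub> (s' \<odot>\<^bsub>M\<^esub> x) = u \<odot>\<^bsub>M\<^esub> (s \<odot>\<^bsub>M\<^esub> x')" using X(6) by blast
    obtain v where v: "v \<in> S" "v \<odot>\<^bsub>M\<^esub> (t' \<odot>\<^bsub>M\<^esub> y) = v \<odot>\<^bsub>M\<^esub> (t \<odot>\<^bsub>M\<^esub> y')" using Y(6) by blast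
    note cl = X(1-4) Y(1-4) u(1) v(1) S_carrier
    have 1: "(u \<otimes> v) \<odot>\<^bsub>M\<^esub> ((s \<otimes> t) \<odot>\<^bsub>M\<^esub> (t' \<odot>\<^bsub>M\<^esub> x' \<oplus>\<^bsub>M\<^esub> s' \<odot>\<^bsub>M\<^esub> y')) =
      (v \<otimes> t \<otimes> t') \<odot>\<^bsub>M\<^esub> (u \<odot>\<^bsub>M\<^esub> (s \<odot>\<^bsub>M\<^esub> x')) \<oplus>\<^bsub>M\<^esub> (u \<otimes> s \<otimes> s') \<odot>\<^bsub>M\<^esub> (v \<odot>\<^bsub>M\<^esub> (t \<odot>\<^bsub>M\<^esub> y'))"
      using cl by (simp add: smult_r_distr R.m_ac flip: smult_assoc1)
    have 2: "(u \<otimes> v) \<odot>\<^bsub>M\<^esub> ((s' \<otimes> t') \<odot>\<^bsub>M\<^esub> (t \<odot>\<^bsub>M\<^esub> x \<oplus>\<^bsub>M\<^esub> s \<odot>\<^bsub>M\<^esub> y)) =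
      (v \<otimes> t \<otimes> t') \<odot>\<^bsub>M\<^esub> (u \<odot>\<^bsub>M\<^esub> (s' \<odot>\<^bsub>M\<^esub> x)) \<oplus>\<^bsub>M\<^esub> (u \<otimes> s \<otimes> s') \<odot>\<^bsub>M\<^esub> (v \<odot>\<^bsub>M\<^esub> (t' \<odot>\<^bsub>M\<^esub> y))"
      using cl by (simp add: smult_r_distr R.m_ac flip: smult_assoc1)
    have "(u \<otimes> v) \<odot>\<^bsub>M\<^esub> ((s \<otimes> t) \<odot>\<^bsub>M\<^esub> (t' \<odot>\<^bsub>M\<^esub> x' \<oplus>\<^bsub>M\<^esub> s' \<odot>\<^bsub>M\<^esub> y')) =
      (u \<otimes> v) \<odot>\<^bsub>M\<^esub> ((s' \<otimes> t') \<odot>\<^bsub>M\<^esub> (t \<odot>\<^bsub>M\<^esub> x \<oplus>\<^bsub>M\<^esub> s \<odot>\<^bsub>M\<^esub> y))"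
      unfolding 1 2 u(2) v(2) ..
    then show ?thesis
      using cl S_mult by (subst frac_eq_iff) (auto intro!: bexI[of _ "u \<otimes> v"])
  qed
  moreover have "fr x s \<noteq> {}" "fr y t \<noteq> {}" using frac_self assms by blast+
  ultimately show ?thesis
    by (auto simp: loc_module_def split_beta intro!: SUP_eq_const)
qed

lemma loc_add_same:
  assumes "x \<in> carrier M" "y \<in> carrier M" "s \<in> S"
  shows "fr x s \<oplus>\<^bsub>L\<^esub> fr y s = fr (x \<oplus>\<^bsub>M\<^esub> y) s"
  using assms S_carrier S_mult
  by (simp add: loc_add, intro frac_eqI) (simp_all add: smult_r_distr R.m_ac flip: smult_assoc1)

lemma loc_zero: "\<zero>\<^bsub>L\<^esub> = fr \<zero>\<^bsub>M\<^esub> \<one>"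
  by (simp add: loc_module_def)

lemma frac_zero: "s \<in> S \<Longrightarrow> fr \<zero>\<^bsub>M\<^esub> s = \<zero>\<^bsub>L\<^esub>"
  unfolding loc_zero using S_one S_carrier by (intro frac_eqI) auto

lemma abelian_group_loc_module: "abelian_group L"
proof (rule abelian_groupI)
  show "\<zero>\<^bsub>L\<^esub> \<in> carrier L" unfolding loc_zero using S_one by (intro frac_in_carrier) auto
next
  fix C D assume "C \<in> carrier L" "D \<in> carrier L"
  then obtain x s y t where *: "x \<in> carrier M" "s \<in> S" "C = fr x s" "y \<in> carrier M" "t \<in> S" "D = fr y t"
    by (metis loc_moduleE)
  then show "C \<oplus>\<^bsub>L\<^esub> D \<in> carrier L"
    using S_carrier S_mult by (simp add: loc_add frac_in_carrier)
  show "C \<oplus>\<^bsub>L\<^esub> D = D \<oplus>\<^bsub>L\<^esub> C"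
    using * S_carrier by (simp add: loc_add M.a_comm R.m_comm)
  fix F assume "F \<in> carrier L"
  then obtain z r where **: "z \<in> carrier M" "r \<in> S" "F = fr z r" by (rule loc_moduleE)
  show "C \<oplus>\<^bsub>L\<^esub> D \<oplus>\<^bsub>L\<^esub> F = C \<oplus>\<^bsub>L\<^esub> (D \<oplus>\<^bsub>L\<^esub> F)"
    using * ** S_carrier S_mult
    by (simp add: loc_add smult_r_distr R.m_ac M.a_ac flip: smult_assoc1)
next
  fix C assume "C \<in> carrier L"
  then obtain x s where *: "x \<in> carrier M" "s \<in> S" "C = fr x s" by (rule loc_moduleE)
  then show "\<zero>\<^bsub>L\<^esub> \<oplus>\<^bsub>L\<^esub> C = C"
    using S_one S_carrier by (simp add: loc_add loc_zero)
  have "fr (\<ominus>\<^bsub>M\<^esub> x) s \<oplus>\<^bsub>L\<^esub> C = \<zero>\<^bsub>L\<^esub>"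
    using * by (simp add: loc_add_same M.l_neg frac_zero)
  then show "\<exists>D\<in>carrier L. D \<oplus>\<^bsub>L\<^esub> C = \<zero>\<^bsub>L\<^esub>"
    using * by (intro bexI[of _ "fr (\<ominus>\<^bsub>M\<^esub> x) s"]) (auto intro: frac_in_carrier)
qed

end

section \<open>Rings of fractions\<close>

context mult_subset
begin

abbreviation frR where "frR \<equiv> frac R S (ideal_module R (carrier R))"

text \<open>Since \<open>loc_ring\<close> is built from \<open>R\<close> as a module over itself,
  the calculus of fractions for modules yields the one for rings.\<close>

lemma localization_self: "localization R (ideal_module R (carrier R)) S"
  using rmodule_ideal_module[OF oneideal]
  by (simp add: localization_def mult_subset_axioms)

sublocale self: localization R "ideal_module R (carrier R)" S
  by (rule localization_self)

lemma self_simps [simp]: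
  "carrier (ideal_module R (carrier R)) = carrier R"
  "ring.add (ideal_module R (carrier R)) = ring.add R"
  "ring.zero (ideal_module R (carrier R)) = ring.zero R"
  "module.smult (ideal_module R (carrier R)) = monoid.mult R"
  by (simp_all add: ideal_module_def)

end

context localization
begin

lemma loc_smult:
  assumes "a \<in> carrier R" "s \<in> S" "x \<in> carrier M" "t \<in> S"
  shows "frR a s \<odot>\<^bsub>L\<^esub> fr x t = fr (a \<odot>\<^bsub>M\<^esub> x) (s \<otimes> t)"
proof -
  have "fr (a' \<odot>\<^bsub>M\<^esub> x') (s' \<otimes> t') = fr (a \<odot>\<^bsub>M\<^esub> x) (s \<otimes> t)"
    if "(a', s') \<in> frR a s" "(x', t') \<in> fr x t" for x' s' a' t'
  proof -
    note A = self.in_fracD[OF that(1)] and X = in_fracD[OF that(2)]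
    obtain u where u: "u \<in> S" "u \<otimes> (s' \<otimes> a) = u \<otimes> (s \<otimes> a')" using A(6) by auto
    obtain v where v: "v \<in> S" "v \<odot>\<^bsub>M\<^esub> (t' \<odot>\<^bsub>M\<^esub> x) = v \<odot>\<^bsub>M\<^esub> (t \<odot>\<^bsub>M\<^esub> x')" using X(6) by blast
    have A': "a \<in> carrier R" "a' \<in> carrier R" using A by auto
    note cl = A(2,4) A' X(1-4) u(1) v(1) S_carrier
    have "(u \<otimes> v) \<odot>\<^bsub>M\<^esub> ((s \<otimes> t) \<odot>\<^bsub>M\<^esub> (a' \<odot>\<^bsub>M\<^esub> x')) = (u \<otimes> (s \<otimes> a')) \<odot>\<^bsub>M\<^esub> (v \<odot>\<^bsub>M\<^esub> (t \<odot>\<^bsub>M\<^esub> x'))"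
      using cl by (simp add: R.m_ac flip: smult_assoc1)
    also have "\<dots> = (u \<otimes> (s' \<otimes> a)) \<odot>\<^bsub>M\<^esub> (v \<odot>\<^bsub>M\<^esub> (t' \<odot>\<^bsub>M\<^esub> x))" unfolding u(2) v(2) ..
    also have "\<dots> = (u \<otimes> v) \<odot>\<^bsub>M\<^esub> ((s' \<otimes> t') \<odot>\<^bsub>M\<^esub> (a \<odot>\<^bsub>M\<^esub> x))"
      using cl by (simp add: R.m_ac flip: smult_assoc1)
    finally show ?thesis
      using cl S_mult by (subst frac_eq_iff) (auto intro!: bexI[of _ "u \<otimes> v"])
  qed
  moreover have "frR a s \<noteq> {}" "fr x t \<noteq> {}" using self.frac_self[of a s] frac_self assms by auto
  ultimately show ?thesis
    by (auto simp: loc_module_def split_beta intro!: SUP_eq_const)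
qed

end

context mult_subset
begin

abbreviation Q where "Q \<equiv> loc_ring R S"

lemma loc_ring_simps:
  "carrier Q = carrier (loc_module R S (ideal_module R (carrier R)))"
  "monoid.mult Q = module.smult (loc_module R S (ideal_module R (carrier R)))"
  "ring.add Q = ring.add (loc_module R S (ideal_module R (carrier R)))"
  "ring.zero Q = ring.zero (loc_module R S (ideal_module R (carrier R)))"
  "monoid.one Q = frR \<one> \<one>"
  by (simp_all add: loc_ring_def Let_def)

lemma carrier_loc_ring: "carrier Q = {frR a s | a s. a \<in> carrier R \<and> s \<in> S}"
  by (simp add: loc_ring_simps self.carrier_loc_module)

lemma loc_ringE:
  assumes "A \<in> carrier Q"
  obtains a s where "a \<in> carrier R" "s \<in> S" "A = frR a s"
  using assms by (auto simp: carrier_loc_ring)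

lemma frR_in_carrier: "a \<in> carrier R \<Longrightarrow> s \<in> S \<Longrightarrow> frR a s \<in> carrier Q"
  by (auto simp: carrier_loc_ring)

lemma frR_add:
  "a \<in> carrier R \<Longrightarrow> s \<in> S \<Longrightarrow> b \<in> carrier R \<Longrightarrow> t \<in> S \<Longrightarrow>
    frR a s \<oplus>\<^bsub>Q\<^esub> frR b t = frR (t \<otimes> a \<oplus> s \<otimes> b) (s \<otimes> t)"
  by (simp add: loc_ring_simps self.loc_add)

lemma frR_mult:
  "a \<in> carrier R \<Longrightarrow> s \<in> S \<Longrightarrow> b \<in> carrier R \<Longrightarrow> t \<in> S \<Longrightarrow>
    frR a s \<otimes>\<^bsub>Q\<^esub> frR b t = frR (a \<otimes> b) (s \<otimes> t)"
  by (simp add: loc_ring_simps self.loc_smult)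

lemma frR_eqI:
  assumes "a \<in> carrier R" "s \<in> S" "b \<in> carrier R" "t \<in> S" "t \<otimes> a = s \<otimes> b"
  shows "frR a s = frR b t"
  by (rule self.frac_eqI) (use assms in simp_all)

lemma frR_add_same:
  "a \<in> carrier R \<Longrightarrow> b \<in> carrier R \<Longrightarrow> s \<in> S \<Longrightarrow> frR a s \<oplus>\<^bsub>Q\<^esub> frR b s = frR (a \<oplus> b) s"
  using self.loc_add_same by (simp add: loc_ring_simps)

lemma cring_loc_ring: "cring Q"
proof (rule cringI)
  show "abelian_group Q"
  proof -
    interpret L: abelian_group "loc_module R S (ideal_module R (carrier R))"
      by (rule self.abelian_group_loc_module)
    show ?thesis
      by (rule abelian_groupI) (auto simp: loc_ring_simps L.a_ac intro: L.l_neg)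
  qed
  show "comm_monoid Q"
  proof (rule comm_monoidI)
    fix A B C assume "A \<in> carrier Q" "B \<in> carrier Q" "C \<in> carrier Q"
    then obtain a s b t c u where *: "a \<in> carrier R" "s \<in> S" "A = frR a s" "b \<in> carrier R" "t \<in> S"
      "B = frR b t" "c \<in> carrier R" "u \<in> S" "C = frR c u" by (metis loc_ringE)
    show "A \<otimes>\<^bsub>Q\<^esub> B \<otimes>\<^bsub>Q\<^esub> C = A \<otimes>\<^bsub>Q\<^esub> (B \<otimes>\<^bsub>Q\<^esub> C)"
      using * S_mult S_carrier by (simp add: frR_mult m_assoc)
  next
    fix A B assume "A \<in> carrier Q" "B \<in> carrier Q"
    then obtain a s b t where *: "a \<in> carrier R" "s \<in> S" "A = frR a s" "b \<in> carrier R" "t \<in> S"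
      "B = frR b t" by (metis loc_ringE)
    then show "A \<otimes>\<^bsub>Q\<^esub> B = B \<otimes>\<^bsub>Q\<^esub> A" "A \<otimes>\<^bsub>Q\<^esub> B \<in> carrier Q"
      using S_mult S_carrier by (simp_all add: frR_mult m_comm frR_in_carrier)
  next
    fix A assume "A \<in> carrier Q"
    then obtain a s where "a \<in> carrier R" "s \<in> S" "A = frR a s" by (rule loc_ringE)
    then show "\<one>\<^bsub>Q\<^esub> \<otimes>\<^bsub>Q\<^esub> A = A"
      using S_one S_carrier by (simp add: frR_mult loc_ring_simps(5))
  next
    show "\<one>\<^bsub>Q\<^esub> \<in> carrier Q" using S_one by (simp add: frR_in_carrier loc_ring_simps(5))
  qed
next
  fix A B C assume "A \<in> carrier Q" "B \<in> carrier Q" "C \<in> carrier Q"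
  then obtain a s b t c u where *: "a \<in> carrier R" "s \<in> S" "A = frR a s" "b \<in> carrier R" "t \<in> S"
    "B = frR b t" "c \<in> carrier R" "u \<in> S" "C = frR c u" by (metis loc_ringE)
  show "(A \<oplus>\<^bsub>Q\<^esub> B) \<otimes>\<^bsub>Q\<^esub> C = A \<otimes>\<^bsub>Q\<^esub> C \<oplus>\<^bsub>Q\<^esub> B \<otimes>\<^bsub>Q\<^esub> C"
    using * S_mult S_carrier
    by (simp add: frR_mult frR_add, intro frR_eqI) (simp_all add: l_distr r_distr m_ac)
qed

end

section \<open>Modules of fractions and the clearing of denominators\<close>

context localization
begin

lemma rmodule_loc_module: "rmodule Q L"
  unfolding rmodule_def
proof (rule moduleI[OF cring_loc_ring abelian_group_loc_module])
  fix A C assume "A \<in> carrier Q" "C \<in> carrier L"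
  then obtain a s x t where *: "a \<in> carrier R" "s \<in> S" "A = frR a s" "x \<in> carrier M" "t \<in> S" "C = fr x t"
    by (metis loc_ringE loc_moduleE)
  then show "A \<odot>\<^bsub>L\<^esub> C \<in> carrier L" using S_mult by (simp add: loc_smult frac_in_carrier)
  fix B assume "B \<in> carrier Q"
  then obtain b u where **: "b \<in> carrier R" "u \<in> S" "B = frR b u" by (rule loc_ringE)
  show "(A \<oplus>\<^bsub>Q\<^esub> B) \<odot>\<^bsub>L\<^esub> C = A \<odot>\<^bsub>L\<^esub> C \<oplus>\<^bsub>L\<^esub> B \<odot>\<^bsub>L\<^esub> C"
    using * ** S_mult S_carrier
    by (simp add: loc_smult frR_add loc_add, intro frac_eqI)
      (simp_all add: smult_l_distr smult_r_distr R.m_ac flip: smult_assoc1)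
  show "(A \<otimes>\<^bsub>Q\<^esub> B) \<odot>\<^bsub>L\<^esub> C = A \<odot>\<^bsub>L\<^esub> (B \<odot>\<^bsub>L\<^esub> C)"
    using * ** S_mult S_carrier by (simp add: loc_smult frR_mult smult_assoc1 R.m_assoc)
next
  fix A C D assume "A \<in> carrier Q" "C \<in> carrier L" "D \<in> carrier L"
  then obtain a s x t y u where *: "a \<in> carrier R" "s \<in> S" "A = frR a s" "x \<in> carrier M" "t \<in> S" "C = fr x t"
    "y \<in> carrier M" "u \<in> S" "D = fr y u"
    by (metis loc_ringE loc_moduleE)
  show "A \<odot>\<^bsub>L\<^esub> (C \<oplus>\<^bsub>L\<^esub> D) = A \<odot>\<^bsub>L\<^esub> C \<oplus>\<^bsub>L\<^esub> A \<odot>\<^bsub>L\<^esub> D"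
    using * S_mult S_carrier
    by (simp add: loc_smult loc_add, intro frac_eqI)
      (simp_all add: smult_r_distr R.m_ac flip: smult_assoc1)
next
  fix C assume "C \<in> carrier L"
  then obtain x t where "x \<in> carrier M" "t \<in> S" "C = fr x t" by (rule loc_moduleE)
  then show "\<one>\<^bsub>Q\<^esub> \<odot>\<^bsub>L\<^esub> C = C"
    using S_one S_carrier by (simp add: loc_smult loc_ring_simps(5))
qed

sublocale L: rmodule Q L by (rule rmodule_loc_module)

text \<open>The product of the individual denominators serves the finite set \<open>G\<close>, and
  then its span by linearity.\<close>

lemma common_denominator:
  assumes "finite G" "G \<subseteq> carrier M" "submodule N R M" "\<And>g. g \<in> G \<Longrightarrow> \<exists>t\<in>S. t \<odot>\<^bsub>M\<^esub> g \<in> N"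
  shows "\<exists>h\<in>S. \<forall>x\<in>span_module R M G. h \<odot>\<^bsub>M\<^esub> x \<in> N"
proof -
  have "\<exists>h\<in>S. \<forall>g\<in>G. h \<odot>\<^bsub>M\<^esub> g \<in> N" using assms(1,2,4)
  proof (induction G)
    case empty
    then show ?case using S_one by auto
  next
    case (insert g G)
    then obtain h where h: "h \<in> S" "\<forall>g\<in>G. h \<odot>\<^bsub>M\<^esub> g \<in> N" by auto
    obtain t where "t \<in> S" "t \<odot>\<^bsub>M\<^esub> g \<in> N" using insert.prems(2)[of g] by blast
    note * = h this
    have "(h \<otimes> t) \<odot>\<^bsub>M\<^esub> g \<in> N"
      using * insert.prems S_carrier submodule_smult[OF assms(3), of h] by (simp add: smult_assoc1)
    moreover have "(h \<otimes> t) \<odot>\<^bsub>M\<^esub> x \<in> N" if "x \<in> G" for x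
    proof -
      have "(h \<otimes> t) \<odot>\<^bsub>M\<^esub> x = t \<odot>\<^bsub>M\<^esub> (h \<odot>\<^bsub>M\<^esub> x)"
        using * insert.prems(1) S_carrier that by (simp add: subset_iff R.m_comm flip: smult_assoc1)
      then show ?thesis using * that S_carrier submodule_smult[OF assms(3), of t] by simp
    qed
    ultimately show ?case using S_mult[OF *(1,3)] by blast
  qed
  then obtain h where h: "h \<in> S" "\<forall>g\<in>G. h \<odot>\<^bsub>M\<^esub> g \<in> N" by blast
  have "G \<subseteq> {x \<in> carrier M. h \<odot>\<^bsub>M\<^esub> x \<in> N}" using assms(2) h by blast
  then have "span_module R M G \<subseteq> {x \<in> carrier M. h \<odot>\<^bsub>M\<^esub> x \<in> N}"
    by (intro span_minimal submodule_colonI assms(3) S_carrier h(1))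
  then show ?thesis using h(1) by blast
qed

lemma frac_eq_smult: "x \<in> carrier M \<Longrightarrow> s \<in> S \<Longrightarrow> fr x s = frR \<one> s \<odot>\<^bsub>L\<^esub> fr x \<one>"
  using S_one S_carrier by (simp add: loc_smult)

lemma span_image_frac:
  assumes A: "A \<subseteq> carrier M" and "h \<in> S" "\<And>x. x \<in> carrier M \<Longrightarrow> h \<odot>\<^bsub>M\<^esub> x \<in> span_module R M A"
  shows "span_module Q L ((\<lambda>a. fr a \<one>) ` A) = carrier L"
proof
  let ?G = "(\<lambda>a. fr a \<one>) ` A"
  have G: "?G \<subseteq> carrier L" using A S_one by (auto intro: frac_in_carrier)
  note sG = L.submodule_span[OF G]
  show "span_module Q L ?G \<subseteq> carrier L" by (rule L.span_closed[OF G])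
  have "submodule {x \<in> carrier M. fr x \<one> \<in> span_module Q L ?G} R M"
  proof (rule submoduleI2)
    show "\<zero>\<^bsub>M\<^esub> \<in> {x \<in> carrier M. fr x \<one> \<in> span_module Q L ?G}"
      using L.submodule_zero[OF sG] frac_zero[OF S_one] by simp
  next
    fix x y assume "x \<in> {x \<in> carrier M. fr x \<one> \<in> span_module Q L ?G}"
      "y \<in> {x \<in> carrier M. fr x \<one> \<in> span_module Q L ?G}"
    then show "x \<oplus>\<^bsub>M\<^esub> y \<in> {x \<in> carrier M. fr x \<one> \<in> span_module Q L ?G}"
      using L.submodule_add[OF sG, of "fr x \<one>" "fr y \<one>"] loc_add_same[of x y \<one>] S_one by simp
  next
    fix r x assume "r \<in> carrier R" "x \<in> {x \<in> carrier M. fr x \<one> \<in> span_module Q L ?G}"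
    then show "r \<odot>\<^bsub>M\<^esub> x \<in> {x \<in> carrier M. fr x \<one> \<in> span_module Q L ?G}"
      using L.submodule_smult[OF sG, of "frR r \<one>" "fr x \<one>"] S_one loc_smult[of r \<one> x \<one>]
        frR_in_carrier[of r \<one>] by simp
  qed auto
  moreover have "A \<subseteq> {x \<in> carrier M. fr x \<one> \<in> span_module Q L ?G}"
    using A L.span_superset[of _ ?G] by blast
  ultimately have span: "fr x \<one> \<in> span_module Q L ?G" if "x \<in> span_module R M A" for x
    using span_minimal that by blast
  show "carrier L \<subseteq> span_module Q L ?G"
  proof
    fix C assume "C \<in> carrier L"
    then obtain x s where *: "x \<in> carrier M" "s \<in> S" "C = fr x s" by (rule loc_moduleE)
    have hx: "h \<odot>\<^bsub>M\<^esub> x \<in> carrier M" using * assms(2) S_carrier by simp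
    \<comment> \<open>\<open>h\<close> is a unit after localization, so \<open>x / s\<close> is a
      multiple of the fraction \<open>h x / 1\<close>.\<close>
    have "C = frR \<one> (h \<otimes> s) \<odot>\<^bsub>L\<^esub> fr (h \<odot>\<^bsub>M\<^esub> x) \<one>"
      using frac_cancel[OF *(1,2) assms(2)] frac_eq_smult[OF hx S_mult[OF assms(2) *(2)]] *(3) by simp
    then show "C \<in> span_module Q L ?G"
      using L.submodule_smult[OF sG frR_in_carrier[OF R.one_closed]] span assms(2,3) * S_mult by simp
  qed
qed

text \<open>Converse of \<open>span_image_frac\<close>: numerators of the generators generate each
  element up to a denominator, and finite generation of \<open>M\<close> allows a single denominator
  for all.\<close>

lemma loc_generators:
  assumes fg: "finitely_generated R M" and B: "B \<subseteq> carrier L" "span_module Q L B = carrier L"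
  shows "\<exists>f. f ` B \<subseteq> carrier M \<and> (\<exists>h\<in>S. \<forall>x\<in>carrier M. h \<odot>\<^bsub>M\<^esub> x \<in> span_module R M (f ` B))"
proof -
  have "\<forall>b\<in>B. \<exists>x. x \<in> carrier M \<and> (\<exists>s\<in>S. b = fr x s)" using B(1) by (metis loc_moduleE subsetD)
  then obtain f where f: "\<And>b. b \<in> B \<Longrightarrow> f b \<in> carrier M" "\<And>b. b \<in> B \<Longrightarrow> \<exists>s\<in>S. b = fr (f b) s"
    by metis
  let ?N = "span_module R M (f ` B)"
  have fB: "f ` B \<subseteq> carrier M" using f by auto
  note sN = submodule_span[OF fB] and NM = span_closed[OF fB]
  \<comment> \<open>The fractions that admit a numerator in \<open>?N\<close> form a submodule
    containing \<open>B\<close>, hence are everything.\<close>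
  let ?D = "{C \<in> carrier L. \<exists>x\<in>?N. \<exists>s\<in>S. C = fr x s}"
  have "submodule ?D Q L"
  proof (rule L.submoduleI2)
    show "\<zero>\<^bsub>L\<^esub> \<in> ?D" using L.zero_closed loc_zero submodule_zero[OF sN] S_one by blast
  next
    fix C D assume "C \<in> ?D" "D \<in> ?D"
    then obtain x s y t where *: "x \<in> ?N" "s \<in> S" "C = fr x s" "y \<in> ?N" "t \<in> S" "D = fr y t"
      "C \<in> carrier L" "D \<in> carrier L" by blast
    have "C \<oplus>\<^bsub>L\<^esub> D = fr (t \<odot>\<^bsub>M\<^esub> x \<oplus>\<^bsub>M\<^esub> s \<odot>\<^bsub>M\<^esub> y) (s \<otimes> t)"
      using * NM by (simp add: loc_add subset_iff)
    moreover have "t \<odot>\<^bsub>M\<^esub> x \<oplus>\<^bsub>M\<^esub> s \<odot>\<^bsub>M\<^esub> y \<in> ?N"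
      using * S_carrier by (intro submodule_add[OF sN] submodule_smult[OF sN]) auto
    ultimately show "C \<oplus>\<^bsub>L\<^esub> D \<in> ?D" using * S_mult L.a_closed by blast
  next
    fix A C assume A: "A \<in> carrier Q" and "C \<in> ?D"
    then obtain x s where *: "x \<in> ?N" "s \<in> S" "C = fr x s" "C \<in> carrier L" by blast
    obtain a t where **: "a \<in> carrier R" "t \<in> S" "A = frR a t" using A by (rule loc_ringE)
    have "A \<odot>\<^bsub>L\<^esub> C = fr (a \<odot>\<^bsub>M\<^esub> x) (t \<otimes> s)" using * ** NM by (simp add: loc_smult subset_iff)
    then show "A \<odot>\<^bsub>L\<^esub> C \<in> ?D"
      using * ** A S_mult submodule_smult[OF sN] L.smult_closed by blast
  qed auto
  moreover have "B \<subseteq> ?D" using f(2) B(1) span_superset[of _ "f ` B"] by blast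
  ultimately have D: "carrier L \<subseteq> ?D" using L.span_minimal[of ?D B] B(2) by simp
  obtain G where G: "finite G" "G \<subseteq> carrier M" "span_module R M G = carrier M"
    using fg by (auto simp: finitely_generated_def)
  have "\<exists>t\<in>S. t \<odot>\<^bsub>M\<^esub> g \<in> ?N" if "g \<in> G" for g
  proof -
    have g: "g \<in> carrier M" using that G by auto
    then have "fr g \<one> \<in> ?D" using D frac_in_carrier S_one by blast
    then obtain x s where *: "x \<in> ?N" "s \<in> S" "fr g \<one> = fr x s" by blast
    have x: "x \<in> carrier M" using * NM by auto
    obtain u where u: "u \<in> S" "u \<odot>\<^bsub>M\<^esub> (s \<odot>\<^bsub>M\<^esub> g) = u \<odot>\<^bsub>M\<^esub> (\<one> \<odot>\<^bsub>M\<^esub> x)"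
      using *(3) frac_eq_iff[OF g S_one x *(2)] by blast
    have "(u \<otimes> s) \<odot>\<^bsub>M\<^esub> g = u \<odot>\<^bsub>M\<^esub> x" using u * x g S_carrier by (simp add: smult_assoc1)
    then show ?thesis
      using submodule_smult[OF sN S_carrier[OF u(1)] *(1)] S_mult[OF u(1) *(2)] by metis
  qed
  from common_denominator[OF G(1,2) sN this] show ?thesis using G(3) fB by auto
qed

end

section \<open>Local numbers of generators and localization\<close>

text \<open>An infimum of natural numbers is attained; the empty infimum is \<infinity>, for which
  both sides fail.\<close>

lemma mu_le_iff:
  "mu R M \<le> enat n \<longleftrightarrow>
     (\<exists>A. finite A \<and> A \<subseteq> carrier M \<and> span_module R M A = carrier M \<and> card A \<le> n)" (is "_ = ?r")
proof
  assume le: "mu R M \<le> enat n"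
  show ?r
  proof (rule ccontr)
    assume "\<not> ?r"
    then have "enat (Suc n) \<le> mu R M"
      unfolding mu_def by (intro INF_greatest) (auto simp: not_le Suc_le_eq)
    with le have "enat (Suc n) \<le> enat n" by (rule order_trans[rotated])
    then show False by simp
  qed
next
  assume ?r
  then obtain A where "finite A" "A \<subseteq> carrier M" "span_module R M A = carrier M" "card A \<le> n" by blast
  then show "mu R M \<le> enat n"
    unfolding mu_def by (intro INF_lower2[of A]) auto
qed

lemma prime_mult_subset:
  assumes "primeideal p R"
  shows "mult_subset R (carrier R - p)"
proof -
  interpret primeideal p R by fact
  show ?thesis
    by (unfold_locales) (use primeideal_compl_one[OF assms] primeideal_compl_mult[OF assms] in auto)
qed

lemma (in rmodule) mu_at_le_iff:
  assumes p: "primeideal p R" and fg: "finitely_generated R M"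
  shows "mu_at R p M \<le> enat n \<longleftrightarrow> gens_at R M p {} n"
proof -
  interpret localization R M "carrier R - p"
    using prime_mult_subset[OF p] by (simp add: localization_def rmodule_axioms)
  have at: "ring_at R p = Q" "module_at R p M = L" by (simp_all add: ring_at_def module_at_def)
  show ?thesis
    unfolding at mu_le_iff
  proof
    assume "\<exists>B. finite B \<and> B \<subseteq> carrier L \<and> span_module Q L B = carrier L \<and> card B \<le> n"
    then obtain B where B: "finite B" "B \<subseteq> carrier L" "span_module Q L B = carrier L" "card B \<le> n"
      by blast
    obtain f h where "f ` B \<subseteq> carrier M" "h \<in> carrier R - p"
      "\<And>x. x \<in> carrier M \<Longrightarrow> h \<odot>\<^bsub>M\<^esub> x \<in> span_module R M (f ` B)"
      using loc_generators[OF fg B(2,3)] by blast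
    then show "gens_at R M p {} n"
      using B(1,4) card_image_le[OF B(1), of f] by (intro gens_atI[of "f ` B" _ h]) auto
  next
    assume "gens_at R M p {} n"
    then obtain A h where A: "finite A" "A \<subseteq> carrier M" "card A \<le> n" "h \<in> carrier R - p"
      "\<And>x. x \<in> carrier M \<Longrightarrow> h \<odot>\<^bsub>M\<^esub> x \<in> span_module R M (A \<union> {})" by (rule gens_atE) (rule that)
    then show "\<exists>B. finite B \<and> B \<subseteq> carrier L \<and> span_module Q L B = carrier L \<and> card B \<le> n"
      using span_image_frac[OF A(2,4)] card_image_le[OF A(1), of "\<lambda>a. fr a \<one>"] S_one
      by (intro exI[of _ "(\<lambda>a. fr a \<one>) ` A"]) (auto intro: frac_in_carrier)
  qed
qed

section \<open>Quotient modules\<close>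

locale rmodule_quotient = rmodule R M for R :: "('a, 'm) ring_scheme" (structure)
    and M :: "('a, 'b) module" (structure) +
  fixes N
  assumes N: "submodule N R M"
begin

abbreviation MN where "MN \<equiv> quotient_module M N"

sublocale N: abelian_subgroup N M
proof (rule abelian_subgroupI3)
  show "additive_subgroup N M"
    using N by (simp add: additive_subgroup_def submodule_def)
qed (rule M.abelian_group_axioms)

lemma carrier_quotient: "carrier MN = (\<lambda>x. N +>\<^bsub>M\<^esub> x) ` carrier M"
  by (auto simp: quotient_module_def A_RCOSETS_def')

lemma coset_eq_iff:
  assumes "x \<in> carrier M" "y \<in> carrier M"
  shows "N +>\<^bsub>M\<^esub> x = N +>\<^bsub>M\<^esub> y \<longleftrightarrow> x \<ominus>\<^bsub>M\<^esub> y \<in> N"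
proof -
  have "N +>\<^bsub>M\<^esub> x = N +>\<^bsub>M\<^esub> y \<longleftrightarrow> x \<in> N +>\<^bsub>M\<^esub> y"
    using M.a_repr_independence[OF _ assms(2) N.a_subgroup, of x] N.a_rcos_self[OF assms(1)] by auto
  also have "\<dots> \<longleftrightarrow> x \<ominus>\<^bsub>M\<^esub> y \<in> N"
  proof
    assume "x \<in> N +>\<^bsub>M\<^esub> y"
    then obtain n where n: "n \<in> N" "x = n \<oplus>\<^bsub>M\<^esub> y" by (auto simp: a_r_coset_def')
    then have "n \<in> carrier M" using N.a_subset by auto
    then have "x \<ominus>\<^bsub>M\<^esub> y = n" using n(2) assms(2) by (simp add: M.minus_eq M.a_assoc M.r_neg)
    then show "x \<ominus>\<^bsub>M\<^esub> y \<in> N" using n(1) by simp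
  next
    assume "x \<ominus>\<^bsub>M\<^esub> y \<in> N"
    moreover have "x = (x \<ominus>\<^bsub>M\<^esub> y) \<oplus>\<^bsub>M\<^esub> y" using assms by (simp add: M.minus_eq M.a_assoc M.l_neg)
    ultimately show "x \<in> N +>\<^bsub>M\<^esub> y" unfolding a_r_coset_def' by blast
  qed
  finally show ?thesis .
qed

lemma coset_add:
  "x \<in> carrier M \<Longrightarrow> y \<in> carrier M \<Longrightarrow> (N +>\<^bsub>M\<^esub> x) \<oplus>\<^bsub>MN\<^esub> (N +>\<^bsub>M\<^esub> y) = N +>\<^bsub>M\<^esub> (x \<oplus>\<^bsub>M\<^esub> y)"
  by (simp add: quotient_module_def N.a_rcos_sum)

lemma coset_zero: "\<zero>\<^bsub>MN\<^esub> = N +>\<^bsub>M\<^esub> \<zero>\<^bsub>M\<^esub>"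
  using N.a_subset by (simp add: quotient_module_def)

lemma coset_smult:
  assumes "r \<in> carrier R" "x \<in> carrier M"
  shows "r \<odot>\<^bsub>MN\<^esub> (N +>\<^bsub>M\<^esub> x) = N +>\<^bsub>M\<^esub> (r \<odot>\<^bsub>M\<^esub> x)"
proof -
  have "N +>\<^bsub>M\<^esub> (r \<odot>\<^bsub>M\<^esub> y) = N +>\<^bsub>M\<^esub> (r \<odot>\<^bsub>M\<^esub> x)" if y: "y \<in> N +>\<^bsub>M\<^esub> x" for y
  proof -
    obtain n where n: "n \<in> N" "y = n \<oplus>\<^bsub>M\<^esub> x" using y by (auto simp: a_r_coset_def')
    then have nM: "n \<in> carrier M" using N.a_subset by auto
    have "r \<odot>\<^bsub>M\<^esub> y \<ominus>\<^bsub>M\<^esub> r \<odot>\<^bsub>M\<^esub> x = r \<odot>\<^bsub>M\<^esub> n"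
      using assms n nM by (simp add: smult_r_distr M.minus_eq M.a_assoc M.r_neg)
    then show ?thesis
      using assms n nM submodule_smult[OF N] by (subst coset_eq_iff) auto
  qed
  moreover have "N +>\<^bsub>M\<^esub> x \<noteq> {}" using N.a_rcos_self[OF assms(2)] by blast
  ultimately show ?thesis
    by (auto simp: quotient_module_def intro!: SUP_eq_const)
qed

lemma rmodule_quotient_module: "rmodule R MN"
proof -
  have "abelian_group MN"
  proof (rule abelian_groupI)
    fix C assume "C \<in> carrier MN"
    then obtain x where x: "x \<in> carrier M" "C = N +>\<^bsub>M\<^esub> x" by (auto simp: carrier_quotient)
    then show "\<exists>D\<in>carrier MN. D \<oplus>\<^bsub>MN\<^esub> C = \<zero>\<^bsub>MN\<^esub>"
      by (intro bexI[of _ "N +>\<^bsub>M\<^esub> (\<ominus>\<^bsub>M\<^esub> x)"]) (auto simp: carrier_quotient coset_add coset_zero M.l_neg)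
  qed (auto simp: carrier_quotient coset_add coset_zero M.a_ac)
  then show ?thesis
    unfolding rmodule_def
    by (intro moduleI R.is_cring)
      (auto simp: carrier_quotient coset_add coset_smult smult_l_distr smult_r_distr smult_assoc1)
qed

sublocale MN: rmodule R MN by (rule rmodule_quotient_module)

text \<open>The correspondence between submodules of \<open>M / N\<close> and submodules of
  \<open>M\<close> that contain \<open>N\<close>.\<close>

lemma coset_in_span_iff:
  assumes A: "A \<subseteq> carrier M" and x: "x \<in> carrier M"
  shows "N +>\<^bsub>M\<^esub> x \<in> span_module R MN ((\<lambda>x. N +>\<^bsub>M\<^esub> x) ` A) \<longleftrightarrow> x \<in> span_module R M (A \<union> N)"
    (is "?\<pi> x \<in> ?S \<longleftrightarrow> _")
proof
  have AN: "A \<union> N \<subseteq> carrier M" using A N.a_subset by auto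
  note sAN = submodule_span[OF AN]
  have \<pi>A: "?\<pi> ` A \<subseteq> carrier MN" using A by (auto simp: carrier_quotient)
  note sS = MN.submodule_span[OF \<pi>A]
  show "x \<in> span_module R M (A \<union> N)" if "?\<pi> x \<in> ?S"
  proof -
    let ?K = "?\<pi> ` span_module R M (A \<union> N)"
    have "submodule ?K R MN"
    proof (rule MN.submoduleI2)
      show "?K \<subseteq> carrier MN" using submoduleE(1)[OF sAN] by (auto simp: carrier_quotient)
      show "\<zero>\<^bsub>MN\<^esub> \<in> ?K" using submodule_zero[OF sAN] by (auto simp: coset_zero)
      show "C \<oplus>\<^bsub>MN\<^esub> D \<in> ?K" if "C \<in> ?K" "D \<in> ?K" for C D
        using that submodule_add[OF sAN] submoduleE(1)[OF sAN] by (auto simp: coset_add subset_iff)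
      show "r \<odot>\<^bsub>MN\<^esub> C \<in> ?K" if "r \<in> carrier R" "C \<in> ?K" for r C
        using that submodule_smult[OF sAN] submoduleE(1)[OF sAN] by (auto simp: coset_smult subset_iff)
    qed
    moreover have "?\<pi> ` A \<subseteq> ?K" using span_subset[of "A \<union> N"] by auto
    ultimately have "?\<pi> x \<in> ?K" using MN.span_minimal that by blast
    then obtain y where y: "y \<in> span_module R M (A \<union> N)" "?\<pi> x = ?\<pi> y" by auto
    have yM: "y \<in> carrier M" using y submoduleE(1)[OF sAN] by auto
    have "x \<ominus>\<^bsub>M\<^esub> y \<in> span_module R M (A \<union> N)"
      using coset_eq_iff[OF x yM] y(2) span_superset[of "x \<ominus>\<^bsub>M\<^esub> y" "A \<union> N"] by simp
    then have "(x \<ominus>\<^bsub>M\<^esub> y) \<oplus>\<^bsub>M\<^esub> y \<in> span_module R M (A \<union> N)" using y(1) by (rule submodule_add[OF sAN])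
    then show ?thesis using x yM by (simp add: M.minus_eq M.a_assoc M.l_neg)
  qed
  show "?\<pi> x \<in> ?S" if "x \<in> span_module R M (A \<union> N)"
  proof -
    have "submodule {x \<in> carrier M. ?\<pi> x \<in> ?S} R M"
      by (rule submoduleI2)
        (use MN.submodule_zero[OF sS] MN.submodule_add[OF sS] MN.submodule_smult[OF sS] in
          \<open>auto simp: coset_zero simp flip: coset_add coset_smult\<close>)
    moreover have "A \<union> N \<subseteq> {x \<in> carrier M. ?\<pi> x \<in> ?S}"
    proof
      fix y assume "y \<in> A \<union> N"
      then consider "y \<in> A" | "y \<in> N" by auto
      then show "y \<in> {x \<in> carrier M. ?\<pi> x \<in> ?S}"
      proof cases
        case 1
        then show ?thesis using A MN.span_superset[of "?\<pi> y" "?\<pi> ` A"] by auto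
      next
        case 2
        then have "y \<in> carrier M" "?\<pi> y = \<zero>\<^bsub>MN\<^esub>"
          using N.a_subset coset_eq_iff[of y "\<zero>\<^bsub>M\<^esub>"] by (auto simp: coset_zero M.minus_eq)
        then show ?thesis using MN.submodule_zero[OF sS] by simp
      qed
    qed
    ultimately show ?thesis using span_minimal that by blast
  qed
qed

lemma gens_at_quotient: "gens_at R MN p {} n \<longleftrightarrow> gens_at R M p N n"
proof
  assume "gens_at R MN p {} n"
  then obtain B h where B: "finite B" "B \<subseteq> carrier MN" "card B \<le> n" "h \<in> carrier R - p"
    "\<And>x. x \<in> carrier MN \<Longrightarrow> h \<odot>\<^bsub>MN\<^esub> x \<in> span_module R MN (B \<union> {})"
    by (rule MN.gens_atE) (rule that)
  \<comment> \<open>Choosing one representative for each coset preserves the number of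
    generators.\<close>
  obtain A where A: "A \<subseteq> carrier M" "inj_on (\<lambda>x. N +>\<^bsub>M\<^esub> x) A" "B = (\<lambda>x. N +>\<^bsub>M\<^esub> x) ` A"
    using B(2) unfolding carrier_quotient subset_image_inj by blast
  show "gens_at R M p N n"
  proof (rule gens_atI[of A _ h])
    show "finite A" "card A \<le> n" using A B by (auto simp: finite_image_iff card_image)
    fix x assume x: "x \<in> carrier M"
    then have "h \<odot>\<^bsub>MN\<^esub> (N +>\<^bsub>M\<^esub> x) \<in> span_module R MN B" using B(5) by (auto simp: carrier_quotient)
    then show "h \<odot>\<^bsub>M\<^esub> x \<in> span_module R M (A \<union> N)"
      using x B(4) A coset_in_span_iff[of A "h \<odot>\<^bsub>M\<^esub> x"] by (simp add: coset_smult)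
  qed (use A B in auto)
next
  assume "gens_at R M p N n"
  then obtain A h where A: "finite A" "A \<subseteq> carrier M" "card A \<le> n" "h \<in> carrier R - p"
    "\<And>x. x \<in> carrier M \<Longrightarrow> h \<odot>\<^bsub>M\<^esub> x \<in> span_module R M (A \<union> N)"
    by (rule gens_atE) (rule that)
  show "gens_at R MN p {} n"
  proof (rule MN.gens_atI[of "(\<lambda>x. N +>\<^bsub>M\<^esub> x) ` A" _ h])
    show "card ((\<lambda>x. N +>\<^bsub>M\<^esub> x) ` A) \<le> n" using A(1,3) card_image_le le_trans by blast
    fix C assume "C \<in> carrier MN"
    then obtain x where "x \<in> carrier M" "C = N +>\<^bsub>M\<^esub> x" by (auto simp: carrier_quotient)
    then show "h \<odot>\<^bsub>MN\<^esub> C \<in> span_module R MN ((\<lambda>x. N +>\<^bsub>M\<^esub> x) ` A \<union> {})"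
      using A(4,5) coset_in_span_iff[OF A(2), of "h \<odot>\<^bsub>M\<^esub> x"] by (simp add: coset_smult)
  qed (use A in \<open>auto simp: carrier_quotient\<close>)
qed

lemma finitely_generated_quotient:
  assumes "finitely_generated R M"
  shows "finitely_generated R MN"
proof -
  obtain A where A: "finite A" "A \<subseteq> carrier M" "span_module R M A = carrier M"
    using assms by (auto simp: finitely_generated_def)
  have \<pi>A: "(\<lambda>x. N +>\<^bsub>M\<^esub> x) ` A \<subseteq> carrier MN" using A(2) by (auto simp: carrier_quotient)
  have "carrier MN \<subseteq> span_module R MN ((\<lambda>x. N +>\<^bsub>M\<^esub> x) ` A)"
    using coset_in_span_iff[OF A(2)] A(3) span_mono[of A "A \<union> N"] by (auto simp: carrier_quotient)
  then show ?thesis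
    using A(1) \<pi>A MN.span_closed[OF \<pi>A] by (auto simp: finitely_generated_def)
qed

end

section \<open>Primes and dimension of rings of fractions\<close>

context mult_subset
begin

definition contract where "contract J = {a \<in> carrier R. frR a \<one> \<in> J}"

definition extend where "extend p = {frR a s | a s. a \<in> p \<and> s \<in> S}"

text \<open>Denominators are units of \<open>Q\<close>, so membership in an ideal depends on the
  numerator alone.\<close>

lemma frR_in_ideal_iff:
  assumes "ideal J Q" "a \<in> carrier R" "s \<in> S"
  shows "frR a s \<in> J \<longleftrightarrow> a \<in> contract J"
proof -
  interpret J: ideal J Q by fact
  have "frR a \<one> = frR s \<one> \<otimes>\<^bsub>Q\<^esub> frR a s" "frR a s = frR \<one> s \<otimes>\<^bsub>Q\<^esub> frR a \<one>"
    using assms S_one S_carrier by (simp_all add: frR_mult) (rule frR_eqI, simp_all)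
  then show ?thesis
    using J.I_l_closed frR_in_carrier assms S_one S_carrier unfolding contract_def
    by (metis (no_types, lifting) mem_Collect_eq one_closed)
qed

lemma primeideal_contract:
  assumes "primeideal J Q"
  shows "primeideal (contract J) R" "contract J \<inter> S = {}"
proof -
  interpret J: primeideal J Q by fact
  show "contract J \<inter> S = {}"
  proof (rule ccontr)
    assume "contract J \<inter> S \<noteq> {}"
    then obtain s where s: "s \<in> S" "s \<in> contract J" by auto
    then have "frR s s \<in> J" using frR_in_ideal_iff[OF J.is_ideal] S_carrier by simp
    moreover have "frR s s = \<one>\<^bsub>Q\<^esub>"
      unfolding loc_ring_simps(5) using s S_one S_carrier by (intro frR_eqI) auto
    ultimately show False using J.one_imp_carrier J.I_notcarr by auto
  qed
  show "primeideal (contract J) R"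
  proof (rule primeidealI)
    show "ideal (contract J) R"
    proof (rule idealI2)
      show "\<zero> \<in> contract J"
        using J.zero_closed self.frac_zero[OF S_one] by (simp add: contract_def loc_ring_simps)
    next
      fix a b assume "a \<in> contract J" "b \<in> contract J"
      then show "a \<oplus> b \<in> contract J"
        using J.a_closed[of "frR a \<one>" "frR b \<one>"] S_one by (simp add: contract_def frR_add_same)
    next
      fix r a assume "r \<in> carrier R" "a \<in> contract J"
      then show "r \<otimes> a \<in> contract J"
        using J.I_l_closed[of "frR a \<one>" "frR r \<one>"] S_one
        by (simp add: contract_def frR_mult frR_in_carrier)
    qed (auto simp: contract_def)
    show "carrier R \<noteq> contract J"
      using \<open>contract J \<inter> S = {}\<close> S_one by auto
    fix a b assume ab: "a \<in> carrier R" "b \<in> carrier R" "a \<otimes> b \<in> contract J"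
    then show "a \<in> contract J \<or> b \<in> contract J"
      using J.I_prime[of "frR a \<one>" "frR b \<one>"] S_one
      by (simp add: contract_def frR_mult frR_in_carrier)
  qed (rule is_cring)
qed

text \<open>Independence of the representative: from \<open>u t a = u s b \<in> p\<close> and
  \<open>u\<close>, \<open>t\<close> outside the prime \<open>p\<close> follows
  \<open>a \<in> p\<close>.\<close>

lemma frR_in_extend_iff:
  assumes "primeideal p R" "p \<inter> S = {}" "a \<in> carrier R" "s \<in> S"
  shows "frR a s \<in> extend p \<longleftrightarrow> a \<in> p"
proof
  interpret p: primeideal p R by fact
  assume "frR a s \<in> extend p"
  then obtain b t where b: "b \<in> p" "t \<in> S" "frR a s = frR b t" by (auto simp: extend_def)
  then obtain u where u: "u \<in> S" "u \<otimes> (t \<otimes> a) = u \<otimes> (s \<otimes> b)"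
    using self.frac_eq_iff[of a s b t] assms p.Icarr by auto
  have "u \<otimes> (t \<otimes> a) \<in> p"
    unfolding u(2) using b u assms S_carrier by (simp add: p.I_l_closed)
  then have "u \<in> p \<or> t \<in> p \<or> a \<in> p"
    using p.I_prime u b assms S_carrier by (meson m_closed)
  then show "a \<in> p" using u b assms(2) by auto
qed (use assms in \<open>auto simp: extend_def\<close>)

lemma primeideal_extend:
  assumes "primeideal p R" "p \<inter> S = {}"
  shows "primeideal (extend p) Q"
proof (rule primeidealI)
  interpret p: primeideal p R by fact
  note iff = frR_in_extend_iff[OF assms]
  have sub: "extend p \<subseteq> carrier Q" using p.Icarr by (auto simp: extend_def intro: frR_in_carrier)
  show "ideal (extend p) Q"
  proof (rule cring.idealI2[OF cring_loc_ring sub])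
    show "\<zero>\<^bsub>Q\<^esub> \<in> extend p"
      using iff[of \<zero> \<one>] S_one p.zero_closed by (simp add: loc_ring_simps self.loc_zero)
  next
    fix A B assume "A \<in> extend p" "B \<in> extend p"
    then obtain a s b t where *: "a \<in> p" "s \<in> S" "A = frR a s" "b \<in> p" "t \<in> S" "B = frR b t"
      by (auto simp: extend_def)
    then have "t \<otimes> a \<oplus> s \<otimes> b \<in> p" using S_carrier by (simp add: p.I_l_closed p.a_closed)
    then show "A \<oplus>\<^bsub>Q\<^esub> B \<in> extend p" using * S_mult by (auto simp: frR_add p.Icarr extend_def)
  next
    fix A B assume "A \<in> carrier Q" "B \<in> extend p"
    then obtain a s b t where *: "a \<in> carrier R" "s \<in> S" "A = frR a s" "b \<in> p" "t \<in> S" "B = frR b t"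
      by (auto simp: extend_def carrier_loc_ring)
    then show "A \<otimes>\<^bsub>Q\<^esub> B \<in> extend p"
      using S_mult[of s t] p.I_l_closed[of b a] unfolding extend_def by (auto simp: frR_mult p.Icarr)
  qed
  show "carrier Q \<noteq> extend p"
  proof
    assume "carrier Q = extend p"
    then have "frR \<one> \<one> \<in> extend p" using frR_in_carrier[of \<one> \<one>] S_one by simp
    then have "\<one> \<in> p" using iff[of \<one> \<one>] S_one by simp
    then show False using assms(2) S_one by auto
  qed
  fix A B assume "A \<in> carrier Q" "B \<in> carrier Q" and AB: "A \<otimes>\<^bsub>Q\<^esub> B \<in> extend p"
  then obtain a s b t where *: "a \<in> carrier R" "s \<in> S" "A = frR a s" "b \<in> carrier R" "t \<in> S" "B = frR b t"
    by (metis loc_ringE)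
  then have "a \<otimes> b \<in> p" using AB iff[of "a \<otimes> b" "s \<otimes> t"] S_mult by (simp add: frR_mult)
  then show "A \<in> extend p \<or> B \<in> extend p" using * iff p.I_prime by auto
qed (rule cring_loc_ring)

end

text \<open>Contraction and extension turn chains of primes of the local ring into chains of primes
  contained in \<open>q\<close>, and conversely.\<close>

lemma krull_dim_ring_at:
  assumes q: "primeideal q R"
  shows "krull_dim (ring_at R q) = height_prime R q"
proof -
  interpret q: primeideal q R by fact
  interpret mult_subset R "carrier R - q" by (rule prime_mult_subset[OF q])
  have at: "ring_at R q = Q" by (simp add: ring_at_def)
  have le: "p \<subseteq> q \<longleftrightarrow> p \<inter> (carrier R - q) = {}" if "primeideal p R" for p
  proof -
    interpret p: primeideal p R by fact
    show ?thesis using p.a_subset by auto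
  qed
  have "krull_dim Q \<le> height_prime R q"
    unfolding krull_dim_def
  proof (rule SUP_least, clarify)
    fix n c assume c: "prime_chain Q c n"
    define d where "d = (\<lambda>i. contract (c i))"
    have prime: "primeideal (d i) R" "d i \<subseteq> q" if "i \<le> n" for i
      using primeideal_contract c that le by (auto simp: prime_chain_def d_def)
    have strict: "d i \<subset> d (Suc i)" if "i < n" for i
    proof -
      have ci: "ideal (c i) Q" "ideal (c (Suc i)) Q" "c i \<subset> c (Suc i)"
        using c that by (simp_all add: prime_chain_def Suc_leI primeideal.axioms(1))
      obtain A where A: "A \<in> c (Suc i)" "A \<notin> c i" using ci(3) by auto
      then have "A \<in> carrier Q" using ideal.Icarr[OF ci(2)] by simp
      then obtain a s where as: "a \<in> carrier R" "s \<in> carrier R - q" "A = frR a s" by (rule loc_ringE)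
      then have "a \<in> d (Suc i)" "a \<notin> d i"
        using A frR_in_ideal_iff[OF ci(1)] frR_in_ideal_iff[OF ci(2)] by (auto simp: d_def)
      moreover have "d i \<subseteq> d (Suc i)" using ci(3) by (auto simp: d_def contract_def)
      ultimately show ?thesis by auto
    qed
    \<comment> \<open>\<open>height_prime\<close> counts only chains that end exactly in
      \<open>q\<close>; the topmost contraction is contained in \<open>q\<close> and gives way to
      it.\<close>
    have "prime_chain R (d(n := q)) n"
      unfolding prime_chain_def
    proof (intro conjI allI impI)
      show "primeideal ((d(n := q)) i) R" if "i \<le> n" for i using q prime(1)[OF that] by auto
      show "(d(n := q)) i \<subset> (d(n := q)) (Suc i)" if "i < n" for i
        using strict[OF that] prime(2)[of "Suc i"] that by (auto simp: fun_upd_def)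
    qed
    then show "enat n \<le> height_prime R q" by (rule height_prime_geI) simp
  qed
  moreover have "height_prime R q \<le> krull_dim Q"
    unfolding height_prime_def
  proof (rule SUP_least)
    fix n assume "n \<in> {n. \<exists>c. prime_chain R c n \<and> c n = q}"
    then obtain c where c: "prime_chain R c n" "c n = q" by blast
    have sub: "c i \<subseteq> c (i + k)" if "i + k \<le> n" for i k
      using that
    proof (induction k)
      case (Suc k)
      then have "c (i + k) \<subset> c (Suc (i + k))" using c(1) by (simp add: prime_chain_def)
      then show ?case using Suc by auto
    qed simp
    have prime: "primeideal (c i) R" "c i \<inter> (carrier R - q) = {}" if "i \<le> n" for i
    proof -
      show "primeideal (c i) R" using c(1) that by (simp add: prime_chain_def)
      then show "c i \<inter> (carrier R - q) = {}" using sub[of i "n - i"] that c(2) le by simp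
    qed
    have "prime_chain Q (\<lambda>i. extend (c i)) n"
      unfolding prime_chain_def
    proof (intro conjI allI impI)
      show "primeideal (extend (c i)) Q" if "i \<le> n" for i by (rule primeideal_extend[OF prime[OF that]])
      show "extend (c i) \<subset> extend (c (Suc i))" if i: "i < n" for i
      proof -
        have ss: "c i \<subset> c (Suc i)" using c(1) i by (simp add: prime_chain_def)
        then obtain a where a: "a \<in> c (Suc i)" "a \<notin> c i" by auto
        have Si: "Suc i \<le> n" using i by simp
        have "a \<in> carrier R" using a(1) prime(1)[OF Si] ideal.Icarr primeideal.axioms(1) by metis
        then have "frR a \<one>\<^bsub>R\<^esub> \<in> extend (c (Suc i))" "frR a \<one>\<^bsub>R\<^esub> \<notin> extend (c i)"
          using frR_in_extend_iff[OF prime[OF Si]] frR_in_extend_iff[OF prime[of i]] a i S_one by auto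
        moreover have "extend (c i) \<subseteq> extend (c (Suc i))" using ss by (auto simp: extend_def)
        ultimately show ?thesis by auto
      qed
    qed
    then show "enat n \<le> krull_dim Q"
      unfolding krull_dim_def by (intro SUP_upper) auto
  qed
  ultimately show ?thesis unfolding at by (rule antisym)
qed

section \<open>Rank\<close>

context localization
begin

abbreviation F where "F \<equiv> free_Abelian_group (carrier M \<times> carrier Q)"
abbreviation rel where "rel \<equiv> tensor_relations R M Q (\<lambda>r. frR r \<one>)"
abbreviation H where "H \<equiv> generate F rel"
abbreviation B where "B \<equiv> base_change R M Q (\<lambda>r. frR r \<one>)"
abbreviation act where "act q \<equiv> frag_extend (\<lambda>(x, p). frag_of (x, q \<otimes>\<^bsub>Q\<^esub> p))"

lemma frR_one_in: "r \<in> carrier R \<Longrightarrow> frR r \<one> \<in> carrier Q"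
  using frR_in_carrier S_one by simp

lemma keys_rel:
  assumes "z \<in> rel"
  shows "Poly_Mapping.keys z \<subseteq> carrier M \<times> carrier Q"
proof -
  show ?thesis using assms frR_one_in unfolding tensor_relations_def
    by (auto dest!: subsetD[OF keys_diff])
qed

lemma subgroup_H: "subgroup H F"
  using keys_rel by (intro group.generate_is_subgroup) auto

lemma H_simps:
  "z \<in> H \<Longrightarrow> Poly_Mapping.keys z \<subseteq> carrier M \<times> carrier Q" "0 \<in> H"
  "z \<in> H \<Longrightarrow> w \<in> H \<Longrightarrow> z + w \<in> H" "z \<in> H \<Longrightarrow> - z \<in> H"
  "z \<in> H \<Longrightarrow> w \<in> H \<Longrightarrow> z - w \<in> H"
proof -
  show 1: "Poly_Mapping.keys z \<subseteq> carrier M \<times> carrier Q" if "z \<in> H" for z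
    using subsetD[OF subgroup.subset[OF subgroup_H] that] by simp
  show "0 \<in> H" using subgroup.one_closed[OF subgroup_H] by simp
  show 2: "z + w \<in> H" if "z \<in> H" "w \<in> H" for z w
    using subgroup.m_closed[OF subgroup_H that] by simp
  show 3: "- z \<in> H" if "z \<in> H" for z
    using subgroup.m_inv_closed[OF subgroup_H that] 1[OF that] by simp
  show "z - w \<in> H" if "z \<in> H" "w \<in> H" using 2[OF that(1) 3[OF that(2)]] by simp
qed

lemma rel_in_H: "z \<in> rel \<Longrightarrow> z \<in> H"
  by (rule generate.incl)

lemma carrier_base_change: "carrier B = {H #>\<^bsub>F\<^esub> z | z. Poly_Mapping.keys z \<subseteq> carrier M \<times> carrier Q}"
  by (auto simp: base_change_def Let_def FactGroup_def RCOSETS_def)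

lemma coset_H: "H #>\<^bsub>F\<^esub> z = {h + z | h. h \<in> H}"
  by (auto simp: r_coset_def)

lemma coset_H_eqI: "z - w \<in> H \<Longrightarrow> H #>\<^bsub>F\<^esub> z = H #>\<^bsub>F\<^esub> w"
proof -
  have "H #>\<^bsub>F\<^esub> z \<subseteq> H #>\<^bsub>F\<^esub> w" if "z - w \<in> H" for z w
  proof
    fix v assume "v \<in> H #>\<^bsub>F\<^esub> z"
    then obtain h where h: "h \<in> H" "v = h + z" by (auto simp: coset_H)
    then have "v = (h + (z - w)) + w" by simp
    then show "v \<in> H #>\<^bsub>F\<^esub> w" using H_simps(3)[OF h(1) that] unfolding coset_H by blast
  qed
  moreover assume "z - w \<in> H"
  moreover from this have "w - z \<in> H" using H_simps(4)[of "z - w"] by simp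
  ultimately show ?thesis by blast
qed

lemma normal_H: "H \<lhd> F"
  by (simp add: comm_group.normal_iff_subgroup[OF abelian_free_Abelian_group] subgroup_H)

lemma base_change_add:
  assumes "Poly_Mapping.keys z \<subseteq> carrier M \<times> carrier Q" "Poly_Mapping.keys w \<subseteq> carrier M \<times> carrier Q"
  shows "(H #>\<^bsub>F\<^esub> z) \<oplus>\<^bsub>B\<^esub> (H #>\<^bsub>F\<^esub> w) = H #>\<^bsub>F\<^esub> (z + w)"
  using normal.rcos_sum[OF normal_H, of z w] assms by (simp add: base_change_def Let_def)

lemma base_change_zero: "\<zero>\<^bsub>B\<^esub> = H #>\<^bsub>F\<^esub> 0"
  by (simp add: base_change_def Let_def coset_H)

text \<open>These laws suffice to compute with the finite sums in
  \<open>free_of_rank\<close>.\<close>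

lemma abelian_monoid_base_change: "abelian_monoid B"
proof (rule abelian_monoidI)
  fix C D assume "C \<in> carrier B" "D \<in> carrier B"
  then obtain z w where *: "C = H #>\<^bsub>F\<^esub> z" "D = H #>\<^bsub>F\<^esub> w"
    "Poly_Mapping.keys z \<subseteq> carrier M \<times> carrier Q" "Poly_Mapping.keys w \<subseteq> carrier M \<times> carrier Q"
    unfolding carrier_base_change by blast
  have keys: "Poly_Mapping.keys (z + w) \<subseteq> carrier M \<times> carrier Q" using * keys_add[of z w] by blast
  then show "C \<oplus>\<^bsub>B\<^esub> D \<in> carrier B" using * base_change_add unfolding carrier_base_change by auto
  show "C \<oplus>\<^bsub>B\<^esub> D = D \<oplus>\<^bsub>B\<^esub> C" using * by (simp add: base_change_add add.commute)
  fix G assume "G \<in> carrier B"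
  then obtain v where v: "G = H #>\<^bsub>F\<^esub> v" "Poly_Mapping.keys v \<subseteq> carrier M \<times> carrier Q"
    unfolding carrier_base_change by blast
  have "Poly_Mapping.keys (w + v) \<subseteq> carrier M \<times> carrier Q" using * v keys_add[of w v] by blast
  then show "C \<oplus>\<^bsub>B\<^esub> D \<oplus>\<^bsub>B\<^esub> G = C \<oplus>\<^bsub>B\<^esub> (D \<oplus>\<^bsub>B\<^esub> G)"
    using * v keys by (simp add: base_change_add add.assoc)
next
  show "\<zero>\<^bsub>B\<^esub> \<in> carrier B" unfolding base_change_zero carrier_base_change by (intro CollectI exI[of _ 0]) simp
next
  fix C assume "C \<in> carrier B"
  then show "\<zero>\<^bsub>B\<^esub> \<oplus>\<^bsub>B\<^esub> C = C"
    unfolding carrier_base_change base_change_zero by (auto simp: base_change_add)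
qed

lemma keys_act:
  assumes "q \<in> carrier Q" "Poly_Mapping.keys z \<subseteq> carrier M \<times> carrier Q"
  shows "Poly_Mapping.keys (act q z) \<subseteq> carrier M \<times> carrier Q"
proof -
  show ?thesis using assms(2)
  proof (induction z rule: free_Abelian_group_induct[consumes 1, case_names zero diff gen])
    case (diff x y)
    then show ?case using keys_diff[of "act q x" "act q y"] by (auto simp: frag_extend_diff)
  qed (use assms(1) in auto)
qed

text \<open>Each generating relation goes to a relation of the same type, with \<open>q\<close>
  multiplied into the second factor; for the last type this uses the commutativity of
  \<open>Q\<close>. Hence the action descends to cosets.\<close>

lemma act_H:
  assumes q: "q \<in> carrier Q" and "z \<in> H"
  shows "act q z \<in> H"
proof -
  have rel: "act q z \<in> rel" if "z \<in> rel" for z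
    using that[unfolded tensor_relations_def]
  proof (elim UnE CollectE exE conjE)
    fix x y p assume "z = frag_of (x \<oplus>\<^bsub>M\<^esub> y, p) - frag_of (x, p) - frag_of (y, p)"
      "x \<in> carrier M" "y \<in> carrier M" "p \<in> carrier Q"
    then show "act q z \<in> rel"
      unfolding tensor_relations_def
      by (intro UnI1 CollectI exI[of _ x] exI[of _ y] exI[of _ "q \<otimes>\<^bsub>Q\<^esub> p"])
         (use q in \<open>simp add: frag_extend_diff\<close>)
  next
    fix x p p' assume "z = frag_of (x, p \<oplus>\<^bsub>Q\<^esub> p') - frag_of (x, p) - frag_of (x, p')"
      "x \<in> carrier M" "p \<in> carrier Q" "p' \<in> carrier Q"
    then show "act q z \<in> rel"
      unfolding tensor_relations_def
      by (intro UnI1[OF UnI2] CollectI exI[of _ x] exI[of _ "q \<otimes>\<^bsub>Q\<^esub> p"] exI[of _ "q \<otimes>\<^bsub>Q\<^esub> p'"])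
         (use q in \<open>simp add: frag_extend_diff self.L.R.r_distr\<close>)
  next
    fix r x p assume "z = frag_of (r \<odot>\<^bsub>M\<^esub> x, p) - frag_of (x, frR r \<one> \<otimes>\<^bsub>Q\<^esub> p)"
      "r \<in> carrier R" "x \<in> carrier M" "p \<in> carrier Q"
    then show "act q z \<in> rel"
      unfolding tensor_relations_def
      by (intro UnI2 CollectI exI[of _ r] exI[of _ x] exI[of _ "q \<otimes>\<^bsub>Q\<^esub> p"])
         (use q frR_one_in in \<open>simp add: frag_extend_diff self.L.R.m_lcomm\<close>)
  qed
  show ?thesis using assms(2)
  proof (induction z rule: generate.induct)
    case one
    then show ?case using H_simps(2) by simp
  next
    case (incl h)
    then show ?case using rel rel_in_H by blast
  next
    case (inv h)
    then show ?case using rel[OF inv] rel_in_H H_simps(4) keys_rel[OF inv] by (simp add: frag_extend_minus)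
  next
    case (eng h1 h2)
    then show ?case using H_simps(3) by (simp add: frag_extend_add)
  qed
qed

lemma base_change_smult:
  assumes "q \<in> carrier Q"
  shows "q \<odot>\<^bsub>B\<^esub> (H #>\<^bsub>F\<^esub> z) = H #>\<^bsub>F\<^esub> act q z"
proof -
  have "H #>\<^bsub>F\<^esub> act q w = H #>\<^bsub>F\<^esub> act q z" if w: "w \<in> H #>\<^bsub>F\<^esub> z" for w
  proof -
    obtain h where "h \<in> H" "w = h + z" using w by (auto simp: coset_H)
    then show ?thesis using act_H[OF assms] by (intro coset_H_eqI) (simp add: frag_extend_add)
  qed
  moreover have "H #>\<^bsub>F\<^esub> z \<noteq> {}" using H_simps(2) by (auto simp: coset_H)
  ultimately show ?thesis
    by (auto simp: base_change_def Let_def intro!: SUP_eq_const)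
qed

lemma base_change_smult_closed:
  assumes "q \<in> carrier Q" "C \<in> carrier B"
  shows "q \<odot>\<^bsub>B\<^esub> C \<in> carrier B"
proof -
  obtain z where z: "C = H #>\<^bsub>F\<^esub> z" "Poly_Mapping.keys z \<subseteq> carrier M \<times> carrier Q"
    using assms(2) unfolding carrier_base_change by blast
  then show ?thesis
    using keys_act[OF assms(1) z(2)] base_change_smult[OF assms(1)] unfolding carrier_base_change by blast
qed

lemma base_change_finsum_mem:
  assumes "finite I" "\<And>i. i \<in> I \<Longrightarrow> f i \<in> D" "D \<subseteq> carrier B" "\<zero>\<^bsub>B\<^esub> \<in> D"
    and "\<And>C C'. C \<in> D \<Longrightarrow> C' \<in> D \<Longrightarrow> C \<oplus>\<^bsub>B\<^esub> C' \<in> D"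
  shows "finsum B f I \<in> D"
proof -
  interpret B: abelian_monoid B by (rule abelian_monoid_base_change)
  show ?thesis using assms(1,2)
  proof (induction I)
    case empty
    then show ?case using assms(4) by simp
  next
    case (insert i I)
    then have "f \<in> I \<rightarrow> carrier B" "f i \<in> carrier B" using assms(3) by auto
    then show ?case using insert assms(5) by simp
  qed
qed

text \<open>The canonical map sends the tensor of x and q to q times the fraction x / 1. Its
  surjectivity carries a basis of the base change to generators of the localization.\<close>

lemma base_change_to_loc_module:
  obtains \<Phi> where "\<Phi> \<in> carrier B \<rightarrow> carrier L"
    "\<And>C D. C \<in> carrier B \<Longrightarrow> D \<in> carrier B \<Longrightarrow> \<Phi> (C \<oplus>\<^bsub>B\<^esub> D) = \<Phi> C \<oplus>\<^bsub>L\<^esub> \<Phi> D"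
    "\<And>q C. q \<in> carrier Q \<Longrightarrow> C \<in> carrier B \<Longrightarrow> \<Phi> (q \<odot>\<^bsub>B\<^esub> C) = q \<odot>\<^bsub>L\<^esub> \<Phi> C"
    "carrier L \<subseteq> \<Phi> ` carrier B"
proof -
  let ?X = "carrier M \<times> carrier Q"
  let ?f = "\<lambda>(x, q). q \<odot>\<^bsub>L\<^esub> fr x \<one>"
  have f: "?f ` ?X \<subseteq> carrier L" using S_one by (auto intro!: L.smult_closed frac_in_carrier)
  have "comm_group (add_monoid L)" using abelian_group.a_comm_group[OF abelian_group_loc_module] .
  then obtain \<phi> where \<phi>: "\<phi> \<in> hom F (add_monoid L)" "\<And>a. a \<in> ?X \<Longrightarrow> \<phi> (frag_of a) = ?f a"
    using comm_group.free_Abelian_group_universal[of "add_monoid L" ?f ?X] f by auto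
  interpret \<phi>: group_hom F "add_monoid L" \<phi>
    using \<phi>(1) group_free_Abelian_group L.M.a_group by (simp add: group_hom_def group_hom_axioms_def)
  have cl: "\<phi> z \<in> carrier L" if "Poly_Mapping.keys z \<subseteq> ?X" for z
    using \<phi>.hom_closed[of z] that by simp
  have add: "\<phi> (z + w) = \<phi> z \<oplus>\<^bsub>L\<^esub> \<phi> w"
    if "Poly_Mapping.keys z \<subseteq> ?X" "Poly_Mapping.keys w \<subseteq> ?X" for z w
    using \<phi>.hom_mult[of z w] that by simp
  have \<phi>_diff: "\<phi> (z - w) = \<phi> z \<ominus>\<^bsub>L\<^esub> \<phi> w"
    if "Poly_Mapping.keys z \<subseteq> ?X" "Poly_Mapping.keys w \<subseteq> ?X" for z w
  proof -
    have "\<phi> (- w) = \<ominus>\<^bsub>L\<^esub> \<phi> w" using \<phi>.hom_inv[of w] that by (simp add: a_inv_def)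
    then show ?thesis using add[of z "- w"] that by (simp add: L.M.minus_eq)
  qed
  \<comment> \<open>The two kinds of additivity relations have this shape.\<close>
  have \<phi>_rel: "\<phi> (u - v - w) = \<zero>\<^bsub>L\<^esub>"
    if k: "Poly_Mapping.keys u \<subseteq> ?X" "Poly_Mapping.keys v \<subseteq> ?X" "Poly_Mapping.keys w \<subseteq> ?X"
      and eq: "\<phi> u = \<phi> v \<oplus>\<^bsub>L\<^esub> \<phi> w" for u v w
  proof -
    have "Poly_Mapping.keys (u - v) \<subseteq> ?X" using keys_diff[of u v] k by auto
    then have "\<phi> (u - v - w) = \<phi> v \<oplus>\<^bsub>L\<^esub> \<phi> w \<ominus>\<^bsub>L\<^esub> \<phi> v \<ominus>\<^bsub>L\<^esub> \<phi> w"
      using k eq by (simp add: \<phi>_diff)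
    then show ?thesis
      using cl k L.M.a_comm[of "\<phi> v" "\<phi> w"]
      by (simp add: L.M.minus_eq L.M.a_assoc L.M.r_neg L.M.r_neg2)
  qed
  have frac1: "fr x \<one> \<in> carrier L" if "x \<in> carrier M" for x using that S_one frac_in_carrier by simp
  have "\<phi> z = \<zero>\<^bsub>L\<^esub>" if "z \<in> rel" for z
    using that[unfolded tensor_relations_def]
  proof (elim UnE CollectE exE conjE)
    fix x y p assume *: "z = frag_of (x \<oplus>\<^bsub>M\<^esub> y, p) - frag_of (x, p) - frag_of (y, p)"
      "x \<in> carrier M" "y \<in> carrier M" "p \<in> carrier Q"
    have "fr (x \<oplus>\<^bsub>M\<^esub> y) \<one> = fr x \<one> \<oplus>\<^bsub>L\<^esub> fr y \<one>" using * S_one by (simp add: loc_add_same)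
    then show "\<phi> z = \<zero>\<^bsub>L\<^esub>"
      unfolding *(1) using *(2-) frac1 \<phi>(2) by (intro \<phi>_rel) (auto simp: L.smult_r_distr)
  next
    fix x p p' assume *: "z = frag_of (x, p \<oplus>\<^bsub>Q\<^esub> p') - frag_of (x, p) - frag_of (x, p')"
      "x \<in> carrier M" "p \<in> carrier Q" "p' \<in> carrier Q"
    show "\<phi> z = \<zero>\<^bsub>L\<^esub>"
      unfolding *(1) using *(2-) frac1 \<phi>(2) by (intro \<phi>_rel) (auto simp: L.smult_l_distr)
  next
    fix r x p assume *: "z = frag_of (r \<odot>\<^bsub>M\<^esub> x, p) - frag_of (x, frR r \<one> \<otimes>\<^bsub>Q\<^esub> p)"
      "r \<in> carrier R" "x \<in> carrier M" "p \<in> carrier Q"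
    have "\<phi> z = p \<odot>\<^bsub>L\<^esub> fr (r \<odot>\<^bsub>M\<^esub> x) \<one> \<ominus>\<^bsub>L\<^esub> (frR r \<one> \<otimes>\<^bsub>Q\<^esub> p) \<odot>\<^bsub>L\<^esub> fr x \<one>"
      using * \<phi>(2) frR_one_in by (simp add: \<phi>_diff)
    also have "fr (r \<odot>\<^bsub>M\<^esub> x) \<one> = frR r \<one> \<odot>\<^bsub>L\<^esub> fr x \<one>" using * S_one by (simp add: loc_smult)
    also have "p \<odot>\<^bsub>L\<^esub> (frR r \<one> \<odot>\<^bsub>L\<^esub> fr x \<one>) = (frR r \<one> \<otimes>\<^bsub>Q\<^esub> p) \<odot>\<^bsub>L\<^esub> fr x \<one>"
      using * frR_one_in frac1 by (simp add: self.L.R.m_comm flip: L.smult_assoc1)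
    finally show "\<phi> z = \<zero>\<^bsub>L\<^esub>"
      using * frR_one_in frac1 by (simp add: L.M.minus_eq L.M.r_neg)
  qed
  then have "rel \<subseteq> kernel F (add_monoid L) \<phi>" using keys_rel by (auto simp: kernel_def)
  then have "H \<subseteq> kernel F (add_monoid L) \<phi>"
    by (rule group.generate_subgroup_incl[OF group_free_Abelian_group _ \<phi>.subgroup_kernel])
  then have \<phi>H: "\<phi> h = \<zero>\<^bsub>L\<^esub>" if "h \<in> H" for h using that by (auto simp: kernel_def)
  have act: "\<phi> (act q z) = q \<odot>\<^bsub>L\<^esub> \<phi> z" if q: "q \<in> carrier Q" and z: "Poly_Mapping.keys z \<subseteq> ?X" for q z
    using z
  proof (induction z rule: free_Abelian_group_induct[consumes 1, case_names zero diff gen])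
    case zero
    then show ?case using \<phi>.hom_one q by simp
  next
    case (diff z w)
    then show ?case
      using q cl keys_act[OF q] by (simp add: frag_extend_diff \<phi>_diff L.M.minus_eq L.smult_r_distr L.smult_r_minus)
  next
    case (gen a)
    then show ?case using q \<phi>(2) frac1 by (auto simp: L.smult_assoc1)
  qed
  \<comment> \<open>Any element of the coset may be chosen, as \<open>\<phi>\<close> vanishes on
    \<open>H\<close>.\<close>
  define \<Phi> where "\<Phi> C = \<phi> (SOME z. z \<in> C)" for C
  have \<Phi>: "\<Phi> (H #>\<^bsub>F\<^esub> z) = \<phi> z" if z: "Poly_Mapping.keys z \<subseteq> ?X" for z
  proof -
    have "z \<in> H #>\<^bsub>F\<^esub> z" using H_simps(2) by (force simp: coset_H)
    then have "(SOME w. w \<in> H #>\<^bsub>F\<^esub> z) \<in> H #>\<^bsub>F\<^esub> z" by (rule someI)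
    then obtain h where "h \<in> H" "(SOME w. w \<in> H #>\<^bsub>F\<^esub> z) = h + z" by (auto simp: coset_H)
    then show ?thesis using z \<phi>H cl H_simps(1) by (simp add: \<Phi>_def add)
  qed
  show thesis
  proof (rule that[of \<Phi>])
    show "\<Phi> \<in> carrier B \<rightarrow> carrier L" unfolding carrier_base_change using \<Phi> cl by auto
  next
    fix C D assume "C \<in> carrier B" "D \<in> carrier B"
    then obtain z w where *: "C = H #>\<^bsub>F\<^esub> z" "D = H #>\<^bsub>F\<^esub> w"
      "Poly_Mapping.keys z \<subseteq> ?X" "Poly_Mapping.keys w \<subseteq> ?X" unfolding carrier_base_change by blast
    then have "Poly_Mapping.keys (z + w) \<subseteq> ?X" using keys_add[of z w] by blast
    then show "\<Phi> (C \<oplus>\<^bsub>B\<^esub> D) = \<Phi> C \<oplus>\<^bsub>L\<^esub> \<Phi> D" using * by (simp add: base_change_add \<Phi> add)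
  next
    fix q C assume q: "q \<in> carrier Q" and "C \<in> carrier B"
    then obtain z where "C = H #>\<^bsub>F\<^esub> z" "Poly_Mapping.keys z \<subseteq> ?X" unfolding carrier_base_change by blast
    then show "\<Phi> (q \<odot>\<^bsub>B\<^esub> C) = q \<odot>\<^bsub>L\<^esub> \<Phi> C"
      using q keys_act[OF q] by (simp add: base_change_smult \<Phi> act)
  next
    show "carrier L \<subseteq> \<Phi> ` carrier B"
    proof
      fix C assume "C \<in> carrier L"
      then obtain x s where *: "x \<in> carrier M" "s \<in> S" "C = fr x s" by (rule loc_moduleE)
      let ?z = "frag_of (x, frR \<one> s)"
      have z: "Poly_Mapping.keys ?z \<subseteq> ?X" using * frR_in_carrier by simp
      have "\<phi> ?z = C" using * \<phi>(2) frR_in_carrier frac_eq_smult by simp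
      then have "C = \<Phi> (H #>\<^bsub>F\<^esub> ?z)" using \<Phi>[OF z] by simp
      then show "C \<in> \<Phi> ` carrier B" using z unfolding carrier_base_change by blast
    qed
  qed
qed

text \<open>The images of a basis generate the localization; \<open>loc_generators\<close> then
  clears their denominators.\<close>

lemma base_change_free_generators:
  assumes fg: "finitely_generated R M" and free: "free_of_rank Q B n"
  shows "\<exists>A. finite A \<and> A \<subseteq> carrier M \<and> card A \<le> n \<and>
    (\<exists>h\<in>S. \<forall>x\<in>carrier M. h \<odot>\<^bsub>M\<^esub> x \<in> span_module R M A)"
proof -
  obtain b where b: "b \<in> {..<n} \<rightarrow> carrier B"
    "bij_betw (\<lambda>c. \<Oplus>\<^bsub>B\<^esub>i\<in>{..<n}. c i \<odot>\<^bsub>B\<^esub> b i) ({..<n} \<rightarrow>\<^sub>E carrier Q) (carrier B)"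
    using free unfolding free_of_rank_def by blast
  obtain \<Phi> where \<Phi>: "\<Phi> \<in> carrier B \<rightarrow> carrier L"
    "\<And>C D. C \<in> carrier B \<Longrightarrow> D \<in> carrier B \<Longrightarrow> \<Phi> (C \<oplus>\<^bsub>B\<^esub> D) = \<Phi> C \<oplus>\<^bsub>L\<^esub> \<Phi> D"
    "\<And>q C. q \<in> carrier Q \<Longrightarrow> C \<in> carrier B \<Longrightarrow> \<Phi> (q \<odot>\<^bsub>B\<^esub> C) = q \<odot>\<^bsub>L\<^esub> \<Phi> C"
    "carrier L \<subseteq> \<Phi> ` carrier B"
    by (rule base_change_to_loc_module) (rule that)
  interpret B: abelian_monoid B by (rule abelian_monoid_base_change)
  let ?G = "(\<lambda>i. \<Phi> (b i)) ` {..<n}"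
  have G: "?G \<subseteq> carrier L" using b(1) \<Phi>(1) by auto
  note sG = L.submodule_span[OF G]
  let ?D = "{C \<in> carrier B. \<Phi> C \<in> span_module Q L ?G}"
  have zeroB: "\<Phi> \<zero>\<^bsub>B\<^esub> = \<zero>\<^bsub>L\<^esub>"
    using \<Phi>(2)[of "\<zero>\<^bsub>B\<^esub>" "\<zero>\<^bsub>B\<^esub>"] \<Phi>(1) L.M.add.r_cancel_one' by (auto simp: Pi_iff)
  have "(\<Oplus>\<^bsub>B\<^esub>i\<in>{..<n}. c i \<odot>\<^bsub>B\<^esub> b i) \<in> ?D" if c: "c \<in> {..<n} \<rightarrow>\<^sub>E carrier Q" for c
  proof (rule base_change_finsum_mem)
    fix i assume i: "i \<in> {..<n}"
    have ci: "c i \<in> carrier Q" "b i \<in> carrier B" using c b(1) i by auto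
    have "\<Phi> (b i) \<in> span_module Q L ?G" using i by (intro L.span_superset) auto
    then show "c i \<odot>\<^bsub>B\<^esub> b i \<in> ?D" using ci base_change_smult_closed \<Phi>(3) L.submodule_smult[OF sG ci(1)] by simp
  qed (use \<Phi>(2) zeroB L.submodule_zero[OF sG] L.submodule_add[OF sG] in auto)
  moreover have "carrier B = (\<lambda>c. \<Oplus>\<^bsub>B\<^esub>i\<in>{..<n}. c i \<odot>\<^bsub>B\<^esub> b i) ` ({..<n} \<rightarrow>\<^sub>E carrier Q)"
    using b(2) by (simp add: bij_betw_def)
  ultimately have "carrier B \<subseteq> ?D" by (metis (no_types, lifting) image_subsetI)
  then have "span_module Q L ?G = carrier L" using \<Phi>(4) L.span_closed[OF G] by blast
  then obtain f h where f: "f ` ?G \<subseteq> carrier M" "h \<in> S"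
    "\<forall>x\<in>carrier M. h \<odot>\<^bsub>M\<^esub> x \<in> span_module R M (f ` ?G)"
    using loc_generators[OF fg G] by blast
  have "card (f ` ?G) \<le> n"
    using card_image_le[of ?G f] card_image_le[of "{..<n}" "\<lambda>i. \<Phi> (b i)"] by simp
  then show ?thesis using f by (intro exI[of _ "f ` ?G"]) auto
qed

text \<open>If \<open>r\<close> kills \<open>M\<close>, then \<open>r / 1\<close> kills the base
  change. The constant coefficient families \<open>r / 1\<close> and \<open>0 / 1\<close> therefore
  give the same combination of the basis and must agree; \<open>n > 0\<close> provides a coefficient
  to compare.\<close>

lemma base_change_free_faithful:
  assumes free: "free_of_rank Q B n" and n: "n > 0" and r: "r \<in> carrier R"
    and zero: "\<And>x. x \<in> carrier M \<Longrightarrow> r \<odot>\<^bsub>M\<^esub> x = \<zero>\<^bsub>M\<^esub>"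
  shows "frR r \<one> = frR \<zero> \<one>"
proof -
  interpret B: abelian_monoid B by (rule abelian_monoid_base_change)
  have zero_smult: "frR t \<one> \<odot>\<^bsub>B\<^esub> C = \<zero>\<^bsub>B\<^esub>"
    if t: "t \<in> carrier R" "\<And>x. x \<in> carrier M \<Longrightarrow> t \<odot>\<^bsub>M\<^esub> x = \<zero>\<^bsub>M\<^esub>" and C: "C \<in> carrier B" for t C
  proof -
    obtain z where z: "C = H #>\<^bsub>F\<^esub> z" "Poly_Mapping.keys z \<subseteq> carrier M \<times> carrier Q"
      using C unfolding carrier_base_change by blast
    have "act (frR t \<one>) z \<in> H" using z(2)
    proof (induction z rule: free_Abelian_group_induct[consumes 1, case_names zero diff gen])
      case zero
      then show ?case using H_simps(2) by simp
    next
      case (diff x y)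
      then show ?case using H_simps(5) by (simp add: frag_extend_diff)
    next
      case (gen a)
      then obtain x p where a: "a = (x, p)" "x \<in> carrier M" "p \<in> carrier Q" by auto
      \<comment> \<open>Additivity applied to 0 + 0 = 0 shows that the tensor of 0 and
        \<open>p\<close> vanishes.\<close>
      have "frag_of (\<zero>\<^bsub>M\<^esub> \<oplus>\<^bsub>M\<^esub> \<zero>\<^bsub>M\<^esub>, p) - frag_of (\<zero>\<^bsub>M\<^esub>, p) - frag_of (\<zero>\<^bsub>M\<^esub>, p) \<in> rel"
        using a(3) unfolding tensor_relations_def by blast
      then have "- frag_of (\<zero>\<^bsub>M\<^esub>, p) \<in> H" using rel_in_H by simp
      then have 1: "frag_of (\<zero>\<^bsub>M\<^esub>, p) \<in> H" using H_simps(4) by fastforce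
      have "frag_of (t \<odot>\<^bsub>M\<^esub> x, p) - frag_of (x, frR t \<one> \<otimes>\<^bsub>Q\<^esub> p) \<in> rel"
        using a t(1) unfolding tensor_relations_def by blast
      then have "frag_of (\<zero>\<^bsub>M\<^esub>, p) - frag_of (x, frR t \<one> \<otimes>\<^bsub>Q\<^esub> p) \<in> H"
        using rel_in_H t(2)[OF a(2)] by simp
      from H_simps(5)[OF 1 this] show ?case using a by simp
    qed
    then show ?thesis
      using z t(1) frR_one_in by (simp add: base_change_smult base_change_zero coset_H_eqI)
  qed
  obtain b where b: "b \<in> {..<n} \<rightarrow> carrier B"
    "inj_on (\<lambda>c. \<Oplus>\<^bsub>B\<^esub>i\<in>{..<n}. c i \<odot>\<^bsub>B\<^esub> b i) ({..<n} \<rightarrow>\<^sub>E carrier Q)"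
    using free unfolding free_of_rank_def bij_betw_def by blast
  define c where "c t = (\<lambda>i\<in>{..<n}. frR t \<one>)" for t
  have c: "c t \<in> {..<n} \<rightarrow>\<^sub>E carrier Q" if "t \<in> carrier R" for t
    using that frR_one_in by (auto simp: c_def)
  have "(\<Oplus>\<^bsub>B\<^esub>i\<in>{..<n}. c t i \<odot>\<^bsub>B\<^esub> b i) = \<zero>\<^bsub>B\<^esub>"
    if "t \<in> carrier R" "\<And>x. x \<in> carrier M \<Longrightarrow> t \<odot>\<^bsub>M\<^esub> x = \<zero>\<^bsub>M\<^esub>" for t
  proof -
    have "(\<Oplus>\<^bsub>B\<^esub>i\<in>{..<n}. c t i \<odot>\<^bsub>B\<^esub> b i) \<in> {\<zero>\<^bsub>B\<^esub>}"
      by (rule base_change_finsum_mem) (use zero_smult[OF that] b(1) in \<open>auto simp: c_def\<close>)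
    then show ?thesis by simp
  qed
  then have "(\<Oplus>\<^bsub>B\<^esub>i\<in>{..<n}. c r i \<odot>\<^bsub>B\<^esub> b i) = (\<Oplus>\<^bsub>B\<^esub>i\<in>{..<n}. c \<zero> i \<odot>\<^bsub>B\<^esub> b i)"
    using r zero by simp
  then have "c r = c \<zero>" by (rule inj_onD[OF b(2) _ c[OF r] c[OF R.zero_closed]])
  then have "c r 0 = c \<zero> 0" by simp
  then show ?thesis using n by (simp add: c_def)
qed

end

lemma (in cring) mult_subset_nonzerodivisors: "mult_subset R (nonzerodivisors R)"
proof
  fix s t assume "s \<in> nonzerodivisors R" "t \<in> nonzerodivisors R"
  then have *: "s \<in> carrier R" "t \<in> carrier R"
    "\<And>x. x \<in> carrier R \<Longrightarrow> s \<otimes> x = \<zero> \<Longrightarrow> x = \<zero>" "\<And>x. x \<in> carrier R \<Longrightarrow> t \<otimes> x = \<zero> \<Longrightarrow> x = \<zero>"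
    unfolding nonzerodivisors_def by blast+
  have "x = \<zero>" if "x \<in> carrier R" "s \<otimes> t \<otimes> x = \<zero>" for x
    using *(3)[of "t \<otimes> x"] *(4)[of x] that *(1,2) by (simp add: m_assoc)
  then show "s \<otimes> t \<in> nonzerodivisors R" using *(1,2) by (simp add: nonzerodivisors_def)
qed (auto simp: nonzerodivisors_def)

context rmodule
begin

text \<open>Meant for primes of height 0: they do not contain the nonzerodivisor \<open>h\<close>,
  so the rank bounds the number of generators there.\<close>

lemma rank_generators:
  assumes "has_rank R M e" "finitely_generated R M"
  shows "\<exists>A. finite A \<and> A \<subseteq> carrier M \<and> card A \<le> e \<and>
    (\<exists>h\<in>nonzerodivisors R. \<forall>x\<in>carrier M. h \<odot>\<^bsub>M\<^esub> x \<in> span_module R M A)"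
proof -
  interpret localization R M "nonzerodivisors R"
    using R.mult_subset_nonzerodivisors by (simp add: localization_def rmodule_axioms)
  have "free_of_rank Q B e"
    using assms(1) by (simp add: has_rank_def total_quot_def to_total_quot_def[abs_def])
  then show ?thesis using base_change_free_generators[OF assms(2)] by blast
qed

text \<open>\<open>R\<close> embeds into its total ring of quotients, so the vanishing of
  \<open>r / 1\<close> gives that of \<open>r\<close>.\<close>

lemma rank_faithful:
  assumes "has_rank R M e" "e > 0" and r: "r \<in> carrier R"
    and zero: "\<And>x. x \<in> carrier M \<Longrightarrow> r \<odot>\<^bsub>M\<^esub> x = \<zero>\<^bsub>M\<^esub>"
  shows "r = \<zero>"
proof -
  interpret localization R M "nonzerodivisors R"
    using R.mult_subset_nonzerodivisors by (simp add: localization_def rmodule_axioms)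
  have "free_of_rank Q B e"
    using assms(1) by (simp add: has_rank_def total_quot_def to_total_quot_def[abs_def])
  then have "frR r \<one> = frR \<zero> \<one>" using base_change_free_faithful assms(2) r zero by blast
  then obtain u where "u \<in> nonzerodivisors R" "u \<otimes> (\<one> \<otimes> r) = u \<otimes> (\<one> \<otimes> \<zero>)"
    using self.frac_eq_iff[of r \<one> \<zero> \<one>] r S_one by auto
  then show ?thesis using r by (auto simp: nonzerodivisors_def)
qed

end

section \<open>Residual intersections\<close>

lemma height_prime_mono:
  assumes "primeideal p R" "primeideal q R" "p \<subseteq> q"
  shows "height_prime R p \<le> height_prime R q"
proof (cases "height_prime R q")
  case (enat h)
  show ?thesis
  proof (cases "p = q")
    case False
    then have "p \<subset> q" using assms(3) by blast
    then obtain k where "height_prime R p = enat k" "k < h"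
      using height_prime_less[OF assms(1,2) _ enat] by blast
    then show ?thesis using enat by simp
  qed simp
qed simp

text \<open>If \<open>t \<in> q\<close> were a nonzerodivisor, a prime avoiding the multiplicative set of all \<open>f t\<^sup>n\<close> with
  \<open>f \<notin> q\<close> would lie strictly below \<open>q\<close>.\<close>

lemma (in noetherian_cring) height_zero_no_nonzerodivisors:
  assumes q: "primeideal q R" and h: "height_prime R q = enat 0"
  shows "q \<inter> nonzerodivisors R = {}"
proof (rule ccontr)
  interpret q: primeideal q R by fact
  interpret T: mult_subset R "nonzerodivisors R" by (rule mult_subset_nonzerodivisors)
  assume "q \<inter> nonzerodivisors R \<noteq> {}"
  then obtain t where t: "t \<in> q" "t \<in> nonzerodivisors R" by auto
  then have tR: "t \<in> carrier R" using q.Icarr by simp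
  define S where "S = {f \<otimes> t [^] n | f n. f \<in> carrier R - q \<and> n \<in> (UNIV :: nat set)}"
  have pow: "t [^] n \<in> nonzerodivisors R" for n :: nat
    using T.S_one T.S_mult t(2) by (induction n) simp_all
  have S_mult: "x \<otimes> y \<in> S" if "x \<in> S" "y \<in> S" for x y
  proof -
    obtain f n g m where *: "f \<in> carrier R - q" "g \<in> carrier R - q" "x = f \<otimes> t [^] (n :: nat)"
      "y = g \<otimes> t [^] (m :: nat)" using \<open>x \<in> S\<close> \<open>y \<in> S\<close> unfolding S_def by blast
    then have "x \<otimes> y = (f \<otimes> g) \<otimes> t [^] (n + m)" using tR by (simp add: nat_pow_mult[symmetric] m_ac)
    then show ?thesis using primeideal_compl_mult[OF q *(1,2)] unfolding S_def by blast
  qed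
  have sub: "carrier R - q \<subseteq> S"
  proof
    fix f assume f: "f \<in> carrier R - q"
    then have "f = f \<otimes> t [^] (0 :: nat)" by simp
    then show "f \<in> S" using f unfolding S_def by blast
  qed
  have tS: "t \<in> S"
  proof -
    have "t = \<one> \<otimes> t [^] (1 :: nat)" using tR by simp
    then show ?thesis using primeideal_compl_one[OF q] unfolding S_def by blast
  qed
  have disj: "{\<zero>} \<inter> S = {}"
  proof -
    \<comment> \<open>The power of \<open>t\<close> is a nonzerodivisor, and \<open>f\<close> is
      nonzero because 0 lies in \<open>q\<close>.\<close>
    have nz: "f \<otimes> t [^] n \<noteq> \<zero>" if f: "f \<in> carrier R - q" for f and n :: nat
    proof
      assume "f \<otimes> t [^] n = \<zero>"
      then have "t [^] n \<otimes> f = \<zero>" using f tR by (simp add: m_comm)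
      then have "f = \<zero>" using pow[of n] f by (simp add: nonzerodivisors_def)
      then show False using f q.zero_closed by simp
    qed
    have "\<zero> \<notin> S"
    proof
      assume "\<zero> \<in> S"
      then obtain f n where fn: "f \<in> carrier R - q" "\<zero> = f \<otimes> t [^] (n :: nat)" unfolding S_def by blast
      from nz[OF fn(1)] fn(2)[symmetric] show False by (rule notE)
    qed
    then show ?thesis by blast
  qed
  have SR: "S \<subseteq> carrier R" using tR unfolding S_def by auto
  have one: "\<one> \<in> S" using sub primeideal_compl_one[OF q] by blast
  obtain p where p: "primeideal p R" "p \<inter> S = {}"
    by (rule primeideal_avoidingE[OF zeroideal disj one SR]) (erule (1) S_mult, rule that)
  interpret p: primeideal p R by fact
  \<comment> \<open>\<open>p\<close> avoids the complement of \<open>q\<close>, and \<open>t\<close>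
    lies in \<open>q\<close> but not in \<open>p\<close>.\<close>
  have "p \<subset> q" using p(2) sub tS t(1) p.a_subset by blast
  then obtain k where "k < (0 :: nat)" using height_prime_less[OF p(1) q _ h] by blast
  then show False by simp
qed

text \<open>The additive form avoids a truncated difference. For the unit ideal there is no prime to
  check, which agrees with its height \<infinity>.\<close>

lemma height_geI:
  assumes "\<And>p. primeideal p R \<Longrightarrow> I \<subseteq> p \<Longrightarrow> enat n \<le> height_prime R p + enat e"
  shows "enat n \<le> height R I + enat e"
proof -
  have "enat (n - e) \<le> height R I"
    unfolding height_def
  proof (rule INF_greatest)
    fix p assume "p \<in> {p. primeideal p R \<and> I \<subseteq> p}"
    then have "enat n \<le> height_prime R p + enat e" using assms by blast
    then show "enat (n - e) \<le> height_prime R p" by (cases "height_prime R p") auto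
  qed
  then show ?thesis by (cases "height R I") auto
qed

text \<open>A supremum of natural numbers reaches a positive \<open>n\<close> only through a member
  that does. For \<open>n = 0\<close> the zero ring would be an exception, since its empty supremum
  is 0.\<close>

lemma krull_dim_chainE:
  assumes "enat n \<le> krull_dim R" "0 < n"
  obtains p where "primeideal p R" "enat n \<le> height_prime R p"
proof -
  have "\<exists>m c. prime_chain R c m \<and> n \<le> m"
  proof (rule ccontr)
    assume "\<not> ?thesis"
    then have "krull_dim R \<le> enat (n - 1)"
      unfolding krull_dim_def by (intro SUP_least) (auto simp: not_le)
    with assms(1) have "enat n \<le> enat (n - 1)" by (rule order_trans)
    then show False using assms(2) by simp
  qed
  then obtain m c where mc: "prime_chain R c m" "n \<le> m" by blast
  then have "enat n \<le> height_prime R (c m)"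
    using height_prime_geI[OF mc(1) refl] by (metis enat_ord_simps(1) order_trans)
  then show thesis using that[of "c m"] mc(1) by (simp add: prime_chain_def)
qed

section \<open>Submodules and quotients at a prime\<close>

context rmodule
begin

text \<open>An element \<open>g \<notin> q\<close> with \<open>g M \<subseteq> W\<close> identifies
  the localizations of \<open>W\<close> and \<open>M\<close> at \<open>q\<close>; in both directions
  it becomes a factor of the multiplier.\<close>

lemma gens_at_submodule_iff:
  assumes q: "primeideal q R" and W: "submodule W R M" and c: "\<not> colon R M W \<subseteq> q" and U: "U \<subseteq> W"
  shows "gens_at R (M\<lparr>carrier := W\<rparr>) q U n \<longleftrightarrow> gens_at R M q U n"
proof -
  interpret W: rmodule R "M\<lparr>carrier := W\<rparr>"
    using rmodule.intro submodule.submodule_is_module[OF W module_axioms] by auto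
  have WM: "W \<subseteq> carrier M" by (rule submoduleE(1)[OF W])
  obtain g where g: "g \<in> carrier R - q" "\<And>x. x \<in> carrier M \<Longrightarrow> g \<odot>\<^bsub>M\<^esub> x \<in> W"
    using c by (auto simp: colon_def)
  show ?thesis
  proof
    assume "gens_at R (M\<lparr>carrier := W\<rparr>) q U n"
    then obtain A h where A: "finite A" "A \<subseteq> carrier (M\<lparr>carrier := W\<rparr>)" "card A \<le> n" "h \<in> carrier R - q"
      "\<And>x. x \<in> carrier (M\<lparr>carrier := W\<rparr>) \<Longrightarrow>
        h \<odot>\<^bsub>M\<lparr>carrier := W\<rparr>\<^esub> x \<in> span_module R (M\<lparr>carrier := W\<rparr>) (A \<union> U)"
      by (rule W.gens_atE) (rule that)
    show "gens_at R M q U n"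
    proof (rule gens_atI[of A _ "h \<otimes> g"])
      fix x assume x: "x \<in> carrier M"
      have "h \<odot>\<^bsub>M\<^esub> (g \<odot>\<^bsub>M\<^esub> x) \<in> span_module R M (A \<union> U)"
        using A(2,5) g(2)[OF x] span_restrict[OF W, of "A \<union> U"] U by simp
      then show "h \<otimes> g \<odot>\<^bsub>M\<^esub> x \<in> span_module R M (A \<union> U)"
        using x g(1) A(4) by (simp add: smult_assoc1)
    qed (use A WM primeideal_compl_mult[OF q A(4) g(1)] in auto)
  next
    assume "gens_at R M q U n"
    then obtain A h where A: "finite A" "A \<subseteq> carrier M" "card A \<le> n" "h \<in> carrier R - q"
      "\<And>x. x \<in> carrier M \<Longrightarrow> h \<odot>\<^bsub>M\<^esub> x \<in> span_module R M (A \<union> U)"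
      by (rule gens_atE) (rule that)
    let ?A = "(\<lambda>a. g \<odot>\<^bsub>M\<^esub> a) ` A"
    have AW: "?A \<subseteq> W" using A(2) g(2) by auto
    show "gens_at R (M\<lparr>carrier := W\<rparr>) q U n"
    proof (rule W.gens_atI[of ?A _ "g \<otimes> h"])
      fix x assume "x \<in> carrier (M\<lparr>carrier := W\<rparr>)"
      then have x: "x \<in> carrier M" using WM by auto
      have "g \<odot>\<^bsub>M\<^esub> (h \<odot>\<^bsub>M\<^esub> x) \<in> span_module R M (?A \<union> U)"
        using span_scale[OF A(5)[OF x] _ A(2)] g(1) U WM by auto
      then show "g \<otimes> h \<odot>\<^bsub>M\<lparr>carrier := W\<rparr>\<^esub> x \<in> span_module R (M\<lparr>carrier := W\<rparr>) (?A \<union> U)"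
        using x g(1) A(4) span_restrict[OF W, of "?A \<union> U"] AW U by (simp add: smult_assoc1)
    next
      show "card ?A \<le> n" using card_image_le[OF A(1), of "\<lambda>a. g \<odot>\<^bsub>M\<^esub> a"] A(3) by simp
      show "g \<otimes> h \<in> carrier R - q" by (rule primeideal_compl_mult[OF q g(1) A(4)])
    qed (use A(1) AW in auto)
  qed
qed

lemma gens_at_zero: "gens_at R M q U 0 \<longleftrightarrow> \<not> colon R M (span_module R M U) \<subseteq> q"
  unfolding gens_at_def by (auto intro!: exI[of _ "{}"])

lemma gens_at_of_finitely_generated:
  assumes "finitely_generated R M" "primeideal p R"
  shows "\<exists>n. gens_at R M p {} n"
proof -
  obtain A where A: "finite A" "A \<subseteq> carrier M" "span_module R M A = carrier M"
    using assms(1) by (auto simp: finitely_generated_def)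
  then have "gens_at R M p {} (card A)"
    using primeideal_compl_one[OF assms(2)] by (intro gens_atI[of A _ \<one>]) auto
  then show ?thesis ..
qed

text \<open>\<open>drop\<close> gives the upper bound. For the lower bound, lifts of generators of
  the quotient together with the at most \<open>s\<close> elements of \<open>U\<close> generate
  \<open>M\<close> at \<open>p\<close>.\<close>

lemma mu_at_quotient:
  assumes p: "primeideal p R" and fg: "finitely_generated R M"
    and U: "finite U" "U \<subseteq> carrier M" "card U \<le> s"
    and drop: "\<And>n. gens_at R M p {} n \<Longrightarrow> gens_at R M p U (n - s)"
  shows "mu_at R p (quotient_module M (span_module R M U)) = max 0 (mu_at R p M - enat s)"
proof -
  interpret MN: rmodule_quotient R M "span_module R M U"
    by (intro rmodule_quotient.intro rmodule_axioms rmodule_quotient_axioms.intro submodule_span[OF U(2)])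
  have quot: "mu_at R p (quotient_module M (span_module R M U)) \<le> enat n \<longleftrightarrow> gens_at R M p U n" for n
    using MN.MN.mu_at_le_iff[OF p MN.finitely_generated_quotient[OF fg]] MN.gens_at_quotient
    by (simp add: gens_at_def span_Un_span)
  have self: "mu_at R p M \<le> enat n \<longleftrightarrow> gens_at R M p {} n" for n
    by (rule mu_at_le_iff[OF p fg])
  have lift: "gens_at R M p {} (n + s)" if gU: "gens_at R M p U n" for n
  proof -
    obtain A h where A: "finite A" "A \<subseteq> carrier M" "card A \<le> n" "h \<in> carrier R - p"
      "\<And>x. x \<in> carrier M \<Longrightarrow> h \<odot>\<^bsub>M\<^esub> x \<in> span_module R M (A \<union> U)"
      by (rule gens_atE[OF gU]) (rule that)
    then show ?thesis
      using U card_Un_le[of A U] by (intro gens_atI[of "A \<union> U" _ h]) auto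
  qed
  obtain n where n: "gens_at R M p {} n" using gens_at_of_finitely_generated[OF fg p] by blast
  then obtain m where m: "mu_at R p M = enat m" using self by (metis enat_ile)
  have "mu_at R p (quotient_module M (span_module R M U)) \<le> enat (m - s)"
    using quot drop self m by (metis order_refl)
  then obtain k where k: "mu_at R p (quotient_module M (span_module R M U)) = enat k" "k \<le> m - s"
    by (metis enat_ile enat_ord_simps(1))
  have "mu_at R p M \<le> enat (k + s)" using self lift quot k(1) by (metis order_refl)
  then have "k = m - s" using m k(2) by simp
  then show ?thesis using k(1) m by (simp add: zero_enat_def)
qed

end

section \<open>Construction of the sequence and of residual intersections\<close>

context noetherian_module
begin

text \<open>\<open>G_cond\<close> begins at dimension 1, so primes of height 0 are left to the rank.
  For \<open>h > 0\<close>, the assumptions \<open>e > 0\<close> and \<open>h + e \<le> s\<close>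
  place \<open>h\<close> in its range, which ends at \<open>s - 1\<close>.\<close>

lemma gens_at_G_cond:
  assumes fg: "finitely_generated R M" and rank: "has_rank R M e" "e > 0" and G: "G_cond R M e s"
    and q: "primeideal q R" "height_prime R q = enat h" "h + e \<le> s"
  shows "gens_at R M q {} (h + e)"
proof (cases "h = 0")
  case True
  obtain A t where A: "finite A" "A \<subseteq> carrier M" "card A \<le> e" "t \<in> nonzerodivisors R"
    "\<forall>x\<in>carrier M. t \<odot>\<^bsub>M\<^esub> x \<in> span_module R M A"
    using rank_generators[OF rank(1) fg] by blast
  have "t \<in> carrier R - q"
    using height_zero_no_nonzerodivisors[OF q(1)] q(2) True A(4) by (auto simp: nonzerodivisors_def)
  then show ?thesis using A True by (intro gens_atI[of A _ t]) auto
next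
  case False
  have dim: "krull_dim (ring_at R q) = enat h" using krull_dim_ring_at[OF q(1)] q(2) by simp
  have "mu_at R q M \<le> enat h + enat e - 1"
    using G q(1,3) False rank(2) unfolding G_cond_def by (auto simp: dim one_enat_def)
  also have "\<dots> \<le> enat (h + e)" by (simp add: one_enat_def)
  finally show ?thesis using mu_at_le_iff[OF q(1) fg] by simp
qed

text \<open>\<open>W_eq\<close> amounts to \<open>ht (W : M) \<ge> s - e + 1\<close>; this generality is needed for \<open>W = p M\<close>, where \<open>p\<close> is only
  known to have height at least \<open>s - e + 1\<close>.\<close>

theorem residual_sequence:
  assumes fg: "finitely_generated R M" and rank: "has_rank R M e" "e > 0" and G: "G_cond R M e s"
    and P: "finite P" "\<forall>p\<in>P. primeideal p R"
    and W: "submodule W R M"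
    and W_eq: "\<forall>q h. primeideal q R \<and> height_prime R q = enat h \<and> h + e \<le> s \<longrightarrow> \<not> colon R M W \<subseteq> q"
  shows "\<exists>a. a \<in> {1..s} \<rightarrow> W \<and>
    (\<forall>p\<in>P. mu_at R p (quotient_module (M\<lparr>carrier := W\<rparr>) (span_module R M (a ` {1..s})))
        = max 0 (mu_at R p (M\<lparr>carrier := W\<rparr>) - enat s)) \<and>
    (\<forall>i\<le>s. height R (colon R M (span_module R M (a ` {1..i}))) + enat e \<ge> enat (i + 1))"
proof -
  let ?W = "M\<lparr>carrier := W\<rparr>"
  interpret W: rmodule R ?W
    using rmodule.intro submodule.submodule_is_module[OF W module_axioms] by auto
  \<comment> \<open>\<open>W\<close> becomes the ambient module, so that the general elements are
    chosen inside it.\<close>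
  interpret W: noetherian_module R ?W ..
  have WM: "\<not> colon R M W \<subseteq> q" if "primeideal q R" "height_prime R q = enat h" "h + e \<le> s" for q h
    using W_eq that by blast
  have P': "primeideal p R" if "p \<in> P" for p using P(2) that by blast
  have fgW: "finitely_generated R ?W" by (rule submodule_finitely_generated[OF fg W])
  \<comment> \<open>At these primes \<open>W\<close> and \<open>M\<close> agree locally, so the
    bound known for \<open>M\<close> starts the construction in \<open>W\<close>.\<close>
  have "\<forall>q h. primeideal q R \<and> height_prime R q = enat h \<and> h + e \<le> s \<longrightarrow> gens_at R ?W q {} (h + e)"
    using gens_at_submodule_iff[OF _ W WM empty_subsetI] gens_at_G_cond[OF fg rank G] by blast
  from W.general_elements[OF P this order_refl]
  obtain a where "a \<in> {1..s} \<rightarrow> carrier ?W" and all: "\<forall>i\<le>s.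
     (\<forall>p\<in>P. \<forall>n. gens_at R ?W p {} n \<longrightarrow> gens_at R ?W p (a ` {1..i}) (n - i)) \<and>
     (\<forall>q h. primeideal q R \<and> height_prime R q = enat h \<and> h + e \<le> s \<longrightarrow>
        gens_at R ?W q (a ` {1..i}) (h + e - i))"
    by (elim exE conjE) (rule that)
  then have a: "a \<in> {1..s} \<rightarrow> W" by simp
  have aP: "gens_at R ?W p (a ` {1..s}) (n - s)" if "p \<in> P" "gens_at R ?W p {} n" for p n
    using all that by blast
  have aq: "gens_at R ?W q (a ` {1..i}) (h + e - i)"
    if "i \<le> s" "primeideal q R" "height_prime R q = enat h" "h + e \<le> s" for i q h
    using all that by blast
  have aW: "a ` {1..i} \<subseteq> W" if "i \<le> s" for i using a that by auto
  have "mu_at R p (quotient_module ?W (span_module R M (a ` {1..s}))) = max 0 (mu_at R p ?W - enat s)"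
    if p: "p \<in> P" for p
  proof -
    have "card (a ` {1..s}) \<le> s" using card_image_le[of "{1..s}" a] by simp
    then show ?thesis
      using W.mu_at_quotient[OF P'[OF p] fgW _ _ _ aP[OF p]] aW[OF order_refl]
        span_restrict[OF W aW[OF order_refl]] by simp
  qed
  moreover have "height R (colon R M (span_module R M (a ` {1..i}))) + enat e \<ge> enat (i + 1)"
    if i: "i \<le> s" for i
  proof (rule height_geI, rule ccontr)
    fix p assume p: "primeideal p R" "colon R M (span_module R M (a ` {1..i})) \<subseteq> p"
      and "\<not> enat (i + 1) \<le> height_prime R p + enat e"
    then obtain h where h: "height_prime R p = enat h" "h + e \<le> i"
      by (cases "height_prime R p") auto
    have "h + e \<le> s" using h(2) i by simp
    \<comment> \<open>With \<open>h + e \<le> i\<close> the bound \<open>h + e - i\<close> is 0: the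
      first \<open>i\<close> elements generate at \<open>p\<close>, so their colon ideal cannot lie
      in \<open>p\<close>.\<close>
    then have "gens_at R ?W p (a ` {1..i}) 0" using aq[OF i p(1) h(1)] h(2) by simp
    then have "gens_at R M p (a ` {1..i}) 0"
      using gens_at_submodule_iff[OF p(1) W WM[OF p(1) h(1) \<open>h + e \<le> s\<close>] aW[OF i]] by simp
    then show False using p(2) gens_at_zero by blast
  qed
  ultimately show ?thesis using a by blast
qed

text \<open>Nakayama's lemma at \<open>p\<close>: positive rank makes \<open>M\<close> faithful, so
  its localization at \<open>p\<close> is nonzero, and the proper submodule supplied by
  \<open>gens_at_dropE\<close> contains \<open>p M\<close>.\<close>

lemma prime_submodule_proper:
  assumes fg: "finitely_generated R M" and rank: "has_rank R M e" "e > 0" and p: "primeideal p R"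
  shows "span_module R M {r \<odot>\<^bsub>M\<^esub> x | r x. r \<in> p \<and> x \<in> carrier M} \<noteq> carrier M" (is "span_module R M ?A \<noteq> _")
proof -
  interpret p: primeideal p R by fact
  obtain k where k: "gens_at R M p {} k" using gens_at_of_finitely_generated[OF fg p] by blast
  have not0: "\<not> gens_at R M p {} 0"
  proof
    assume "gens_at R M p {} 0"
    then obtain f where f: "f \<in> carrier R - p" "\<And>x. x \<in> carrier M \<Longrightarrow> f \<odot>\<^bsub>M\<^esub> x \<in> span_module R M {}"
      unfolding gens_at_zero by (auto simp: colon_def)
    then have "f = \<zero>" using rank_faithful[OF rank, of f] span_empty by auto
    then show False using f(1) p.zero_closed by simp
  qed
  have "\<exists>n. gens_at R M p {} (Suc n) \<and> \<not> gens_at R M p {} n"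
  proof (rule ccontr)
    assume "\<not> ?thesis"
    then have "gens_at R M p {} j \<Longrightarrow> gens_at R M p {} 0" for j by (induction j) auto
    then show False using k not0 by blast
  qed
  then obtain n where n: "gens_at R M p {} (Suc n)" "\<not> gens_at R M p {} n" by blast
  obtain N where N: "submodule N R M" "N \<noteq> carrier M"
    "\<And>r x. r \<in> p \<Longrightarrow> x \<in> carrier M \<Longrightarrow> r \<odot>\<^bsub>M\<^esub> x \<in> N"
    by (rule gens_at_dropE[OF p _ n]) (simp, rule that)
  have "span_module R M ?A \<subseteq> N" by (rule span_minimal[OF N(1)]) (use N(3) in blast)
  then show ?thesis using N(2) submoduleE(1)[OF N(1)] by blast
qed

lemma residual_intersection_exists:
  assumes fg: "finitely_generated R M" and rank: "has_rank R M e" "e > 0" and G: "G_cond R M e s"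
    and i: "e \<le> i" "i \<le> s" "krull_dim R + enat e \<ge> enat (i + 1)"
  shows "\<exists>K. residual_intersection R M e i K"
proof -
  \<comment> \<open>Because \<open>e \<le> i\<close>, this number is positive, as
    \<open>krull_dim_chainE\<close> demands.\<close>
  have "enat (i + 1 - e) \<le> krull_dim R" using i(3) by (cases "krull_dim R") auto
  then obtain p where p: "primeideal p R" "enat (i + 1 - e) \<le> height_prime R p"
    using krull_dim_chainE[of "i + 1 - e" R] i(1) by auto
  interpret p: primeideal p R by fact
  let ?A = "{r \<odot>\<^bsub>M\<^esub> x | r x. r \<in> p \<and> x \<in> carrier M}"
  let ?W = "span_module R M ?A"
  have A: "?A \<subseteq> carrier M" using p.Icarr by auto
  have W: "submodule ?W R M" by (rule submodule_span[OF A])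
  have "p \<subseteq> colon R M ?W"
  proof
    fix r assume r: "r \<in> p"
    have "r \<odot>\<^bsub>M\<^esub> x \<in> ?W" if "x \<in> carrier M" for x
      by (rule span_superset) (use r that in blast)
    then show "r \<in> colon R M ?W" using r p.Icarr by (simp add: colon_def)
  qed
  \<comment> \<open>A prime over the colon ideal contains \<open>p\<close>, so its height is at
    least \<open>i + 1 - e\<close>.\<close>
  have col: "\<forall>q h. primeideal q R \<and> height_prime R q = enat h \<and> h + e \<le> i \<longrightarrow> \<not> colon R M ?W \<subseteq> q"
  proof (intro allI impI notI)
    fix q h assume q: "primeideal q R \<and> height_prime R q = enat h \<and> h + e \<le> i" and "colon R M ?W \<subseteq> q"
    then have "p \<subseteq> q" using \<open>p \<subseteq> colon R M ?W\<close> by blast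
    then have "height_prime R p \<le> enat h" using height_prime_mono[OF p(1), of q] q by auto
    with p(2) have "enat (i + 1 - e) \<le> enat h" by (rule order_trans)
    then have "i + 1 - e \<le> h" by simp
    then show False using q by linarith
  qed
  \<comment> \<open>A smaller index restricts the range of dimensions in \<open>G_cond\<close>; the
    bound itself does not involve it.\<close>
  have Gi: "G_cond R M e i"
    using G i(2) unfolding G_cond_def by (meson diff_le_mono enat_ord_simps(1) order_trans)
  obtain a where a: "a \<in> {1..i} \<rightarrow> ?W"
    "\<forall>j\<le>i. height R (colon R M (span_module R M (a ` {1..j}))) + enat e \<ge> enat (j + 1)"
    using residual_sequence[OF fg rank Gi finite.emptyI _ W col] by blast
  let ?U = "span_module R M (a ` {1..i})"
  have aM: "a ` {1..i} \<subseteq> carrier M" using a(1) submoduleE(1)[OF W] by auto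
  have U: "submodule ?U R M" by (rule submodule_span[OF aM])
  have "?U \<subseteq> ?W" by (rule span_minimal[OF W]) (use a(1) in auto)
  \<comment> \<open>If the colon ideal contained 1, then \<open>?U\<close> and with it
    \<open>?W\<close>, that is, the product of \<open>p\<close> and \<open>M\<close>, would be all
    of \<open>M\<close>.\<close>
  have "colon R M ?U \<noteq> carrier R"
  proof
    assume "colon R M ?U = carrier R"
    then have "\<one> \<in> colon R M ?U" by simp
    then have "carrier M \<subseteq> ?U" by (auto simp: colon_def)
    then have "?W = carrier M" using \<open>?U \<subseteq> ?W\<close> submoduleE(1)[OF W] by blast
    then show False using prime_submodule_proper[OF fg rank p(1)] by blast
  qed
  moreover have "a \<in> {1..i} \<rightarrow> carrier M" using aM by auto
  ultimately have "residual_intersection R M e i (colon R M ?U)"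
    unfolding residual_intersection_def using i(1) colon_ideal[OF U] a(2) by auto
  then show ?thesis ..
qed

end

section \<open>Transport along isomorphisms\<close>

lemma module_iso_colon:
  assumes M: "rmodule R M" and N: "rmodule R N" and iso: "module_iso R M N \<phi>" and A: "A \<subseteq> carrier M"
  shows "colon R N (span_module R N (\<phi> ` A)) = colon R M (span_module R M A)"
proof -
  interpret M: rmodule R M by fact
  interpret N: rmodule R N by fact
  have bij: "\<phi> ` carrier M = carrier N" "inj_on \<phi> (carrier M)"
    and add: "\<And>x y. x \<in> carrier M \<Longrightarrow> y \<in> carrier M \<Longrightarrow> \<phi> (x \<oplus>\<^bsub>M\<^esub> y) = \<phi> x \<oplus>\<^bsub>N\<^esub> \<phi> y"
    and smult: "\<And>r x. r \<in> carrier R \<Longrightarrow> x \<in> carrier M \<Longrightarrow> \<phi> (r \<odot>\<^bsub>M\<^esub> x) = r \<odot>\<^bsub>N\<^esub> \<phi> x"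
    using iso by (auto simp: module_iso_def bij_betw_def)
  have closed: "\<And>x. x \<in> carrier M \<Longrightarrow> \<phi> x \<in> carrier N" using bij(1) by auto
  have zero: "\<phi> \<zero>\<^bsub>M\<^esub> = \<zero>\<^bsub>N\<^esub>"
    using smult[of "\<zero>\<^bsub>R\<^esub>" "\<zero>\<^bsub>M\<^esub>"] closed by simp
  note sA = M.submodule_span[OF A]
  have \<phi>A: "\<phi> ` A \<subseteq> carrier N" using A closed by auto
  note sN = N.submodule_span[OF \<phi>A]
  have AM: "span_module R M A \<subseteq> carrier M" by (rule M.span_closed[OF A])
  have "submodule (\<phi> ` span_module R M A) R N"
  proof (rule N.submoduleI2)
    show "\<phi> ` span_module R M A \<subseteq> carrier N" using AM closed by auto
    show "\<zero>\<^bsub>N\<^esub> \<in> \<phi> ` span_module R M A" using M.submodule_zero[OF sA] zero by (metis imageI)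
  next
    fix x y assume "x \<in> \<phi> ` span_module R M A" "y \<in> \<phi> ` span_module R M A"
    then obtain u v where "u \<in> span_module R M A" "v \<in> span_module R M A" "x = \<phi> u" "y = \<phi> v" by blast
    then have "x \<oplus>\<^bsub>N\<^esub> y = \<phi> (u \<oplus>\<^bsub>M\<^esub> v)" "u \<oplus>\<^bsub>M\<^esub> v \<in> span_module R M A"
      using M.submodule_add[OF sA, of u v] add[OF subsetD[OF AM] subsetD[OF AM], of u v] by simp_all
    then show "x \<oplus>\<^bsub>N\<^esub> y \<in> \<phi> ` span_module R M A" by blast
  next
    fix r x assume r: "r \<in> carrier R" and "x \<in> \<phi> ` span_module R M A"
    then obtain u where "u \<in> span_module R M A" "x = \<phi> u" by blast
    then have "r \<odot>\<^bsub>N\<^esub> x = \<phi> (r \<odot>\<^bsub>M\<^esub> u)" "r \<odot>\<^bsub>M\<^esub> u \<in> span_module R M A"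
      using r M.submodule_smult[OF sA, of r u] AM smult[of r u] by auto
    then show "r \<odot>\<^bsub>N\<^esub> x \<in> \<phi> ` span_module R M A" by blast
  qed
  then have 1: "span_module R N (\<phi> ` A) \<subseteq> \<phi> ` span_module R M A"
    by (rule N.span_minimal) (use M.span_subset[of A] in blast)
  have "submodule {x \<in> carrier M. \<phi> x \<in> span_module R N (\<phi> ` A)} R M"
    by (rule M.submoduleI2)
      (use N.submodule_zero[OF sN] N.submodule_add[OF sN] N.submodule_smult[OF sN] zero add smult in auto)
  then have 2: "span_module R M A \<subseteq> {x \<in> carrier M. \<phi> x \<in> span_module R N (\<phi> ` A)}"
    by (rule M.span_minimal) (use A N.span_subset[of "\<phi> ` A"] in blast)
  have mem: "\<phi> x \<in> span_module R N (\<phi> ` A) \<longleftrightarrow> x \<in> span_module R M A" if x: "x \<in> carrier M" for x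
  proof
    assume "\<phi> x \<in> span_module R N (\<phi> ` A)"
    then obtain y where "y \<in> span_module R M A" "\<phi> x = \<phi> y" using 1 by blast
    then show "x \<in> span_module R M A" using inj_onD[OF bij(2)] x AM by blast
  qed (use 2 in blast)
  show ?thesis
    unfolding colon_def bij(1)[symmetric] using mem smult M.smult_closed by (auto simp flip: smult)
qed

text \<open>Replacing \<open>u\<close> by \<open>\<phi> \<circ> u\<close> leaves the colon ideal
  unchanged. This carries the existence result from \<open>E\<close> to the ideals isomorphic to
  it.\<close>

lemma residual_intersection_module_iso:
  assumes "rmodule R M" "rmodule R N" "module_iso R M N \<phi>" "residual_intersection R M e i K"
  shows "residual_intersection R N e i K"
proof -
  obtain u where u: "u \<in> {1..i} \<rightarrow> carrier M" "K = colon R M (span_module R M (u ` {1..i}))"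
    using assms(4) by (auto simp: residual_intersection_def)
  then have "u ` {1..i} \<subseteq> carrier M" by auto
  then have "K = colon R N (span_module R N ((\<phi> \<circ> u) ` {1..i}))"
    using module_iso_colon[OF assms(1-3)] u(2) by (simp only: image_comp[symmetric])
  moreover have "\<phi> \<circ> u \<in> {1..i} \<rightarrow> carrier N"
    using u(1) assms(3) by (fastforce simp: module_iso_def bij_betw_def)
  ultimately show ?thesis
    using assms(4) unfolding residual_intersection_def by blast
qed

text \<open>The dimension condition in the second part is forced: a proper ideal of height at least
  i - e + 1 lies in a prime of at least that height. The clause on ideals handles the convention
  that compares \<open>i\<close> with the height of \<open>I\<close>, which an isomorphism of
  modules does not see.\<close>

theorem proposition2p3:
  fixes R :: "('a, 'm) ring_scheme"
    and E :: "('a, 'b) module"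
    and P :: "'a set set"
    and W :: "'b set"
    and e s :: nat
  assumes "noetherian_ring R"
    and "finite P" and "\<forall>p\<in>P. primeideal p R"
    and "module R E" and "finitely_generated R E"
    and "has_rank R E e" and "e > 0"
    and "submodule W R E" and "height R (colon R E W) \<ge> enat s"
    and "G_cond R E e s"
  shows
    "(\<exists>a. a \<in> {1..s} \<rightarrow> W \<and>
        (\<forall>p\<in>P. mu_at R p (quotient_module (E\<lparr>carrier := W\<rparr>) (span_module R E (a ` {1..s})))
                = max 0 (mu_at R p (E\<lparr>carrier := W\<rparr>) - enat s)) \<and>
        (\<forall>i\<le>s. height R (colon R E (span_module R E (a ` {1..i}))) + enat e \<ge> enat (i + 1)))
     \<and>
     (\<forall>i. e \<le> i \<and> i \<le> s \<and> krull_dim R + enat e \<ge> enat (i + 1) \<longrightarrow>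
        (\<exists>K. residual_intersection R E e i K) \<and>
        (\<forall>I \<phi>. ideal I R \<and> module_iso R E (ideal_module R I) \<phi> \<and>
               (0 < grade R I \<longrightarrow> height R I \<le> enat i) \<longrightarrow>
           (\<exists>K. ideal_residual_intersection R I e i K)))"
proof -
  have E: "rmodule R E" using assms(4) by (rule rmodule.intro)
  interpret noetherian_module R E
    using E assms(1) by (rule noetherian_module.intro)
  \<comment> \<open>\<open>e > 0\<close> turns \<open>h + e \<le> s\<close> into
    \<open>h < s\<close>, which is too small for a prime over the colon ideal of
    \<open>W\<close>.\<close>
  have "\<forall>q h. primeideal q R \<and> height_prime R q = enat h \<and> h + e \<le> s \<longrightarrow> \<not> colon R E W \<subseteq> q"
  proof (intro allI impI notI)
    fix q h assume q: "primeideal q R \<and> height_prime R q = enat h \<and> h + e \<le> s"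
      and "colon R E W \<subseteq> q"
    then have "height R (colon R E W) \<le> height_prime R q"
      unfolding height_def using q by (intro INF_lower) simp
    then have "enat s \<le> enat h" using assms(9) q by (metis order_trans)
    then show False using q assms(7) by simp
  qed
  note seq = residual_sequence[OF assms(5,6,7,10,2,3,8) this]
  have ex: "\<exists>K. residual_intersection R E e i K"
    if "e \<le> i \<and> i \<le> s \<and> krull_dim R + enat e \<ge> enat (i + 1)" for i
    using residual_intersection_exists[OF assms(5,6,7,10)] that by blast
  have "\<exists>K. ideal_residual_intersection R I e i K"
    if i: "e \<le> i \<and> i \<le> s \<and> krull_dim R + enat e \<ge> enat (i + 1)"
      and I: "ideal I R \<and> module_iso R E (ideal_module R I) \<phi> \<and> (0 < grade R I \<longrightarrow> height R I \<le> enat i)"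
    for i I \<phi>
  proof -
    have "rmodule R (ideal_module R I)" using R.rmodule_ideal_module I by blast
    then show ?thesis
      using residual_intersection_module_iso[OF E _ conjunct1[OF conjunct2[OF I]]] ex[OF i] I
      unfolding ideal_residual_intersection_def by blast
  qed
  with seq ex show ?thesis by blast
qed

end
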